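(* For every $X\in 2^\omega$ there is a Martin-L\"of random sequence $Y\in 2^\omega$ such that \[ d(X,Y)\le \tfrac12 - H^{-1}(\dim(X)). \]
   Context: $2^\omega$ is the space of infinite binary sequences and $Z\upharpoonright_n$ is the $n$-bit prefix of $Z$. $K$ denotes prefix-free Kolmogorov complexity. The effective Hausdorff dimension of $X\in 2^\omega$ is $\dim(X)=\liminf_{n\to\infty} K(X\upharpoonright_n)/n$. A sequence $Y$ is Martin-L\"of random (with respect to the uniform measure) iff there is a constant $c$ with $K(Y\upharpoonright_n)\ge n-c$ for all $n$. For $n\ge 1$ and $\sigma,\tau\in\{0,1\}^n$, $d(\sigma,\tau)=\#\{k:\sigma(k)\ne\tau(k)\}/n$; for $X,Y\in 2^\omega$, $d(X,Y)=\limsup_{n\to\infty} d(X\upharpoonright_n,Y\upharpoonright_n)$. $H(p)=-(p\log_2 p+(1-p)\log_2(1-p))$ is the binary entropy function on $[0,1]$ (with $H(0)=H(1)=0$), and $H^{-1}:[0,1]\to[0,1/2]$ is the inverse of the restriction of $H$ to $[0,1/2]$. *)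

theory Defs
  imports Complex_Main "HOL-Library.Extended_Real" "HOL-Library.Liminf_Limsup"
    "HOL-Library.Sublist" "HOL-Real_Asymp.Real_Asymp"
begin

text \<open>
  Partial recursive functions on tuples of natural numbers. Arities are not tracked: a term
  applied to too few arguments is undefined, surplus arguments are ignored by \<open>Zero\<close> and \<open>Succ\<close>.
  In \<open>PrimRec f g\<close> the recursion argument comes first, and \<open>g\<close> receives the counter, the
  previous value and the parameters, in this order.
\<close>

datatype recf =
    Zero
  | Succ
  | Proj nat
  | Comp recf "recf list"
  | PrimRec recf recf
  | Minim recf

inductive evaluates :: "recf \<Rightarrow> nat list \<Rightarrow> nat \<Rightarrow> bool" where
  zero: "evaluates Zero xs 0"
| succ: "evaluates Succ (x # xs) (Suc x)"
| proj: "i < length xs \<Longrightarrow> evaluates (Proj i) xs (xs ! i)"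
| comp: "list_all2 (\<lambda>g y. evaluates g xs y) gs ys \<Longrightarrow> evaluates f ys z
    \<Longrightarrow> evaluates (Comp f gs) xs z"
| primrec_0: "evaluates f xs y \<Longrightarrow> evaluates (PrimRec f g) (0 # xs) y"
| primrec_Suc: "evaluates (PrimRec f g) (n # xs) r \<Longrightarrow> evaluates g (n # r # xs) y
    \<Longrightarrow> evaluates (PrimRec f g) (Suc n # xs) y"
| minim: "evaluates f (y # xs) 0 \<Longrightarrow> (\<And>z. z < y \<Longrightarrow> \<exists>v. 0 < v \<and> evaluates f (z # xs) v)
    \<Longrightarrow> evaluates (Minim f) xs y"

lemma evaluates_deterministic:
  "evaluates f xs y \<Longrightarrow> evaluates f xs z \<Longrightarrow> y = z"
proof (induction arbitrary: z rule: evaluates.induct)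
  case (comp xs gs ys f u)
  from comp.prems obtain ys' where ys': "list_all2 (\<lambda>g y. evaluates g xs y) gs ys'"
      and ev: "evaluates f ys' z"
    by (cases rule: evaluates.cases) auto
  have "ys = ys'"
    using comp.IH(1) ys' by (auto simp: list_all2_conv_all_nth intro!: nth_equalityI)
  then show ?case using comp.IH(2) ev by blast
next
  case (primrec_Suc f g n xs r y)
  from primrec_Suc.prems obtain r' where "evaluates (PrimRec f g) (n # xs) r'"
      and "evaluates g (n # r' # xs) z"
    by (cases rule: evaluates.cases) auto
  then show ?case using primrec_Suc.IH by metis
next
  case (minim f y xs)
  from minim.prems have z0: "evaluates f (z # xs) 0"
      and zl: "\<And>w. w < z \<Longrightarrow> \<exists>v. 0 < v \<and> evaluates f (w # xs) v"
    by (cases rule: evaluates.cases; auto)+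
  have "\<not> z < y" using minim.IH(2) z0 by fastforce
  moreover have "\<not> y < z" using minim.IH(1) zl by fastforce
  ultimately show ?case by simp
qed (erule evaluates.cases; auto)+

text \<open>Bijective base-2 numeration, identifying binary strings with natural numbers.\<close>

fun str_code :: "bool list \<Rightarrow> nat" where
  "str_code [] = 0"
| "str_code (b # \<sigma>) = 2 * str_code \<sigma> + (if b then 2 else 1)"

lemma bij_str_code: "bij str_code"
proof (rule bijI)
  show "inj str_code"
  proof (rule injI)
    fix \<sigma> \<tau> show "str_code \<sigma> = str_code \<tau> \<Longrightarrow> \<sigma> = \<tau>"
    proof (induction \<sigma> arbitrary: \<tau>)
      case Nil then show ?case by (cases \<tau>) (auto split: if_splits)
    next
      case (Cons b \<sigma>)
      then obtain c \<tau>' where \<tau>: "\<tau> = c # \<tau>'" by (cases \<tau>) (auto split: if_splits)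
      with Cons.prems have "2 * str_code \<sigma> + (if b then 2 else 1)
        = 2 * str_code \<tau>' + (if c then 2 else 1)" by simp
      then have "b = c \<and> str_code \<sigma> = str_code \<tau>'" by (auto split: if_splits) presburger+
      then show ?case using Cons.IH \<tau> by blast
    qed
  qed
  have "\<exists>\<sigma>. str_code \<sigma> = n" for n
  proof (induction n rule: less_induct)
    case (less n)
    show ?case
    proof (cases "n = 0")
      case True then show ?thesis by (intro exI[of _ "[]"]) simp
    next
      case False
      then have "(n - 1) div 2 < n" by simp
      then obtain \<sigma> where "str_code \<sigma> = (n - 1) div 2" using less by blast
      then have "str_code (even n # \<sigma>) = n" using False by (auto elim!: evenE oddE)
      then show ?thesis by blast
    qed
  qed
  then show "surj str_code" by (metis surjI)
qed

definition partial_computable :: "(bool list \<Rightarrow> bool list option) \<Rightarrow> bool" where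
  "partial_computable M \<longleftrightarrow>
     (\<exists>f. \<forall>\<sigma> \<tau>. M \<sigma> = Some \<tau> \<longleftrightarrow> evaluates f [str_code \<sigma>] (str_code \<tau>))"

definition prefix_free :: "bool list set \<Rightarrow> bool" where
  "prefix_free A \<longleftrightarrow> (\<forall>\<sigma>\<in>A. \<forall>\<tau>\<in>A. prefix \<sigma> \<tau> \<longrightarrow> \<sigma> = \<tau>)"

definition prefix_free_machine :: "(bool list \<Rightarrow> bool list option) \<Rightarrow> bool" where
  "prefix_free_machine M \<longleftrightarrow> partial_computable M \<and> prefix_free (dom M)"

definition optimal_machine :: "(bool list \<Rightarrow> bool list option) \<Rightarrow> bool" where
  "optimal_machine U \<longleftrightarrow> prefix_free_machine U \<and>
     (\<forall>M. prefix_free_machine M \<longrightarrow>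
       (\<exists>c. \<forall>p \<sigma>. M p = Some \<sigma> \<longrightarrow> (\<exists>q. U q = Some \<sigma> \<and> length q \<le> length p + c)))"

text \<open>
  Prefix-free complexity relative to a reference machine \<open>U\<close>. It is only meaningful when every
  string has a \<open>U\<close>-description, which holds whenever \<open>U\<close> is optimal.
\<close>

definition KC :: "(bool list \<Rightarrow> bool list option) \<Rightarrow> bool list \<Rightarrow> nat" where
  "KC U \<sigma> = (LEAST n. \<exists>p. U p = Some \<sigma> \<and> length p = n)"

definition initial_seg :: "(nat \<Rightarrow> bool) \<Rightarrow> nat \<Rightarrow> bool list" where
  "initial_seg X n = map X [0..<n]"

text \<open>
  The limits inferior and superior are taken in the extended reals, where they always exist.
  Both lie in the unit interval (for the dimension: when \<open>U\<close> is optimal), so passing back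
  to the reals loses nothing. The junk value at \<open>n = 0\<close> is irrelevant to the limits.
\<close>

definition eff_dim :: "(bool list \<Rightarrow> bool list option) \<Rightarrow> (nat \<Rightarrow> bool) \<Rightarrow> real" where
  "eff_dim U X =
     real_of_ereal (liminf (\<lambda>n. ereal (real (KC U (initial_seg X n)) / real n)))"

definition martin_loef_random :: "(bool list \<Rightarrow> bool list option) \<Rightarrow> (nat \<Rightarrow> bool) \<Rightarrow> bool" where
  "martin_loef_random U Y \<longleftrightarrow> (\<exists>c::nat. \<forall>n. real (KC U (initial_seg Y n)) \<ge> real n - real c)"

definition str_dist :: "bool list \<Rightarrow> bool list \<Rightarrow> real" where
  "str_dist \<sigma> \<tau> = real (card {k. k < length \<sigma> \<and> \<sigma> ! k \<noteq> \<tau> ! k}) / real (length \<sigma>)"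

definition seq_dist :: "(nat \<Rightarrow> bool) \<Rightarrow> (nat \<Rightarrow> bool) \<Rightarrow> real" where
  "seq_dist X Y =
     real_of_ereal (limsup (\<lambda>n. ereal (str_dist (initial_seg X n) (initial_seg Y n))))"

text \<open>Since \<open>log 2 0 = 0\<close>, this gives the value \<open>0\<close> at both endpoints of the unit interval.\<close>

definition bin_entropy :: "real \<Rightarrow> real" where
  "bin_entropy p = - (p * log 2 p + (1 - p) * log 2 (1 - p))"

lemma bij_betw_bin_entropy: "bij_betw bin_entropy {0..1/2} {0..1}"
proof -
  have xlogx: "((\<lambda>x::real. x * log 2 x) \<longlongrightarrow> 0) (at_right 0)"
  proof -
    have "((\<lambda>x::real. x * ln x) \<longlongrightarrow> 0) (at_right 0)"
      by real_asymp
    then have "((\<lambda>x::real. x * ln x / ln 2) \<longlongrightarrow> 0 / ln 2) (at_right 0)"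
      by (intro tendsto_intros) auto
    then show ?thesis by (simp add: log_def)
  qed
  have cont: "continuous_on {0..1/2} bin_entropy"
  proof (rule continuous_on_eq_continuous_within[THEN iffD2, rule_format])
    fix x :: real assume x: "x \<in> {0..1/2}"
    have "((\<lambda>x. x * log 2 x) \<longlongrightarrow> x * log 2 x) (at x within {0..1/2})"
    proof (cases "x = 0")
      case True
      have "((\<lambda>x::real. x * log 2 x) \<longlongrightarrow> 0) (at 0 within {0..1/2})"
      proof -
        have "(at (0::real) within {0..1/2}) \<le> at_right 0"
          unfolding at_within_def by (intro inf_mono order_refl) auto
        then show ?thesis using xlogx by (rule tendsto_mono)
      qed
      then show ?thesis using True by simp
    next
      case False
      then show ?thesis using x by (intro tendsto_intros) auto
    qed
    moreover have "((\<lambda>x. (1 - x) * log 2 (1 - x)) \<longlongrightarrow> (1 - x) * log 2 (1 - x)) (at x within {0..1/2})"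
      using x by (intro tendsto_intros) auto
    ultimately show "continuous (at x within {0..1/2}) bin_entropy"
      unfolding continuous_within bin_entropy_def by (intro tendsto_minus tendsto_add)
  qed
  have mono: "bin_entropy x < bin_entropy y" if "0 \<le> x" "x < y" "y \<le> 1/2" for x y
  proof (rule DERIV_pos_imp_increasing_open[OF \<open>x < y\<close>])
    fix p assume p: "x < p" "p < y"
    have "((\<lambda>p. - (p * ln p + (1 - p) * ln (1 - p))) has_real_derivative ln (1 - p) - ln p) (at p)"
      using p that by (auto intro!: derivative_eq_intros)
    from DERIV_cdivide[OF this, of "ln 2"]
    have "(bin_entropy has_real_derivative (ln (1 - p) - ln p) / ln 2) (at p)"
      by (simp add: bin_entropy_def [abs_def] log_def add_divide_distrib diff_divide_distrib)
    moreover have "0 < (ln (1 - p) - ln p) / ln 2" using p that by simp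
    ultimately show "\<exists>z. (bin_entropy has_real_derivative z) (at p) \<and> 0 < z" by blast
  next
    show "continuous_on {x..y} bin_entropy"
      by (rule continuous_on_subset[OF cont]) (use that in auto)
  qed
  have e0: "bin_entropy 0 = 0" and e1: "bin_entropy (1/2) = 1"
    by (simp_all add: bin_entropy_def log_divide)
  have "inj_on bin_entropy {0..1/2}"
    by (rule linorder_inj_onI) (use mono in force)+
  moreover have "bin_entropy ` {0..1/2} = {0..1}"
  proof
    show "bin_entropy ` {0..1/2} \<subseteq> {0..1}"
    proof clarify
      fix p :: real assume p: "p \<in> {0..1/2}"
      then have "bin_entropy 0 \<le> bin_entropy p" "bin_entropy p \<le> bin_entropy (1/2)"
        using mono[of 0 p] mono[of p "1/2"]
        by (cases "p = 0"; cases "p = 1/2"; force)+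
      then show "bin_entropy p \<in> {0..1}" using e0 e1 by simp
    qed
    show "{0..1} \<subseteq> bin_entropy ` {0..1/2}"
    proof
      fix y :: real assume "y \<in> {0..1}"
      then show "y \<in> bin_entropy ` {0..1/2}"
        using IVT'[of bin_entropy 0 y "1/2"] cont e0 e1 by auto
    qed
  qed
  ultimately show ?thesis by (simp add: bij_betw_def)
qed

definition bin_entropy_inv :: "real \<Rightarrow> real" where
  "bin_entropy_inv = the_inv_into {0..1/2} bin_entropy"

end

theory Submission
  imports Defs "HOL-Library.Discrete_Functions"
begin

text \<open>
  Fix \<open>X\<close> of effective dimension \<open>s = H(\<theta>)\<close> with \<open>\<theta> \<le> 1/2\<close>. Let \<open>M(y)\<close> be the martingale
  obtained by averaging \<open>Y \<mapsto> \<Sum> 2^(length z - length p)\<close>, the sum over all \<open>U p = z\<close> with \<open>z\<close> a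
  prefix of \<open>Y\<close>; its initial value is at most 1 by the Kraft inequality. Every prefix of a string \<open>y\<close>
  with \<open>M(y) < 2\<close> has complexity at least its length, so it is enough to find a path \<open>Y\<close> on which
  \<open>q(y) = 1 - M(y)/2\<close> stays positive and which stays close to \<open>X\<close>. The quantity \<open>q\<close> satisfies
  \<open>2 q(y) \<le> q(y0) + q(y1)\<close> and is approximated computably from above.

  A companion \<open>y\<close> of \<open>\<sigma>\<close> is evaluated by the potential \<open>exp(t d) q(y)^(-\<alpha>)\<close>, where \<open>d\<close> counts the
  places where \<open>\<sigma>\<close> and \<open>y\<close> differ. If for each of the two extensions \<open>\<sigma>b\<close> a suitable child of \<open>y\<close> is
  chosen, the sum of the two new potentials is at most \<open>2 cosh(t/2) cosh(t/(2\<alpha>))^\<alpha>\<close> times the old one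
  (lemma \<open>two_point\<close>). This is a dimension-free form of the isoperimetric inequality in the Hamming
  cube. As \<open>\<alpha>\<close> grows, the last factor tends to 1, and minimising over \<open>t\<close> produces exactly the entropy
  function.

  Let \<open>r\<close> grow like a logarithm and let \<open>D\<close> be a distance budget. Companion \<open>y\<close> is alive when
  \<open>d + r log(1/q(y)) \<le> D\<close> held at all its prefixes; \<open>\<sigma>\<close> is dead when it has no living companion.
  Losing \<open>q\<close> only makes strings die, so the strings that are ever seen to die first (while their
  parent is not yet dead) form a c.e. set. Since a minimal potential above \<open>exp(t D)\<close> is needed for
  dying, the potential bounds the number of such strings of length \<open>n\<close> by
  \<open>exp(n ln(2 cosh(t/2)) - t D(n) + o(n))\<close> (theorem \<open>card_Dies\<close>). The enumeration happens in stages, and a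
  string enumerated early may later lie below a shorter dead string; the induction treats all stages
  at once to absorb this. For \<open>D(n) \<ge> \<delta> n\<close> with \<open>\<delta> > 1/2 - \<theta>\<close> the bound is \<open>2^((s - \<eta>) n + o(n))\<close>, so every
  such string has a description of about \<open>(s - \<eta>) n\<close> bits (lemma \<open>counting_code\<close>), which long prefixes
  of \<open>X\<close> do not have (lemma \<open>rarely_dies\<close>).

  To reach the exact constant, \<open>D(n)/n\<close> has to approach \<open>1/2 - \<theta>\<close> at a rate depending on \<open>X\<close>. The
  slope of \<open>D\<close> is constant on each dyadic block of lengths and given by a short number there, so that
  the budget up to length \<open>n\<close> is described by \<open>O(log(n)^2)\<close> bits. On every late block the
  slope is the least one with which no prefix of \<open>X\<close> can die there. Then every prefix of \<open>X\<close> keeps a companion that is alive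
  at all stages, and Koenig's lemma yields \<open>Y\<close>.

  Computability is treated through total functions of an environment: closure rules for these are
  applied mechanically, and a step-bounded evaluator replaces a universal machine.
\<close>

section \<open>Total recursive functions of an environment\<close>

text \<open>
  The arguments are the values of an environment, and \<open>evaluates\<close> ignores surplus arguments, so the
  recursive term may be run on any sufficiently long initial part of the environment. This leaves no
  arities to track, and a variable bound by a sum or a quantifier becomes entry 0 of a shifted
  environment, as with de Bruijn indices.
\<close>

definition computable :: "((nat \<Rightarrow> nat) \<Rightarrow> nat) \<Rightarrow> bool" where
  "computable F \<longleftrightarrow> (\<exists>f k. \<forall>e m. k \<le> m \<longrightarrow> evaluates f (map e [0..<m]) (F e))"

definition decidable :: "((nat \<Rightarrow> nat) \<Rightarrow> bool) \<Rightarrow> bool" where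
  "decidable P \<longleftrightarrow> computable (\<lambda>e. of_bool (P e))"

named_theorems comp_intros

lemma computable_var [comp_intros]: "computable (\<lambda>e. e i)"
proof -
  have "evaluates (Proj i) (map e [0..<m]) (e i)" if "Suc i \<le> m" for e m
    using evaluates.proj[of i "map e [0..<m]"] that by simp
  then show ?thesis unfolding computable_def by blast
qed

lemma computable_subst:
  assumes "computable F" "\<And>i. computable (G i)"
  shows "computable (\<lambda>e. F (\<lambda>i. G i e))"
proof -
  obtain f k where f: "\<And>e m. k \<le> m \<Longrightarrow> evaluates f (map e [0..<m]) (F e)"
    using assms(1) unfolding computable_def by blast
  have "\<forall>i. \<exists>g l. \<forall>e m. l \<le> m \<longrightarrow> evaluates g (map e [0..<m]) (G i e)"
    using assms(2) unfolding computable_def by blast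
  then obtain g l where g: "\<And>i e m. l i \<le> m \<Longrightarrow> evaluates (g i) (map e [0..<m]) (G i e)"
    by metis
  have "evaluates (Comp f (map g [0..<k])) (map e [0..<m]) (F (\<lambda>i. G i e))"
    if "Max (insert 0 (l ` {0..<k})) \<le> m" for e m
  proof (rule evaluates.comp)
    show "list_all2 (\<lambda>g y. evaluates g (map e [0..<m]) y) (map g [0..<k])
       (map (\<lambda>i. G i e) [0..<k])"
      using that by (auto simp: list_all2_conv_all_nth intro!: g)
    show "evaluates f (map (\<lambda>i. G i e) [0..<k]) (F (\<lambda>i. G i e))"
      by (rule f) simp
  qed
  then show ?thesis unfolding computable_def by blast
qed

lemma map_upt_Cons: "0 < m \<Longrightarrow> map e [0..<m] = e 0 # map (\<lambda>i. e (Suc i)) [0..<m - 1]"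
  by (cases m) (simp_all add: map_upt_Suc del: upt_Suc)

lemma computable_Suc [comp_intros]:
  assumes "computable F" shows "computable (\<lambda>e. Suc (F e))"
proof -
  have "evaluates Succ (map e [0..<m]) (Suc (e 0))" if "1 \<le> m" for e m
    using that evaluates.succ[of "e 0"] by (simp add: map_upt_Cons del: upt_Suc)
  then have "computable (\<lambda>e. Suc (e 0))" unfolding computable_def by blast
  from computable_subst[OF this, of "\<lambda>_. F"] assms show ?thesis by simp
qed

lemma computable_const [comp_intros]: "computable (\<lambda>_. n)"
proof (induction n)
  case 0
  have "evaluates Zero (map e [0..<m]) 0" for e m by (rule evaluates.zero)
  then show ?case unfolding computable_def by blast
qed (rule computable_Suc)

lemma computable_rec_nat [comp_intros]:
  assumes B: "computable B" and F: "computable F"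
    and G: "computable (\<lambda>e. G (e 0) (e 1) (\<lambda>i. e (Suc (Suc i))))"
  shows "computable (\<lambda>e. rec_nat (F e) (\<lambda>n r. G n r e) (B e))"
proof -
  obtain f k where f: "\<And>e m. k \<le> m \<Longrightarrow> evaluates f (map e [0..<m]) (F e)"
    using F unfolding computable_def by blast
  obtain g l where g: "\<And>e m. l \<le> m \<Longrightarrow>
      evaluates g (map e [0..<m]) (G (e 0) (e 1) (\<lambda>i. e (Suc (Suc i))))"
    using G unfolding computable_def by blast
  have rec: "evaluates (PrimRec f g) (n # map e [0..<m]) (rec_nat (F e) (\<lambda>n r. G n r e) n)"
    if m: "k \<le> m" "l \<le> m" for e m n
  proof (induction n)
    case 0
    show ?case using f[OF m(1)] by (simp add: evaluates.primrec_0)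
  next
    case (Suc n)
    let ?r = "rec_nat (F e) (\<lambda>n r. G n r e) n"
    have "evaluates g (map (case_nat n (case_nat ?r e)) [0..<Suc (Suc m)]) (G n ?r e)"
      using g[of "Suc (Suc m)" "case_nat n (case_nat ?r e)"] m by simp
    then have "evaluates g (n # ?r # map e [0..<m]) (G n ?r e)"
      by (simp add: map_upt_Suc del: upt_Suc)
    with Suc show ?case by (simp add: evaluates.primrec_Suc)
  qed
  have "evaluates (PrimRec f g) (map e [0..<m])
      (rec_nat (F (\<lambda>i. e (Suc i))) (\<lambda>n r. G n r (\<lambda>i. e (Suc i))) (e 0))" if "Suc (k + l) \<le> m" for e m
    using rec[of "m - 1" "e 0" "\<lambda>i. e (Suc i)"] that by (simp add: map_upt_Cons del: upt_Suc)
  then have "computable (\<lambda>e. rec_nat (F (\<lambda>i. e (Suc i))) (\<lambda>n r. G n r (\<lambda>i. e (Suc i))) (e 0))"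
    unfolding computable_def by blast
  from computable_subst[OF this, of "case_nat B (\<lambda>j e. e j)"] B computable_var
  show ?thesis by (simp split: nat.split)
qed

lemma computable_add [comp_intros]:
  assumes "computable F" "computable G" shows "computable (\<lambda>e. F e + G e)"
proof -
  have "rec_nat a (\<lambda>_. Suc) n = a + n" for a n by (induction n) auto
  moreover have "computable (\<lambda>e. rec_nat (F e) (\<lambda>_ r. Suc r) (G e))"
    by (intro comp_intros assms)
  ultimately show ?thesis by simp
qed

lemma computable_diff [comp_intros]:
  assumes "computable F" "computable G" shows "computable (\<lambda>e. F e - G e)"
proof -
  have "rec_nat 0 (\<lambda>n _. n) n = n - Suc 0" for n by (cases n) auto
  moreover have "computable (\<lambda>e. rec_nat 0 (\<lambda>n _. n) (H e))" if "computable H" for H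
    by (intro comp_intros that)
  ultimately have pred: "computable (\<lambda>e. H e - Suc 0)" if "computable H" for H using that by simp
  have "rec_nat a (\<lambda>_ r. r - Suc 0) n = a - n" for a n by (induction n) auto
  moreover have "computable (\<lambda>e. rec_nat (F e) (\<lambda>_ r. r - Suc 0) (G e))"
    by (intro comp_intros assms pred)
  ultimately show ?thesis by simp
qed

lemma computable_mult [comp_intros]:
  assumes "computable F" "computable G" shows "computable (\<lambda>e. F e * G e)"
proof -
  have "computable (\<lambda>e. rec_nat 0 (\<lambda>_ r. r + F e) (G e))"
    by (intro comp_intros assms computable_subst[OF assms(1)])
  moreover have "rec_nat 0 (\<lambda>_ r. r + a) n = a * n" for a n :: nat by (induction n) auto
  ultimately show ?thesis by simp
qed

lemma computable_shift: "computable F \<Longrightarrow> computable (\<lambda>e. F (\<lambda>i. e (Suc i)))"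
  by (rule computable_subst[of F "\<lambda>i e. e (Suc i)"]) (assumption | rule computable_var)+

lemma computable_power [comp_intros]:
  assumes "computable F" "computable G" shows "computable (\<lambda>e. F e ^ G e)"
proof -
  have "computable (\<lambda>e. rec_nat 1 (\<lambda>_ r. r * F e) (G e))"
    by (intro comp_intros assms computable_subst[OF assms(1)])
  moreover have "rec_nat 1 (\<lambda>_ r. r * a) n = a ^ n" for a n :: nat by (induction n) auto
  ultimately show ?thesis by simp
qed

lemma computable_sum [comp_intros]:
  assumes "computable B" "computable (\<lambda>e. F (e 0) (\<lambda>i. e (Suc i)))"
  shows "computable (\<lambda>e. \<Sum>i<B e. F i e)"
proof -
  have "computable (\<lambda>e. F (e 0) (\<lambda>i. e (Suc (Suc i))))"
    using computable_subst[OF assms(2), of "case_nat (\<lambda>e. e 0) (\<lambda>i e. e (Suc (Suc i)))"]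
    by (simp add: computable_var split: nat.split)
  then have "computable (\<lambda>e. rec_nat 0 (\<lambda>n r. r + F n e) (B e))"
    by (intro comp_intros assms)
  moreover have "rec_nat 0 (\<lambda>n r. r + g n) b = (\<Sum>i<b. g i)" for g :: "nat \<Rightarrow> nat" and b
    by (induction b) auto
  ultimately show ?thesis by simp
qed

lemma computable_of_bool [comp_intros]: "decidable P \<Longrightarrow> computable (\<lambda>e. of_bool (P e))"
  by (simp add: decidable_def)

lemma decidable_le [comp_intros]:
  assumes "computable F" "computable G" shows "decidable (\<lambda>e. F e \<le> G e)"
proof -
  have "computable (\<lambda>e. 1 - (F e - G e))" by (intro comp_intros assms)
  moreover have "1 - (a - b) = of_bool (a \<le> b)" for a b :: nat by auto
  ultimately show ?thesis by (simp add: decidable_def)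
qed

lemma decidable_less [comp_intros]:
  assumes "computable F" "computable G" shows "decidable (\<lambda>e. F e < G e)"
  using decidable_le[OF computable_Suc[OF assms(1)] assms(2)] by (simp add: Suc_le_eq)

lemma decidable_not [comp_intros]:
  assumes "decidable P" shows "decidable (\<lambda>e. \<not> P e)"
proof -
  have "computable (\<lambda>e. 1 - of_bool (P e))"
    using assms by (intro comp_intros)
  moreover have "1 - of_bool p = (of_bool (\<not> p) :: nat)" for p by auto
  ultimately show ?thesis by (simp add: decidable_def)
qed

lemma decidable_conj [comp_intros]:
  assumes "decidable P" "decidable Q" shows "decidable (\<lambda>e. P e \<and> Q e)"
proof -
  have "computable (\<lambda>e. of_bool (P e) * of_bool (Q e))" using assms by (intro comp_intros)
  then show ?thesis by (simp add: decidable_def of_bool_conj)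
qed

lemma decidable_imp [comp_intros]:
  assumes "decidable P" "decidable Q" shows "decidable (\<lambda>e. P e \<longrightarrow> Q e)"
proof -
  have "decidable (\<lambda>e. \<not> (P e \<and> \<not> Q e))" by (intro comp_intros assms)
  then show ?thesis by simp
qed

lemma decidable_eq [comp_intros]:
  fixes F G :: "(nat \<Rightarrow> nat) \<Rightarrow> nat"
  assumes "computable F" "computable G" shows "decidable (\<lambda>e. F e = G e)"
proof -
  have "decidable (\<lambda>e. F e \<le> G e \<and> G e \<le> F e)" by (intro comp_intros assms)
  then show ?thesis by (simp add: eq_iff)
qed

lemma decidable_ex [comp_intros]:
  assumes "computable B" "decidable (\<lambda>e. P (e 0) (\<lambda>i. e (Suc i)))"
  shows "decidable (\<lambda>e. \<exists>i<B e. P i e)"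
proof -
  have "decidable (\<lambda>e. 0 < (\<Sum>i<B e. of_bool (P i e) :: nat))" by (intro comp_intros assms)
  moreover have "0 < (\<Sum>i<b. of_bool (Q i) :: nat) \<longleftrightarrow> (\<exists>i<b. Q i)" for b :: nat and Q
    by (auto simp flip: neq0_conv)
  ultimately show ?thesis by simp
qed

lemma decidable_all [comp_intros]:
  assumes "computable B" "decidable (\<lambda>e. P (e 0) (\<lambda>i. e (Suc i)))"
  shows "decidable (\<lambda>e. \<forall>i<B e. P i e)"
proof -
  have "decidable (\<lambda>e. \<not> (\<exists>i<B e. \<not> P i e))" by (intro comp_intros assms)
  then show ?thesis by simp
qed

lemma computable_if [comp_intros]:
  assumes "decidable P" "computable F" "computable G"
  shows "computable (\<lambda>e. if P e then F e else G e)"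
proof -
  have "computable (\<lambda>e. of_bool (P e) * F e + of_bool (\<not> P e) * G e)"
    by (intro comp_intros assms)
  moreover have "of_bool p * a + of_bool (\<not> p) * b = (if p then a else b)" for p and a b :: nat
    by simp
  ultimately show ?thesis by simp
qed

lemma computable_div [comp_intros]:
  assumes "computable F" "computable G" shows "computable (\<lambda>e. F e div G e)"
proof -
  have *: "(\<Sum>i<a. of_bool (0 < b \<and> Suc i * b \<le> a)) = a div b" for a b :: nat
  proof (cases "b = 0")
    case False
    then have "{i. i < a \<and> Suc i * b \<le> a} = {..<a div b}"
      by (auto simp: less_eq_div_iff_mult_less_eq Suc_le_eq[symmetric]
          intro: order_trans[of _ "a div b"])
    moreover have "(\<Sum>i<a. of_bool (0 < b \<and> Suc i * b \<le> a)) = card {i. i < a \<and> Suc i * b \<le> a}"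
      using False by (auto simp: sum.If_cases of_bool_def Int_def)
    ultimately show ?thesis by simp
  qed simp
  have "computable (\<lambda>e. \<Sum>i<F e. of_bool (0 < G e \<and> Suc i * G e \<le> F e))"
    by (intro comp_intros assms computable_shift)
  then show ?thesis by (simp only: *)
qed

lemma computable_mod [comp_intros]:
  assumes "computable F" "computable G" shows "computable (\<lambda>e. F e mod G e)"
proof -
  have "computable (\<lambda>e. F e - F e div G e * G e)" by (intro comp_intros assms)
  then show ?thesis by (simp only: minus_div_mult_eq_mod)
qed

lemma computable_min [comp_intros]:
  fixes F G :: "(nat \<Rightarrow> nat) \<Rightarrow> nat"
  assumes "computable F" "computable G" shows "computable (\<lambda>e. min (F e) (G e))"
  unfolding min_def by (intro comp_intros assms)

text \<open>
  To be run inside a machine, a computable function needs a term that works on short argument lists;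
  the missing entries of the environment are set to 0.
\<close>

lemma computable_arity:
  assumes "computable F"
  shows "\<exists>f. \<forall>xs. length xs = n \<longrightarrow> evaluates f xs (F (\<lambda>i. if i < n then xs ! i else 0))"
proof -
  obtain f k where f: "\<And>e m. k \<le> m \<Longrightarrow> evaluates f (map e [0..<m]) (F e)"
    using assms unfolding computable_def by blast
  have "evaluates (Comp f (map (\<lambda>i. if i < n then Proj i else Zero) [0..<k])) xs
      (F (\<lambda>i. if i < n then xs ! i else 0))" if "length xs = n" for xs
  proof (rule evaluates.comp)
    show "list_all2 (\<lambda>g. evaluates g xs) (map (\<lambda>i. if i < n then Proj i else Zero) [0..<k])
        (map (\<lambda>i. if i < n then xs ! i else 0) [0..<k])"
      using that by (auto simp: list_all2_conv_all_nth intro: evaluates.intros)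
  qed (rule f, simp)
  then show ?thesis by blast
qed

section \<open>Step-bounded evaluation\<close>

definition bounded_least :: "nat \<Rightarrow> (nat \<Rightarrow> bool) \<Rightarrow> nat" where
  "bounded_least b P = (\<Sum>y<b. of_bool (\<forall>z<Suc y. \<not> P z))"

lemma computable_bounded_least [comp_intros]:
  assumes "computable B" "decidable (\<lambda>e. P (e 0) (\<lambda>i. e (Suc i)))"
  shows "computable (\<lambda>e. bounded_least (B e) (\<lambda>y. P y e))"
proof -
  have "decidable (\<lambda>e. P (e 0) (\<lambda>i. e (Suc (Suc i))))"
    using computable_subst[OF assms(2)[unfolded decidable_def], of "case_nat (\<lambda>e. e 0) (\<lambda>i e. e (Suc (Suc i)))"]
    by (simp add: computable_var decidable_def split: nat.split)
  then show ?thesis unfolding bounded_least_def by (intro comp_intros assms)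
qed

lemma bounded_least_eq:
  assumes "y < b" "P y" "\<And>z. z < y \<Longrightarrow> \<not> P z"
  shows "bounded_least b P = y"
proof -
  have "{x. x < b \<and> (\<forall>z<Suc x. \<not> P z)} = {..<y}"
    using assms by (auto simp: less_Suc_eq_le) (meson leI order.strict_trans)+
  then have "(\<Sum>x<b. if \<forall>z<Suc x. \<not> P z then 1 else 0) = y"
    by (simp add: sum.If_cases Int_def)
  then show ?thesis by (simp add: bounded_least_def of_bool_def)
qed

lemma bounded_least_none: "(\<And>z. z < b \<Longrightarrow> \<not> P z) \<Longrightarrow> bounded_least b P = b"
  by (simp add: bounded_least_def)

lemma bounded_least_props:
  assumes "bounded_least b P < b"
  shows "P (bounded_least b P)" "z < bounded_least b P \<Longrightarrow> \<not> P z"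
proof -
  obtain x where x: "x < b" "P x" using assms bounded_least_none[of b P] by fastforce
  obtain y where y: "P y" "\<forall>z<y. \<not> P z" using x(2) exists_least_iff[of P] by blast
  have "y < b" using x y by (meson linorder_not_less order.strict_trans1)
  then have "bounded_least b P = y" using y by (intro bounded_least_eq) auto
  with y show "P (bounded_least b P)" "z < bounded_least b P \<Longrightarrow> \<not> P z" by auto
qed

text \<open>
  \<open>H s xs\<close> is the result of \<open>f\<close> on \<open>xs\<close> after \<open>s\<close> steps: 0 for no result yet, \<open>Suc y\<close> for the
  result \<open>y\<close>. What counts as a step is irrelevant as long as results persist and every result shows up
  eventually.
\<close>

definition simulates :: "(nat \<Rightarrow> nat list \<Rightarrow> nat) \<Rightarrow> nat \<Rightarrow> recf \<Rightarrow> bool" where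
  "simulates H m f \<longleftrightarrow> computable (\<lambda>e. H (e 0) (map (\<lambda>i. e (Suc i)) [0..<m])) \<and>
     (\<forall>s s' xs y. length xs = m \<longrightarrow> s \<le> s' \<longrightarrow> H s xs = Suc y \<longrightarrow> H s' xs = Suc y) \<and>
     (\<forall>xs y. length xs = m \<longrightarrow> evaluates f xs y \<longleftrightarrow> (\<exists>s. H s xs = Suc y))"

lemma simulates_computable:
  assumes "simulates H m f" "computable S" "\<And>i. computable (X i)"
  shows "computable (\<lambda>e. H (S e) (map (\<lambda>i. X i e) [0..<m]))"
  using computable_subst[of "\<lambda>e. H (e 0) (map (\<lambda>i. e (Suc i)) [0..<m])" "case_nat S X"] assms
  by (simp add: simulates_def split: nat.split)

lemma simulates_computable_Cons:
  assumes "simulates H (Suc m) f" "computable S" "computable Y" "\<And>i. computable (X i)"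
  shows "computable (\<lambda>e. H (S e) (Y e # map (\<lambda>i. X i e) [0..<m]))"
  using simulates_computable[OF assms(1,2), of "case_nat Y X"] assms(3,4)
  by (simp add: map_upt_Suc del: upt_Suc split: nat.split)

lemma simulates_computable_Cons2:
  assumes "simulates H (Suc (Suc m)) f" "computable S" "computable Y" "computable Z" "\<And>i. computable (X i)"
  shows "computable (\<lambda>e. H (S e) (Y e # Z e # map (\<lambda>i. X i e) [0..<m]))"
  using simulates_computable[OF assms(1,2), of "case_nat Y (case_nat Z X)"] assms(3-5)
  by (simp add: map_upt_Suc del: upt_Suc split: nat.split)

lemma simulates_mono:
  "simulates H m f \<Longrightarrow> length xs = m \<Longrightarrow> s \<le> s' \<Longrightarrow> H s xs = Suc y \<Longrightarrow> H s' xs = Suc y"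
  unfolding simulates_def by blast

lemma simulates_pos_mono:
  "simulates H m f \<Longrightarrow> length xs = m \<Longrightarrow> s \<le> s' \<Longrightarrow> 0 < H s xs \<Longrightarrow> H s' xs = H s xs"
  using simulates_mono[of H m f xs s s' "H s xs - 1"] by simp

lemma simulates_iff:
  "simulates H m f \<Longrightarrow> length xs = m \<Longrightarrow> evaluates f xs y \<longleftrightarrow> (\<exists>s. H s xs = Suc y)"
  unfolding simulates_def by blast

lemma decidable_all_fixed:
  "(\<And>i. i < l \<Longrightarrow> decidable (P i)) \<Longrightarrow> decidable (\<lambda>e. \<forall>i<(l::nat). P i e)"
proof (induction l)
  case 0
  then show ?case using decidable_le[OF computable_const computable_const, of 0 0] by simp
next
  case (Suc l)
  then show ?case unfolding All_less_Suc by (intro decidable_conj) auto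
qed

lemma common_stage:
  assumes "\<And>i. i < (l::nat) \<Longrightarrow> \<exists>s::nat. P i s" "\<And>i s s'. P i s \<Longrightarrow> s \<le> s' \<Longrightarrow> P i s'"
  shows "\<exists>s. \<forall>i<l. P i s"
proof -
  obtain t where t: "\<And>i. i < l \<Longrightarrow> P i (t i)" using assms(1) by metis
  have "t i \<le> Max (t ` {..<l})" if "i < l" for i using that by simp
  with t assms(2) show ?thesis by blast
qed

text \<open>
  The outer function is run once all inner results are present; a common stage exists because results
  persist and there are finitely many of them.
\<close>

lemma simulates_Comp:
  assumes Hf: "simulates Hf (length gs) f" and Hg: "\<And>i. i < length gs \<Longrightarrow> simulates (Hg i) m (gs ! i)"
  shows "\<exists>H. simulates H m (Comp f gs)"
proof -
  define H where "H s xs = (if \<forall>i<length gs. 0 < Hg i s xs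
      then Hf s (map (\<lambda>i. Hg i s xs - 1) [0..<length gs]) else 0)" for s xs
  have "simulates H m (Comp f gs)" unfolding simulates_def
  proof (intro conjI allI impI)
    let ?g = "\<lambda>i e. Hg i (e 0) (map (\<lambda>i. e (Suc i)) [0..<m])"
    have g: "computable (?g i)" if "i < length gs" for i
      using Hg[OF that] by (simp add: simulates_def)
    have "computable (\<lambda>e. Hf (e 0) (map (\<lambda>i. if i < length gs then ?g i e - 1 else 0) [0..<length gs]))"
    proof (rule simulates_computable[OF Hf computable_var])
      fix i
      have "computable (\<lambda>e. ?g i e - 1)" if "i < length gs"
        by (rule computable_diff[OF g[OF that] computable_const])
      then show "computable (\<lambda>e. if i < length gs then ?g i e - 1 else 0)"
        by (cases "i < length gs") (simp_all only: if_True if_False computable_const)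
    qed
    moreover have "map (\<lambda>i. if i < length gs then h i else 0) [0..<length gs] = map h [0..<length gs]"
      for h :: "nat \<Rightarrow> nat" by simp
    ultimately have "computable (\<lambda>e. Hf (e 0) (map (\<lambda>i. ?g i e - 1) [0..<length gs]))"
      by (simp only:)
    then show "computable (\<lambda>e. H (e 0) (map (\<lambda>i. e (Suc i)) [0..<m]))"
      unfolding H_def by (intro computable_if decidable_all_fixed decidable_less computable_const g)
  next
    fix s s' and xs :: "nat list" and y assume xs: "length xs = m" "s \<le> s'" "H s xs = Suc y"
    have pos: "\<forall>i<length gs. 0 < Hg i s xs" using xs(3) by (auto simp: H_def split: if_splits)
    have eq: "Hg i s' xs = Hg i s xs" if "i < length gs" for i
      by (rule simulates_pos_mono[OF Hg[OF that] xs(1,2)]) (use pos that in simp)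
    have "Hf s (map (\<lambda>i. Hg i s xs - 1) [0..<length gs]) = Suc y" using xs(3) pos by (simp add: H_def)
    from simulates_mono[OF Hf _ xs(2) this]
    have "Hf s' (map (\<lambda>i. Hg i s xs - 1) [0..<length gs]) = Suc y" by simp
    moreover have "map (\<lambda>i. Hg i s' xs - 1) [0..<length gs] = map (\<lambda>i. Hg i s xs - 1) [0..<length gs]"
      using eq by simp
    ultimately have "Hf s' (map (\<lambda>i. Hg i s' xs - 1) [0..<length gs]) = Suc y" by (simp only:)
    moreover have "\<forall>i<length gs. 0 < Hg i s' xs" using pos eq by simp
    ultimately show "H s' xs = Suc y" unfolding H_def by (subst if_P)
  next
    fix xs :: "nat list" and y assume xs: "length xs = m"
    show "evaluates (Comp f gs) xs y \<longleftrightarrow> (\<exists>s. H s xs = Suc y)"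
    proof
      assume "evaluates (Comp f gs) xs y"
      then obtain ys where ys: "list_all2 (\<lambda>g y. evaluates g xs y) gs ys" "evaluates f ys y"
        by (cases rule: evaluates.cases) auto
      have l: "length ys = length gs" using ys(1) by (simp add: list_all2_lengthD)
      have ev: "evaluates (gs ! i) xs (ys ! i)" if "i < length gs" for i
        using ys(1) that by (simp add: list_all2_conv_all_nth)
      have "\<exists>s. \<forall>i<length gs. i < length gs \<and> Hg i s xs = Suc (ys ! i)"
      proof (rule common_stage)
        fix i assume i: "i < length gs"
        show "\<exists>s. i < length gs \<and> Hg i s xs = Suc (ys ! i)"
          using simulates_iff[OF Hg[OF i] xs, THEN iffD1, OF ev[OF i]] i by simp
      next
        fix i s s' assume i: "i < length gs \<and> Hg i s xs = Suc (ys ! i)" "s \<le> s'"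
        show "i < length gs \<and> Hg i s' xs = Suc (ys ! i)"
          using simulates_mono[OF Hg xs i(2)] i(1) by simp
      qed
      then obtain s where s: "\<And>i. i < length gs \<Longrightarrow> Hg i s xs = Suc (ys ! i)" by auto
      obtain s2 where s2: "Hf s2 ys = Suc y" using simulates_iff[OF Hf l, THEN iffD1, OF ys(2)] ..
      define t where "t = max s s2"
      have t: "Hg i t xs = Suc (ys ! i)" if "i < length gs" for i
        using simulates_mono[OF Hg[OF that] xs _ s[OF that]] by (simp add: t_def)
      have "Hf t ys = Suc y" using simulates_mono[OF Hf l _ s2] by (simp add: t_def)
      moreover have "map (\<lambda>i. Hg i t xs - 1) [0..<length gs] = ys"
        using t l by (intro nth_equalityI) auto
      ultimately have "Hf t (map (\<lambda>i. Hg i t xs - 1) [0..<length gs]) = Suc y" by (simp only:)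
      moreover have "\<forall>i<length gs. 0 < Hg i t xs" using t by simp
      ultimately have "H t xs = Suc y" unfolding H_def by (subst if_P)
      then show "\<exists>s. H s xs = Suc y" ..
    next
      assume "\<exists>s. H s xs = Suc y"
      then obtain s where s: "H s xs = Suc y" ..
      let ?ys = "map (\<lambda>i. Hg i s xs - 1) [0..<length gs]"
      have pos: "\<forall>i<length gs. 0 < Hg i s xs" and Hs: "Hf s ?ys = Suc y"
        using s by (auto simp: H_def split: if_splits)
      have "evaluates (gs ! i) xs (Hg i s xs - 1)" if "i < length gs" for i
        by (rule simulates_iff[OF Hg[OF that] xs, THEN iffD2], rule exI[of _ s]) (use pos that in simp)
      then have "list_all2 (\<lambda>g y. evaluates g xs y) gs ?ys" by (simp add: list_all2_conv_all_nth)
      moreover have "evaluates f ?ys y"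
        by (rule simulates_iff[OF Hf, THEN iffD2], simp, rule exI[of _ s], rule Hs)
      ultimately show "evaluates (Comp f gs) xs y" by (rule evaluates.comp)
    qed
  qed
  then show ?thesis by (intro exI)
qed

lemma evaluates_PrimRec_Suc:
  "evaluates (PrimRec f g) (Suc n # xs) y \<longleftrightarrow>
    (\<exists>r. evaluates (PrimRec f g) (n # xs) r \<and> evaluates g (n # r # xs) y)"
  by (auto elim: evaluates.cases intro: evaluates.primrec_Suc)

lemma evaluates_PrimRec_0: "evaluates (PrimRec f g) (0 # xs) y \<longleftrightarrow> evaluates f xs y"
  by (auto elim: evaluates.cases intro: evaluates.primrec_0)

lemma simulates_PrimRec:
  assumes Hf: "simulates Hf m f" and Hg: "simulates Hg (Suc (Suc m)) g"
  shows "\<exists>H. simulates H (Suc m) (PrimRec f g)"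
proof -
  define R where "R s xs n = rec_nat (Hf s xs)
      (\<lambda>n r. if r = 0 then 0 else Hg s (n # (r - 1) # xs)) n" for s xs n
  have R_simps: "R s xs 0 = Hf s xs"
      "R s xs (Suc n) = (if R s xs n = 0 then 0 else Hg s (n # (R s xs n - 1) # xs))" for s xs n
    by (simp_all add: R_def)
  have mono: "R s' xs n = Suc y" if "length xs = m" "s \<le> s'" "R s xs n = Suc y" for s s' xs n y
    using that(3)
  proof (induction n arbitrary: y)
    case 0 then show ?case using simulates_mono[OF Hf that(1,2)] by (simp add: R_simps)
  next
    case (Suc n)
    from Suc.prems obtain r where r: "R s xs n = Suc r" "Hg s (n # r # xs) = Suc y"
      by (cases "R s xs n") (auto simp: R_simps)
    with Suc.IH[OF r(1)] simulates_mono[OF Hg _ that(2) r(2)] that(1) show ?case by (simp add: R_simps)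
  qed
  have lim: "evaluates (PrimRec f g) (n # xs) y \<longleftrightarrow> (\<exists>s. R s xs n = Suc y)" if "length xs = m" for xs n y
  proof (induction n arbitrary: y)
    case 0 show ?case by (simp add: R_simps evaluates_PrimRec_0 simulates_iff[OF Hf that])
  next
    case (Suc n)
    have "(\<exists>s. R s xs (Suc n) = Suc y) \<longleftrightarrow> (\<exists>r s. R s xs n = Suc r \<and> Hg s (n # r # xs) = Suc y)"
    proof
      assume "\<exists>s. R s xs (Suc n) = Suc y"
      then obtain s where s: "R s xs (Suc n) = Suc y" ..
      then show "\<exists>r s. R s xs n = Suc r \<and> Hg s (n # r # xs) = Suc y"
        by (intro exI[of _ "R s xs n - 1"] exI[of _ s]) (auto simp: R_simps split: if_splits)
    next
      assume "\<exists>r s. R s xs n = Suc r \<and> Hg s (n # r # xs) = Suc y"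
      then obtain r s where s: "R s xs n = Suc r" "Hg s (n # r # xs) = Suc y" by blast
      then have "R s xs (Suc n) = Suc y" by (simp add: R_simps)
      then show "\<exists>s. R s xs (Suc n) = Suc y" ..
    qed
    also have "\<dots> \<longleftrightarrow> (\<exists>r. (\<exists>s. R s xs n = Suc r) \<and> (\<exists>s. Hg s (n # r # xs) = Suc y))"
    proof -
      have "\<exists>s. R s xs n = Suc r \<and> Hg s (n # r # xs) = Suc y"
        if "R s1 xs n = Suc r" "Hg s2 (n # r # xs) = Suc y" for r s1 s2
        using mono[OF \<open>length xs = m\<close> _ that(1), of "max s1 s2"]
          simulates_mono[OF Hg _ _ that(2), of "max s1 s2"] \<open>length xs = m\<close> by auto
      then show ?thesis by blast
    qed
    also have "\<dots> \<longleftrightarrow> evaluates (PrimRec f g) (Suc n # xs) y"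
      using that by (simp add: evaluates_PrimRec_Suc Suc.IH simulates_iff[OF Hg])
    finally show ?case by simp
  qed
  define H where "H s xs = R s (tl xs) (hd xs)" for s xs
  have "simulates H (Suc m) (PrimRec f g)" unfolding simulates_def
  proof (intro conjI allI impI)
    have "computable (\<lambda>e. R (e 0) (map (\<lambda>i. e (Suc (Suc i))) [0..<m]) (e (Suc 0)))"
      unfolding R_def
      by (intro comp_intros simulates_computable[OF Hf] simulates_computable_Cons2[OF Hg])
    then show "computable (\<lambda>e. H (e 0) (map (\<lambda>i. e (Suc i)) [0..<Suc m]))"
      by (simp add: H_def map_upt_Suc del: upt_Suc)
  next
    fix s s' and xs :: "nat list" and y assume "length xs = Suc m" "s \<le> s'" "H s xs = Suc y"
    then show "H s' xs = Suc y" unfolding H_def by (intro mono[of "tl xs" s s']) auto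
  next
    fix xs :: "nat list" and y assume "length xs = Suc m"
    then show "evaluates (PrimRec f g) xs y \<longleftrightarrow> (\<exists>s. H s xs = Suc y)"
      unfolding H_def by (cases xs) (simp_all add: lim)
  qed
  then show ?thesis by (intro exI)
qed

text \<open>
  The least argument below \<open>s\<close> whose value is 0 or still unknown is computed first. It is the correct
  answer exactly if its value is known, since then all smaller arguments have known positive values.
\<close>

lemma simulates_Minim:
  assumes Hf: "simulates Hf (Suc m) f"
  shows "\<exists>H. simulates H m (Minim f)"
proof -
  define L where "L s xs = bounded_least s (\<lambda>y. Hf s (y # xs) \<le> 1)" for s xs
  define H where "H s xs = (if L s xs < s \<and> Hf s (L s xs # xs) = 1 then Suc (L s xs) else 0)" for s xs
  have H_iff: "H s xs = Suc y \<longleftrightarrow> y < s \<and> Hf s (y # xs) = 1 \<and> (\<forall>z<y. 1 < Hf s (z # xs))" for s xs y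
  proof
    assume "H s xs = Suc y"
    then have "L s xs = y" "y < s" "Hf s (y # xs) = 1" by (auto simp: H_def split: if_splits)
    then show "y < s \<and> Hf s (y # xs) = 1 \<and> (\<forall>z<y. 1 < Hf s (z # xs))"
      using bounded_least_props(2)[of s "\<lambda>y. Hf s (y # xs) \<le> 1"] by (auto simp: L_def not_le)
  next
    assume *: "y < s \<and> Hf s (y # xs) = 1 \<and> (\<forall>z<y. 1 < Hf s (z # xs))"
    then have "L s xs = y" unfolding L_def by (intro bounded_least_eq) (auto simp: not_le)
    with * show "H s xs = Suc y" by (simp add: H_def)
  qed
  have "simulates H m (Minim f)" unfolding simulates_def
  proof (intro conjI allI impI)
    have *: "computable (\<lambda>e. L (e 0) (map (\<lambda>i. e (Suc i)) [0..<m]))" unfolding L_def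
      by (intro comp_intros simulates_computable_Cons[OF Hf])
    show "computable (\<lambda>e. H (e 0) (map (\<lambda>i. e (Suc i)) [0..<m]))" unfolding H_def
      by (intro comp_intros simulates_computable_Cons[OF Hf] *)
  next
    fix s s' and xs :: "nat list" and y assume xs: "length xs = m" "s \<le> s'" "H s xs = Suc y"
    then have "Hf s' (z # xs) = Hf s (z # xs)" if "z \<le> y" for z
      using that by (intro simulates_pos_mono[OF Hf _ xs(2)]) (auto simp: H_iff le_less)
    with xs show "H s' xs = Suc y" by (auto simp: H_iff)
  next
    fix xs :: "nat list" and y assume xs: "length xs = m"
    show "evaluates (Minim f) xs y \<longleftrightarrow> (\<exists>s. H s xs = Suc y)"
    proof
      assume "evaluates (Minim f) xs y"
      then have ev: "evaluates f (y # xs) 0" "\<And>z. z < y \<Longrightarrow> \<exists>v. 0 < v \<and> evaluates f (z # xs) v"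
        by (auto elim: evaluates.cases)
      have "\<exists>s. \<forall>z<Suc y. if z = y then Hf s (z # xs) = 1 else 1 < Hf s (z # xs)"
      proof (rule common_stage)
        fix z assume "z < Suc y"
        show "\<exists>s. if z = y then Hf s (z # xs) = 1 else 1 < Hf s (z # xs)"
        proof (cases "z = y")
          case True
          then show ?thesis using ev(1) simulates_iff[OF Hf, of "y # xs" 0] xs by auto
        next
          case False
          then obtain v where "0 < v" "evaluates f (z # xs) v" using ev(2)[of z] \<open>z < Suc y\<close> by auto
          then show ?thesis using False simulates_iff[OF Hf, of "z # xs" v] xs by (metis One_nat_def Suc_less_eq length_Cons)
        qed
      next
        fix z s s' assume *: "if z = y then Hf s (z # xs) = 1 else 1 < Hf s (z # xs)" and "s \<le> s'"
        then have "Hf s' (z # xs) = Hf s (z # xs)"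
          using xs by (intro simulates_pos_mono[OF Hf]) (auto split: if_splits)
        with * show "if z = y then Hf s' (z # xs) = 1 else 1 < Hf s' (z # xs)" by (simp only:)
      qed
      then obtain s where s: "\<forall>z<Suc y. if z = y then Hf s (z # xs) = 1 else 1 < Hf s (z # xs)" ..
      define t where "t = max s (Suc y)"
      have pos: "0 < Hf s (z # xs)" if "z < Suc y" for z
        using s[rule_format, OF that] by (cases "z = y") auto
      have eq: "Hf t (z # xs) = Hf s (z # xs)" if "z < Suc y" for z
        by (rule simulates_pos_mono[OF Hf _ _ pos[OF that]]) (simp_all add: xs t_def)
      have "Hf t (y # xs) = 1" using eq[of y] s[rule_format, of y] by simp
      moreover have "1 < Hf t (z # xs)" if "z < y" for z
        using eq[of z] s[rule_format, of z] that by simp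
      moreover have "y < t" by (simp add: t_def)
      ultimately have "H t xs = Suc y" unfolding H_iff by blast
      then show "\<exists>s. H s xs = Suc y" ..
    next
      assume "\<exists>s. H s xs = Suc y"
      then obtain s where s: "Hf s (y # xs) = 1" "\<And>z. z < y \<Longrightarrow> 1 < Hf s (z # xs)"
        by (auto simp: H_iff)
      show "evaluates (Minim f) xs y"
      proof (rule evaluates.minim)
        show "evaluates f (y # xs) 0" using simulates_iff[OF Hf, of "y # xs" 0] s(1) xs by auto
        fix z assume "z < y"
        then have v: "Hf s (z # xs) = Suc (Hf s (z # xs) - 1)" "0 < Hf s (z # xs) - 1"
          using s(2)[OF \<open>z < y\<close>] by linarith+
        have "evaluates f (z # xs) (Hf s (z # xs) - 1)"
          by (rule simulates_iff[OF Hf, THEN iffD2]) (use xs v(1) in auto)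
        with v(2) show "\<exists>v. 0 < v \<and> evaluates f (z # xs) v" by (intro exI conjI)
      qed
    qed
  qed
  then show ?thesis by (intro exI)
qed

text \<open>
  By recursion on the term a separate evaluator is built for each recursive function; no universal
  function and no numbering of terms is involved.
\<close>

lemma ex_simulates: "\<exists>H. simulates H m f"
proof (induction f arbitrary: m)
  case Zero
  have "evaluates Zero xs y \<longleftrightarrow> y = 0" for xs y
    by (auto elim: evaluates.cases intro: evaluates.zero)
  then have "simulates (\<lambda>_ _. 1) m Zero" by (auto simp: simulates_def intro: comp_intros)
  then show ?case by (intro exI)
next
  case Succ
  have ev: "evaluates Succ xs y \<longleftrightarrow> xs \<noteq> [] \<and> y = Suc (hd xs)" for xs y
    by (cases xs) (auto elim: evaluates.cases intro: evaluates.succ)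
  show ?case
  proof (cases m)
    case 0
    then have "simulates (\<lambda>_ _. 0) m Succ" by (auto simp: simulates_def ev intro: comp_intros)
    then show ?thesis by (intro exI)
  next
    case (Suc l)
    then have "simulates (\<lambda>_ xs. Suc (Suc (hd xs))) m Succ"
      by (auto simp: simulates_def ev map_upt_Suc simp del: upt_Suc intro!: comp_intros)
    then show ?thesis by (intro exI)
  qed
next
  case (Proj i)
  have ev: "evaluates (Proj i) xs y \<longleftrightarrow> i < length xs \<and> y = xs ! i" for xs y
    by (auto elim: evaluates.cases intro: evaluates.proj)
  show ?case
  proof (cases "i < m")
    case False
    then have "simulates (\<lambda>_ _. 0) m (Proj i)" by (auto simp: simulates_def ev intro: comp_intros)
    then show ?thesis by (intro exI)
  next
    case True
    then have "simulates (\<lambda>_ xs. Suc (xs ! i)) m (Proj i)"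
      by (auto simp: simulates_def ev intro!: comp_intros)
    then show ?thesis by (intro exI)
  qed
next
  case (Comp f gs)
  obtain Hf where "simulates Hf (length gs) f" using Comp.IH(1) by blast
  moreover have "\<exists>H. simulates H m (gs ! i)" if "i < length gs" for i
    using Comp.IH(2) that nth_mem by blast
  then obtain Hg where "\<And>i. i < length gs \<Longrightarrow> simulates (Hg i) m (gs ! i)" by metis
  ultimately show ?case by (rule simulates_Comp)
next
  case (PrimRec f g)
  show ?case
  proof (cases m)
    case 0
    then have "\<not> evaluates (PrimRec f g) xs y" if "length xs = m" for xs y
      using that by (auto elim: evaluates.cases)
    then have "simulates (\<lambda>_ _. 0) m (PrimRec f g)" by (auto simp: simulates_def intro: comp_intros)
    then show ?thesis by (intro exI)
  next
    case (Suc l)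
    then show ?thesis using PrimRec.IH simulates_PrimRec by metis
  qed
next
  case (Minim f)
  then show ?case using simulates_Minim by metis
qed

section \<open>Integer roots, logarithms and pairs\<close>

lemma sum_of_bool_Suc_le: "r \<le> n \<Longrightarrow> (\<Sum>i<n. of_bool (Suc i \<le> r)) = (r::nat)"
proof -
  assume "r \<le> n"
  then have "{i. i < n \<and> Suc i \<le> r} = {..<r}" by auto
  then show ?thesis by (simp add: of_bool_def sum.If_cases Int_def)
qed

lemma computable_floor_sqrt [comp_intros]:
  assumes "computable F" shows "computable (\<lambda>e. floor_sqrt (F e))"
proof -
  have "computable (\<lambda>e. \<Sum>i<F e. of_bool (Suc i ^ 2 \<le> F e))"
    by (intro comp_intros assms computable_shift)
  moreover have "(\<Sum>i<n. of_bool (Suc i ^ 2 \<le> n)) = floor_sqrt n" for n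
    using sum_of_bool_Suc_le[OF floor_sqrt_le] by (simp only: le_floor_sqrt_iff)
  ultimately show ?thesis by (simp only:)
qed

lemma computable_floor_log [comp_intros]:
  assumes "computable F" shows "computable (\<lambda>e. floor_log (F e))"
proof -
  have "computable (\<lambda>e. \<Sum>i<F e. of_bool (2 ^ Suc i \<le> F e))"
    by (intro comp_intros assms computable_shift)
  moreover have "(\<Sum>i<n. of_bool (2 ^ Suc i \<le> n)) = floor_log n" for n :: nat
  proof (cases "n = 0")
    case False
    have iff: "2 ^ k \<le> n \<longleftrightarrow> k \<le> floor_log n" for k
    proof
      assume "2 ^ k \<le> n" then show "k \<le> floor_log n" using floor_log_le_iff[of "2^k" n] by simp
    next
      assume "k \<le> floor_log n"
      then have "2 ^ k \<le> (2::nat) ^ floor_log n" by (simp add: power_increasing)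
      also have "\<dots> \<le> n" using False floor_log_exp2_le by simp
      finally show "2 ^ k \<le> n" .
    qed
    have "floor_log n < 2 ^ floor_log n" by simp
    also have "\<dots> \<le> n" using False floor_log_exp2_le by simp
    finally show ?thesis using sum_of_bool_Suc_le[of "floor_log n" n] by (simp only: iff)
  qed simp
  ultimately show ?thesis by (simp only:)
qed

text \<open>
  Taking squares as blocks, \<open>pair x y\<close> is the \<open>x\<close>-th number of the block beginning at \<open>(x + y)^2\<close>. It is of
  quadratic size, which keeps the description of a pair short.
\<close>

definition pair :: "nat \<Rightarrow> nat \<Rightarrow> nat" where "pair x y = (x + y)^2 + x"
definition pfst :: "nat \<Rightarrow> nat" where "pfst w = w - (floor_sqrt w)^2"
definition psnd :: "nat \<Rightarrow> nat" where "psnd w = floor_sqrt w - pfst w"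

lemma pfst_pair [simp]: "pfst (pair x y) = x" and psnd_pair [simp]: "psnd (pair x y) = y"
proof -
  have "floor_sqrt ((x + y)^2 + x) = x + y"
    by (rule floor_sqrt_unique) (auto simp: power2_eq_square)
  then show "pfst (pair x y) = x" "psnd (pair x y) = y" by (simp_all add: pair_def pfst_def psnd_def)
qed

lemma computable_pfst [comp_intros]: "computable F \<Longrightarrow> computable (\<lambda>e. pfst (F e))"
  unfolding pfst_def by (intro comp_intros)

lemma computable_psnd [comp_intros]: "computable F \<Longrightarrow> computable (\<lambda>e. psnd (F e))"
  unfolding psnd_def by (intro comp_intros)

section \<open>Binary strings as numbers\<close>

text \<open>
  Bijective numeration shifted by one is ordinary binary notation, least significant bit first, with an
  additional leading 1 marking the end. Prefixes become residues modulo powers of 2, suffixes become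
  quotients, and the length becomes the integer logarithm.
\<close>

definition num :: "bool list \<Rightarrow> nat" where "num \<sigma> = Suc (str_code \<sigma>)"

lemma num_Nil [simp]: "num [] = 1" and num_Cons [simp]: "num (b # \<sigma>) = of_bool b + 2 * num \<sigma>"
  by (simp_all add: num_def)

lemma ex_str_code: "\<exists>\<sigma>. str_code \<sigma> = n"
  by (metis bij_is_surj[OF bij_str_code] surjD)

lemma inj_num: "num \<sigma> = num \<tau> \<longleftrightarrow> \<sigma> = \<tau>"
  using bij_str_code by (auto simp: num_def bij_def inj_eq)

lemma num_bounds: "2 ^ length \<sigma> \<le> num \<sigma>" "num \<sigma> < 2 * 2 ^ length \<sigma>"
  by (induction \<sigma>) auto

lemma floor_log_num [simp]: "floor_log (num \<sigma>) = length \<sigma>"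
  by (rule floor_log_eqI) (auto simp: num_bounds, simp add: num_def)

lemma num_surj: "2 ^ n \<le> N \<Longrightarrow> N < 2 * 2 ^ n \<Longrightarrow> \<exists>\<sigma>. length \<sigma> = n \<and> num \<sigma> = N"
proof -
  assume N: "2 ^ n \<le> N" "N < 2 * 2 ^ n"
  then have "0 < N" by (metis less_le_trans pos2 zero_less_power)
  moreover obtain \<sigma> where "str_code \<sigma> = N - 1" using ex_str_code by metis
  ultimately have "num \<sigma> = N" by (simp add: num_def)
  moreover have "floor_log N = n" using floor_log_eqI \<open>0 < N\<close> N by blast
  ultimately show ?thesis by (metis floor_log_num)
qed

lemma num_nth: "i < length \<sigma> \<Longrightarrow> odd (num \<sigma> div 2 ^ i) \<longleftrightarrow> \<sigma> ! i"
proof (induction \<sigma> arbitrary: i)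
  case (Cons b \<sigma>)
  have half: "(of_bool b + 2 * num \<sigma>) div 2 = num \<sigma>" by simp
  show ?case
  proof (cases i)
    case (Suc j)
    then show ?thesis using Cons.IH[of j] Cons.prems half by (simp add: div_mult2_eq)
  qed simp
qed simp

lemma num_mod_eq_iff:
  assumes "m \<le> length \<sigma>" "m \<le> length \<tau>"
  shows "num \<sigma> mod 2 ^ m = num \<tau> mod 2 ^ m \<longleftrightarrow> take m \<sigma> = take m \<tau>"
  using assms
proof (induction m arbitrary: \<sigma> \<tau>)
  case (Suc m)
  then obtain b \<sigma>' c \<tau>' where *: "\<sigma> = b # \<sigma>'" "\<tau> = c # \<tau>'" "m \<le> length \<sigma>'" "m \<le> length \<tau>'"
    by (cases \<sigma>; cases \<tau>) auto
  have mod: "(of_bool d + 2 * x) mod 2 ^ Suc m = of_bool d + 2 * (x mod 2 ^ m)" for d and x :: nat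
    unfolding power_Suc by (subst mod_mult2_eq) simp
  have "of_bool b + 2 * x = of_bool c + 2 * y \<longleftrightarrow> b = c \<and> x = y" for x y :: nat
    by (cases b; cases c; simp; presburger)
  then show ?case using * Suc.IH[OF *(3,4)] by (simp only: num_Cons mod take_Suc_Cons list.inject)
qed simp

section \<open>Machines that search\<close>

text \<open>
  With at most one witness, unbounded minimisation finds it if there is one and diverges otherwise, so
  that the domain of the resulting machine is known exactly.
\<close>

lemma evaluates_search:
  assumes A: "decidable (\<lambda>e. A (e 0) (e 1))" and G: "computable (\<lambda>e. G (e 0))"
    and uniq: "\<And>x w w'. A w x \<Longrightarrow> A w' x \<Longrightarrow> w = w'"
  shows "\<exists>f. \<forall>x y. evaluates f [x] y \<longleftrightarrow> (\<exists>w. A w x \<and> y = G w)"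
proof -
  have "computable (\<lambda>e. of_bool (\<not> A (e 0) (e 1)))" by (intro comp_intros A)
  from computable_arity[OF this, of 2] obtain h where
    "\<And>xs. length xs = 2 \<Longrightarrow> evaluates h xs (of_bool (\<not> A (xs ! 0) (xs ! 1)))" by auto
  from this[of "[_, _]"] have h: "evaluates h [w, x] (of_bool (\<not> A w x))" for w x by simp
  from computable_arity[OF G, of 1] obtain g where
    "\<And>xs. length xs = 1 \<Longrightarrow> evaluates g xs (G (xs ! 0))" by auto
  from this[of "[_]"] have g: "evaluates g [w] (G w)" for w by simp
  have M: "evaluates (Minim h) [x] w \<longleftrightarrow> A w x" for x w
  proof
    assume "evaluates (Minim h) [x] w"
    then have "evaluates h [w, x] 0" by (auto elim: evaluates.cases)
    then show "A w x" using evaluates_deterministic[OF h] by fastforce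
  next
    assume "A w x"
    show "evaluates (Minim h) [x] w"
    proof (rule evaluates.minim)
      show "evaluates h [w, x] 0" using h[of w x] \<open>A w x\<close> by simp
      fix z assume "z < w"
      then have "\<not> A z x" using uniq \<open>A w x\<close> by blast
      then show "\<exists>v. 0 < v \<and> evaluates h [z, x] v" using h[of z x] by (intro exI[of _ 1]) simp
    qed
  qed
  have "evaluates (Comp g [Minim h]) [x] y \<longleftrightarrow> (\<exists>w. A w x \<and> y = G w)" for x y
  proof
    assume "evaluates (Comp g [Minim h]) [x] y"
    then obtain w where "evaluates (Minim h) [x] w" "evaluates g [w] y"
      by (auto elim!: evaluates.cases[of "Comp g [Minim h]"] simp: list_all2_Cons1)
    then show "\<exists>w. A w x \<and> y = G w" using M evaluates_deterministic[OF g] by blast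
  next
    assume "\<exists>w. A w x \<and> y = G w"
    then obtain w where "A w x" "y = G w" by blast
    then show "evaluates (Comp g [Minim h]) [x] y"
      using g[of w] by (intro evaluates.comp[where ys = "[w]"]) (simp_all add: M)
  qed
  then show ?thesis by blast
qed

lemma machine_of_recf: "\<exists>M. partial_computable M \<and>
    (\<forall>\<sigma> \<tau>. M \<sigma> = Some \<tau> \<longleftrightarrow> evaluates f [str_code \<sigma>] (str_code \<tau>))"
proof -
  define M where "M \<sigma> = (if \<exists>\<tau>. evaluates f [str_code \<sigma>] (str_code \<tau>)
      then Some (SOME \<tau>. evaluates f [str_code \<sigma>] (str_code \<tau>)) else None)" for \<sigma>
  have inj: "str_code \<tau> = str_code \<tau>' \<Longrightarrow> \<tau> = \<tau>'" for \<tau> \<tau>'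
    using bij_str_code by (auto simp: bij_def inj_eq)
  have "M \<sigma> = Some \<tau> \<longleftrightarrow> evaluates f [str_code \<sigma>] (str_code \<tau>)" for \<sigma> \<tau>
  proof
    assume "M \<sigma> = Some \<tau>"
    then show "evaluates f [str_code \<sigma>] (str_code \<tau>)"
      by (auto simp: M_def split: if_splits intro: someI)
  next
    assume *: "evaluates f [str_code \<sigma>] (str_code \<tau>)"
    then have "evaluates f [str_code \<sigma>] (str_code (SOME \<tau>. evaluates f [str_code \<sigma>] (str_code \<tau>)))"
      by (rule someI)
    then have "(SOME \<tau>. evaluates f [str_code \<sigma>] (str_code \<tau>)) = \<tau>"
      using * evaluates_deterministic inj by blast
    with * show "M \<sigma> = Some \<tau>" by (auto simp: M_def)
  qed
  then show ?thesis unfolding partial_computable_def by blast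
qed

section \<open>Describing the members of a small enumerable set\<close>

text \<open>
  Two numbers in unary, followed by a payload whose length is determined by them. Recording a square root
  \<open>b\<close> of the payload length in unary costs only a lower order term.
\<close>

definition program :: "nat \<Rightarrow> nat \<Rightarrow> bool list \<Rightarrow> bool list" where
  "program a b w = replicate a True @ False # replicate b True @ False # w"

lemma replicate_prefix_eq:
  "prefix (replicate a True @ False # u) (replicate b True @ False # v) \<Longrightarrow> a = b \<and> prefix u v"
proof (induction a arbitrary: b)
  case 0 then show ?case by (cases b) auto
next
  case (Suc a) then show ?case by (cases b) auto
qed

lemma prefix_program:
  assumes "prefix (program a b w) (program a' b' w')" "length w = l a b" "length w' = l a' b'"
  shows "a = a' \<and> b = b' \<and> w = w'"
proof -
  have "a = a' \<and> prefix (replicate b True @ False # w) (replicate b' True @ False # w')"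
    using assms(1) unfolding program_def by (rule replicate_prefix_eq)
  then have *: "a = a'" "b = b'" "prefix w w'" using replicate_prefix_eq by blast+
  then show ?thesis using assms(2,3) by (auto simp: prefix_def)
qed

lemma num_program: "num (program a b w) + 1 = 2 ^ a + 2 ^ Suc a * (2 ^ b + 2 ^ Suc b * num w - 1)"
proof -
  have *: "num (replicate k True @ False # u) + 1 = 2 ^ k + 2 ^ Suc k * num u" for k u
    by (induction k) auto
  have "num (replicate b True @ False # w) = 2 ^ b + 2 ^ Suc b * num w - 1" using *[of b w] by simp
  with *[of a] show ?thesis by (simp add: program_def)
qed

text \<open>
  A member of a c.e. set with parameter \<open>c\<close> is described by \<open>c\<close> together with its position in the
  enumeration of that set. If the set has at most \<open>2^(b^2)\<close> members, then \<open>a + b^2\<close> bits are enough for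
  \<open>c\<close> and the position. The machine does not verify the cardinality bound; it is only used to see that
  the position fits into the payload.
\<close>

lemma counting_code:
  assumes U: "optimal_machine U" and P: "decidable (\<lambda>e. P (e 0) (e 1) (e 2))"
  shows "\<exists>C. \<forall>c a b \<sigma>. c < 2 ^ a \<longrightarrow> finite {\<tau>. \<exists>s. P c (str_code \<tau>) s} \<longrightarrow>
     card {\<tau>. \<exists>s. P c (str_code \<tau>) s} \<le> 2 ^ b\<^sup>2 \<longrightarrow> (\<exists>s. P c (str_code \<sigma>) s) \<longrightarrow>
     (\<exists>p. U p = Some \<sigma> \<and> length p \<le> 2 * a + b\<^sup>2 + b + C)"
proof -
  \<comment> \<open>\<open>w\<close> is the first pair that witnesses membership of its first component, so that every member
    is enumerated exactly once.\<close>
  define new where "new c w \<longleftrightarrow> P c (pfst w) (psnd w) \<and> (\<forall>v<w. pfst v = pfst w \<longrightarrow> \<not> P c (pfst v) (psnd v))" for c w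
  define nth_new where "nth_new c j w \<longleftrightarrow> new c w \<and> (\<Sum>v<w. of_bool (new c v)) = j" for c w and j :: nat
  define A where "A w x \<longleftrightarrow> (\<exists>a<Suc x. \<exists>b<Suc x. \<exists>V<Suc x.
      Suc (Suc x) = 2 ^ a + 2 ^ Suc a * (2 ^ b + 2 ^ Suc b * V - 1) \<and>
      2 ^ (a + b\<^sup>2) \<le> V \<and> V < 2 * 2 ^ (a + b\<^sup>2) \<and> nth_new (V mod 2 ^ a) (V div 2 ^ a - 2 ^ b\<^sup>2) w)" for w x
  have P': "decidable (\<lambda>e. P (F e) (G e) (H e))" if "computable F" "computable G" "computable H" for F G H
    using computable_subst[OF P[unfolded decidable_def], of "case_nat F (case_nat G (\<lambda>_. H))"] that
    by (simp add: decidable_def split: nat.split)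
  have new: "decidable (\<lambda>e. new (F e) (G e))" if "computable F" "computable G" for F G
    unfolding new_def by (intro comp_intros P' that computable_shift)
  have nth_new: "decidable (\<lambda>e. nth_new (F e) (J e) (G e))" if "computable F" "computable G" "computable J" for F G J
    unfolding nth_new_def by (intro comp_intros new that computable_shift)
  have A_dec: "decidable (\<lambda>e. A (e 0) (e 1))" unfolding A_def by (intro comp_intros nth_new)
  \<comment> \<open>Quantifying over all candidates avoids parsing the program.\<close>
  have A_prog: "A w (str_code p) \<longleftrightarrow> (\<exists>a b u. p = program a b u \<and> length u = a + b\<^sup>2 \<and>
      nth_new (num u mod 2 ^ a) (num u div 2 ^ a - 2 ^ b\<^sup>2) w)" (is "_ \<longleftrightarrow> ?R") for w p
  proof
    assume "A w (str_code p)"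
    then obtain a b V where *: "num p + 1 = 2 ^ a + 2 ^ Suc a * (2 ^ b + 2 ^ Suc b * V - 1)"
      "2 ^ (a + b\<^sup>2) \<le> V" "V < 2 * 2 ^ (a + b\<^sup>2)" "nth_new (V mod 2 ^ a) (V div 2 ^ a - 2 ^ b\<^sup>2) w"
      unfolding A_def by (auto simp: num_def)
    obtain u where u: "length u = a + b\<^sup>2" "num u = V" using num_surj[OF *(2,3)] by blast
    have "num p = num (program a b u)" using *(1) num_program[of a b u] u by simp
    then have "p = program a b u" by (simp add: inj_num)
    with u * show ?R by blast
  next
    assume ?R
    then obtain a b u where *: "p = program a b u" "length u = a + b\<^sup>2"
      "nth_new (num u mod 2 ^ a) (num u div 2 ^ a - 2 ^ b\<^sup>2) w" by blast
    have eq: "num p + 1 = 2 ^ a + 2 ^ Suc a * (2 ^ b + 2 ^ Suc b * num u - 1)"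
      using num_program * by blast
    have u: "2 ^ (a + b\<^sup>2) \<le> num u" "num u < 2 * 2 ^ (a + b\<^sup>2)" using num_bounds[of u] * by auto
    have len: "length p = a + b + 2 + (a + b\<^sup>2)" using * by (simp add: program_def)
    have "length p < num p" using num_bounds(1)[of p] less_exp[of "length p"] by (meson less_le_trans)
    then have "a < num p" "b < num p" using len by auto
    moreover have "num u < num p"
    proof -
      have "num u < 2 ^ Suc (length u)" using u * by simp
      also have "\<dots> \<le> 2 ^ length p" using len * by (intro power_increasing) auto
      also have "\<dots> \<le> num p" by (rule num_bounds)
      finally show ?thesis .
    qed
    ultimately show "A w (str_code p)" using * u eq unfolding A_def num_def[of p, symmetric]
      by (metis Suc_eq_plus1 num_def)
  qed
  have nth_uniq: "w = w'" if "nth_new c j w" "nth_new c j w'" for c j w w'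
  proof (rule ccontr)
    have *: "(\<Sum>v<w. of_bool (new c v)) < (\<Sum>v<w'. of_bool (new c v) :: nat)" if "w < w'" "new c w" for w w'
    proof -
      have "(\<Sum>v<w. of_bool (new c v)) < (\<Sum>v<Suc w. of_bool (new c v) :: nat)" using that by simp
      also have "\<dots> \<le> (\<Sum>v<w'. of_bool (new c v))" using that by (intro sum_mono2) auto
      finally show ?thesis .
    qed
    assume "w \<noteq> w'"
    then consider "w < w'" | "w' < w" by linarith
    then show False using * that unfolding nth_new_def by cases fastforce+
  qed
  have uniq: "w = w'" if A: "A w x" "A w' x" for x w w'
  proof -
    obtain p where x: "x = str_code p" using ex_str_code by metis
    obtain a b u where 1: "p = program a b u" "length u = a + b\<^sup>2"
      "nth_new (num u mod 2 ^ a) (num u div 2 ^ a - 2 ^ b\<^sup>2) w" using A(1) A_prog x by blast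
    obtain a' b' u' where 2: "p = program a' b' u'" "length u' = a' + b'\<^sup>2"
      "nth_new (num u' mod 2 ^ a') (num u' div 2 ^ a' - 2 ^ b'\<^sup>2) w'" using A(2) A_prog x by blast
    have "prefix (program a b u) (program a' b' u')" using 1 2 by simp
    then have "a = a' \<and> b = b' \<and> u = u'"
      by (rule prefix_program[where l = "\<lambda>a b. a + b\<^sup>2"]) (use 1 2 in auto)
    then show ?thesis using 1 2 nth_uniq by blast
  qed
  have "computable (\<lambda>e. pfst (e 0))" by (intro comp_intros)
  then have "\<exists>f. \<forall>x y. evaluates f [x] y \<longleftrightarrow> (\<exists>w. A w x \<and> y = pfst w)"
    by (rule evaluates_search[OF A_dec]) (rule uniq)
  then obtain f where f: "\<And>x y. evaluates f [x] y \<longleftrightarrow> (\<exists>w. A w x \<and> y = pfst w)" by blast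
  obtain M where M: "partial_computable M"
      "\<And>\<sigma> \<tau>. M \<sigma> = Some \<tau> \<longleftrightarrow> evaluates f [str_code \<sigma>] (str_code \<tau>)"
    using machine_of_recf by blast
  have "prefix_free (dom M)" unfolding prefix_free_def
  proof (intro ballI impI)
    have form: "\<exists>a b u. p = program a b u \<and> length u = a + b\<^sup>2" if "p \<in> dom M" for p
    proof -
      obtain w where "A w (str_code p)" using \<open>p \<in> dom M\<close> M(2) f by blast
      then show ?thesis unfolding A_prog by blast
    qed
    fix p q assume "p \<in> dom M" "q \<in> dom M" "prefix p q"
    then show "p = q"
      using form[of p] form[of q] prefix_program[where l = "\<lambda>a b. a + b\<^sup>2"] by metis
  qed
  then have "prefix_free_machine M" using M(1) by (simp add: prefix_free_machine_def)
  then obtain C where C: "\<And>p \<sigma>. M p = Some \<sigma> \<Longrightarrow> \<exists>q. U q = Some \<sigma> \<and> length q \<le> length p + C"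
    using U unfolding optimal_machine_def by blast
  have "\<exists>p. U p = Some \<sigma> \<and> length p \<le> 2 * a + b\<^sup>2 + b + (C + 2)"
    if c: "c < 2 ^ a" and fin: "finite {\<tau>. \<exists>s. P c (str_code \<tau>) s}"
      and card: "card {\<tau>. \<exists>s. P c (str_code \<tau>) s} \<le> 2 ^ b\<^sup>2" and \<sigma>: "\<exists>s. P c (str_code \<sigma>) s" for c a b \<sigma>
  proof -
    let ?Q = "\<lambda>w. pfst w = str_code \<sigma> \<and> P c (pfst w) (psnd w)"
    obtain s where "P c (str_code \<sigma>) s" using \<sigma> ..
    then have "?Q (pair (str_code \<sigma>) s)" by simp
    then have "\<exists>w. ?Q w" by blast
    then obtain w where w: "?Q w" "\<forall>v<w. \<not> ?Q v" using exists_least_iff[of ?Q] by blast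
    then have new_w: "new c w" unfolding new_def by auto
    define j where "j = (\<Sum>v<w. of_bool (new c v) :: nat)"
    have j_card: "Suc j = card {v. v < Suc w \<and> new c v}"
    proof -
      have "Suc j = (\<Sum>v<Suc w. of_bool (new c v))" using new_w by (simp add: j_def)
      also have "\<dots> = card {v. v < Suc w \<and> new c v}"
        by (simp add: of_bool_def sum.If_cases Int_def del: sum.lessThan_Suc)
      finally show ?thesis .
    qed
    have new_less: False if "new c v" "new c v'" "pfst v = pfst v'" "v < v'" for v v'
      using that unfolding new_def by simp
    have "inj_on pfst {v. v < Suc w \<and> new c v}"
    proof (rule inj_onI)
      fix v v' assume "v \<in> {v. v < Suc w \<and> new c v}" "v' \<in> {v. v < Suc w \<and> new c v}" "pfst v = pfst v'"
      then show "v = v'" using new_less[of v v'] new_less[of v' v] by (cases v v' rule: linorder_cases) simp_all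
    qed
    moreover have "pfst ` {v. v < Suc w \<and> new c v} \<subseteq> str_code ` {\<tau>. \<exists>s. P c (str_code \<tau>) s}"
    proof clarify
      fix v assume "new c v"
      moreover obtain \<tau> where "str_code \<tau> = pfst v" using ex_str_code by metis
      ultimately have "\<exists>s. P c (str_code \<tau>) s" unfolding new_def by auto
      then show "pfst v \<in> str_code ` {\<tau>. \<exists>s. P c (str_code \<tau>) s}"
        using \<open>str_code \<tau> = pfst v\<close> by (intro image_eqI[of _ _ \<tau>]) simp_all
    qed
    ultimately have "Suc j \<le> card (str_code ` {\<tau>. \<exists>s. P c (str_code \<tau>) s})"
      unfolding j_card using fin by (intro card_inj_on_le[of pfst] finite_imageI)
    also have "\<dots> \<le> 2 ^ b\<^sup>2" using card card_image_le[OF fin, of str_code] by linarith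
    finally have j: "Suc j \<le> 2 ^ b\<^sup>2" .
    define V where "V = c + 2 ^ a * (2 ^ b\<^sup>2 + j)"
    have V: "V mod 2 ^ a = c" "V div 2 ^ a - 2 ^ b\<^sup>2 = j" using c by (simp_all add: V_def)
    have "2 ^ (a + b\<^sup>2) \<le> V" by (simp add: V_def power_add algebra_simps)
    moreover have "V < 2 * 2 ^ (a + b\<^sup>2)"
    proof -
      have "V < 2 ^ a * (2 ^ b\<^sup>2 + Suc j)" using c by (simp add: V_def algebra_simps)
      also have "\<dots> \<le> 2 ^ a * (2 ^ b\<^sup>2 + 2 ^ b\<^sup>2)" using j by (intro mult_left_mono) auto
      finally show ?thesis by (simp add: power_add algebra_simps)
    qed
    ultimately obtain u where u: "length u = a + b\<^sup>2" "num u = V" using num_surj by blast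
    have "nth_new c j w" using new_w by (simp add: nth_new_def j_def)
    then have "A w (str_code (program a b u))" unfolding A_prog using u V by blast
    then have "evaluates f [str_code (program a b u)] (str_code \<sigma>)" unfolding f using w(1) by (intro exI[of _ w]) simp
    then have "M (program a b u) = Some \<sigma>" by (simp add: M(2))
    then obtain q where "U q = Some \<sigma>" "length q \<le> length (program a b u) + C" using C by blast
    then show ?thesis using u by (intro exI[of _ q]) (simp add: program_def)
  qed
  then show ?thesis by blast
qed

section \<open>A left-c.e. martingale measuring compressibility\<close>

text \<open>
  Induction on the maximal length: removing the first bit splits the set into two prefix-free sets of
  shorter strings, each contributing half of its sum.
\<close>

lemma kraft_inequality:
  assumes "finite A" "prefix_free A"
  shows "(\<Sum>p\<in>A. 1 / 2 ^ length p) \<le> (1::real)"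
proof -
  have "(\<Sum>p\<in>A. 1 / 2 ^ length p) \<le> (1::real)"
    if "finite A" "prefix_free A" "\<And>p. p \<in> A \<Longrightarrow> length p \<le> n" for n A
    using that
  proof (induction n arbitrary: A)
    case 0
    then have "A \<subseteq> {[]}" by auto
    then have "(\<Sum>p\<in>A. 1 / 2 ^ length p) \<le> (\<Sum>p\<in>{[]::bool list}. 1 / 2 ^ length p :: real)"
      by (intro sum_mono2) auto
    then show ?case by simp
  next
    case (Suc n)
    show ?case
    proof (cases "[] \<in> A")
      case True
      have "p = []" if "p \<in> A" for p
        using bspec[OF bspec[OF Suc.prems(2)[unfolded prefix_free_def] True] that] by simp
      then have "A = {[]}" using True by blast
      then show ?thesis by simp
    next
      case False
      define B where "B b = {p. b # p \<in> A}" for b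
      have A: "A = Cons True ` B True \<union> Cons False ` B False"
      proof (intro set_eqI iffI)
        fix p assume "p \<in> A"
        with False obtain b p' where "p = b # p'" by (cases p) auto
        with \<open>p \<in> A\<close> show "p \<in> Cons True ` B True \<union> Cons False ` B False"
          by (cases b) (auto simp: B_def)
      qed (auto simp: B_def)
      have fin: "finite (B b)" for b
        using finite_vimageI[OF Suc.prems(1), of "Cons b"] by (simp add: B_def vimage_def)
      have le: "(\<Sum>p\<in>B b. 1 / 2 ^ length p) \<le> (1::real)" for b
      proof (rule Suc.IH[OF fin])
        show "prefix_free (B b)" unfolding prefix_free_def
        proof (intro ballI impI)
          fix p q assume "p \<in> B b" "q \<in> B b" "prefix p q"
          then show "p = q"
            using bspec[OF bspec[OF Suc.prems(2)[unfolded prefix_free_def], of "b # p"], of "b # q"]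
            by (simp add: B_def)
        qed
        show "length p \<le> n" if "p \<in> B b" for p
          using that Suc.prems(3)[of "b # p"] by (simp add: B_def)
      qed
      have "(\<Sum>p\<in>A. 1 / 2 ^ length p) = (\<Sum>p\<in>Cons True ` B True. 1 / 2 ^ length p)
          + (\<Sum>p\<in>Cons False ` B False. 1 / 2 ^ length p :: real)"
        by (subst A, rule sum.union_disjoint) (auto simp: fin)
      also have "\<dots> = (\<Sum>p\<in>B True. 1 / 2 ^ length p) / 2 + (\<Sum>p\<in>B False. 1 / 2 ^ length p) / 2"
        by (simp add: sum.reindex sum_divide_distrib mult.commute)
      also have "\<dots> \<le> 1" using le[of True] le[of False] by simp
      finally show ?thesis .
    qed
  qed
  from this[OF assms, of "Max (length ` A)"] show ?thesis using assms(1) by simp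
qed

text \<open>
  \<open>2^(min (length z) m)\<close> if the string \<open>z\<close> with number \<open>Z\<close> is comparable with the string of length \<open>m\<close> with
  number \<open>Y\<close>, and 0 otherwise: the conditional expectation, given that string, of \<open>2^(length z)\<close> times
  the indicator of the sequences extending \<open>z\<close>.
\<close>

definition overlap :: "nat \<Rightarrow> nat \<Rightarrow> nat \<Rightarrow> nat" where
  "overlap Z m Y = (let l = min (floor_log Z) m in if Z mod 2 ^ l = Y mod 2 ^ l then 2 ^ l else 0)"

lemma computable_overlap [comp_intros]:
  assumes "computable F" "computable G" "computable H"
  shows "computable (\<lambda>e. overlap (F e) (G e) (H e))"
  unfolding overlap_def Let_def by (intro comp_intros assms)

lemma overlap_num: "overlap (num z) (length y) (num y) =
   (if take (min (length z) (length y)) z = take (min (length z) (length y)) y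
    then 2 ^ min (length z) (length y) else 0)"
  by (simp add: overlap_def num_mod_eq_iff)

lemma overlap_take: "n \<le> length y \<Longrightarrow> overlap Z n (num (take n y)) = overlap Z n (num y)"
proof -
  assume n: "n \<le> length y"
  have "num (take n y) mod 2 ^ l = num y mod 2 ^ l" if "l \<le> n" for l
    using n that by (subst num_mod_eq_iff) (auto simp: min_absorb1)
  then show ?thesis by (simp add: overlap_def Let_def)
qed

lemma overlap_martingale:
  assumes "0 < Z"
  shows "overlap Z (Suc (length y)) (num (y @ [False])) + overlap Z (Suc (length y)) (num (y @ [True]))
    = 2 * overlap Z (length y) (num y)"
proof -
  obtain z where "str_code z = Z - 1" using ex_str_code by blast
  with assms have Z: "Z = num z" by (simp add: num_def)
  have ov: "overlap Z (Suc (length y)) (num (y @ [b])) =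
    (if take (min (length z) (Suc (length y))) z = take (min (length z) (Suc (length y))) (y @ [b])
      then 2 ^ min (length z) (Suc (length y)) else 0)" for b
    using overlap_num[of z "y @ [b]"] Z by simp
  show ?thesis
  proof (cases "length z \<le> length y")
    case True
    then show ?thesis unfolding ov unfolding Z overlap_num by (simp add: min_absorb1)
  next
    case False
    then have "take (Suc (length y)) z = take (length y) z @ [z ! length y]"
      by (simp add: take_Suc_conv_app_nth)
    with False show ?thesis unfolding ov unfolding Z overlap_num
      by (cases "z ! length y") (auto simp: min_def)
  qed
qed

text \<open>
  A prefix-free machine with a computable approximation: \<open>h s (str_code p)\<close> is the number of the output
  of \<open>p\<close> once it is known by stage \<open>s\<close>, and 0 before.
\<close>

locale staged_machine =
  fixes U :: "bool list \<Rightarrow> bool list option" and h :: "nat \<Rightarrow> nat \<Rightarrow> nat"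
  assumes computable_h: "computable (\<lambda>e. h (e 0) (e 1))"
    and h_mono: "\<And>s s' x. s \<le> s' \<Longrightarrow> 0 < h s x \<Longrightarrow> h s' x = h s x"
    and h_limit: "\<And>p \<sigma>. U p = Some \<sigma> \<longleftrightarrow> (\<exists>s. h s (str_code p) = num \<sigma>)"
    and prefix_free_dom: "prefix_free (dom U)"
begin

text \<open>
  The integer \<open>2^s * mass s y\<close>, which is what is actually computed; the denominators divide \<open>2^s\<close> because
  only programs with codes below \<open>s\<close> contribute.
\<close>

definition scaled_mass :: "nat \<Rightarrow> nat \<Rightarrow> nat \<Rightarrow> nat" where
  "scaled_mass s m Y = (\<Sum>x<s. if h s x = 0 then 0 else 2 ^ (s - floor_log (Suc x)) * overlap (h s x) m Y)"

text \<open>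
  For every description \<open>p\<close> of a string \<open>z\<close> found by stage \<open>s\<close>, a capital of \<open>2^(-length p)\<close> is staked
  on \<open>z\<close> and doubles with each correct bit.
\<close>

definition mass :: "nat \<Rightarrow> bool list \<Rightarrow> real" where
  "mass s y = (\<Sum>x<s. if h s x = 0 then 0
     else real (overlap (h s x) (length y) (num y)) / 2 ^ floor_log (Suc x))"

definition room :: "nat \<Rightarrow> bool list \<Rightarrow> real" where
  "room s y = max 0 (1 - mass s y / 2)"

lemma floor_log_Suc_le: "floor_log (Suc x) \<le> x"
proof -
  have "floor_log (Suc x) < 2 ^ floor_log (Suc x)" by simp
  also have "\<dots> \<le> Suc x" by (rule floor_log_exp2_le) simp
  finally show ?thesis by simp
qed

lemma scaled_mass: "real (scaled_mass s (length y) (num y)) = 2 ^ s * mass s y"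
proof -
  have "real (2 ^ (s - floor_log (Suc x)) * k) = 2 ^ s * (real k / 2 ^ floor_log (Suc x))"
    if "x < s" for x k
  proof -
    have "floor_log (Suc x) \<le> s" using floor_log_Suc_le[of x] that by simp
    then have "(2::real) ^ (s - floor_log (Suc x)) = 2 ^ s / 2 ^ floor_log (Suc x)"
      by (intro power_diff) auto
    then show ?thesis by simp
  qed
  then show ?thesis unfolding scaled_mass_def mass_def sum_distrib_left of_nat_sum
    by (intro sum.cong) auto
qed

lemma scaled_mass_take:
  assumes "n \<le> length y" shows "scaled_mass s n (num (take n y)) = scaled_mass s n (num y)"
  unfolding scaled_mass_def overlap_take[OF assms] ..

lemma room_eq: "room s y = real (2 ^ Suc s - scaled_mass s (length y) (num y)) / 2 ^ Suc s"
proof -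
  let ?m = "scaled_mass s (length y) (num y)"
  have "1 - mass s y / 2 = (2 ^ Suc s - real ?m) / 2 ^ Suc s"
    unfolding scaled_mass by (simp add: field_simps)
  moreover have "real (2 ^ Suc s - ?m) = max 0 (2 ^ Suc s - real ?m)"
    by (cases "?m \<le> 2 ^ Suc s") (auto simp: of_nat_diff max_def simp del: power_Suc)
  ultimately show ?thesis
    by (simp add: room_def max_divide_distrib_right del: power_Suc)
qed

lemma mass_martingale: "mass s (y @ [False]) + mass s (y @ [True]) = 2 * mass s y"
proof -
  have "real (overlap Z (Suc (length y)) (num (y @ [False]))) / c
      + real (overlap Z (Suc (length y)) (num (y @ [True]))) / c
    = 2 * (real (overlap Z (length y) (num y)) / c)" if "0 < Z" for Z and c :: real
    using overlap_martingale[OF that, of y] by (simp flip: add_divide_distrib of_nat_add)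
  then show ?thesis unfolding mass_def sum_distrib_left sum.distrib[symmetric]
    by (intro sum.cong) auto
qed

lemma room_submartingale: "2 * room s y \<le> room s (y @ [False]) + room s (y @ [True])"
proof -
  have "1 - mass s (y @ [b]) / 2 \<le> room s (y @ [b])" "0 \<le> room s (y @ [b])" for b
    by (simp_all add: room_def)
  from this[of False] this[of True] show ?thesis
    using mass_martingale[of s y] by (cases "1 - mass s y / 2 \<le> 0") (simp_all add: room_def)
qed

lemma mass_mono: "s \<le> s' \<Longrightarrow> mass s y \<le> mass s' y"
proof -
  assume s: "s \<le> s'"
  have "mass s y \<le> (\<Sum>x<s. if h s' x = 0 then 0
     else real (overlap (h s' x) (length y) (num y)) / 2 ^ floor_log (Suc x))"
    unfolding mass_def
  proof (rule sum_mono)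
    fix x
    show "(if h s x = 0 then 0 else real (overlap (h s x) (length y) (num y)) / 2 ^ floor_log (Suc x))
      \<le> (if h s' x = 0 then 0 else real (overlap (h s' x) (length y) (num y)) / 2 ^ floor_log (Suc x))"
      using h_mono[OF s, of x] by (cases "h s x = 0") auto
  qed
  also have "\<dots> \<le> mass s' y" unfolding mass_def using s by (intro sum_mono2) auto
  finally show ?thesis .
qed

lemma room_antimono: "s \<le> s' \<Longrightarrow> room s' y \<le> room s y"
  using mass_mono[of s s' y] by (simp add: room_def)

lemma mass_nonneg: "0 \<le> mass s y"
  unfolding mass_def by (intro sum_nonneg) auto

lemma room_le_1: "room s y \<le> 1"
  using mass_nonneg[of s y] by (simp add: room_def)

text \<open>
  The initial mass is the sum of the weights of halting programs, hence at most 1.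
\<close>

lemma room_Nil: "1 / 2 \<le> room s []"
proof -
  let ?A = "{x \<in> {..<s}. h s x \<noteq> 0}"
  define dec where "dec = inv str_code"
  have dec: "str_code (dec x) = x" for x
    unfolding dec_def using bij_str_code by (simp add: bij_is_surj surj_f_inv_f)
  have "dec ` ?A \<subseteq> dom U"
  proof (rule image_subsetI)
    fix x assume "x \<in> ?A"
    then have x: "h s x \<noteq> 0" by simp
    obtain z where "str_code z = h s x - 1" using ex_str_code by blast
    then have "h s (str_code (dec x)) = num z" using x by (simp add: num_def dec)
    then have "U (dec x) = Some z" using h_limit by blast
    then show "dec x \<in> dom U" by blast
  qed
  then have pf: "prefix_free (dec ` ?A)" using prefix_free_dom unfolding prefix_free_def by blast
  have len: "floor_log (Suc x) = length (dec x)" for x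
    using floor_log_num[of "dec x"] by (simp add: num_def dec)
  have inj: "inj_on dec ?A" using dec by (metis inj_onI)
  have "mass s [] = (\<Sum>x<s. if h s x = 0 then 0 else 1 / 2 ^ floor_log (Suc x))"
    unfolding mass_def by (intro sum.cong) (auto simp: overlap_def)
  also have "\<dots> = (\<Sum>x\<in>?A. 1 / 2 ^ floor_log (Suc x))"
    by (rule sum.mono_neutral_cong_right) auto
  also have "\<dots> = (\<Sum>p\<in>dec ` ?A. 1 / 2 ^ length p)"
    by (simp only: sum.reindex[OF inj] len o_def)
  also have "\<dots> \<le> 1" using pf by (intro kraft_inequality) auto
  finally show ?thesis by (simp add: room_def)
qed

text \<open>
  A description \<open>p\<close> of \<open>y\<close> alone gives \<open>y\<close> the mass \<open>2^(length y - length p)\<close>, which is below 2.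
\<close>

lemma room_pos_incompressible:
  assumes "\<And>s. 0 < room s y" "U p = Some y"
  shows "length y \<le> length p"
proof -
  obtain t where t: "h t (str_code p) = num y" using assms(2) h_limit by blast
  define s where "s = max t (Suc (str_code p))"
  have hs: "h s (str_code p) = num y"
    using h_mono[of t s "str_code p"] t by (simp add: s_def num_def)
  define f where "f x = (if h s x = 0 then 0
    else real (overlap (h s x) (length y) (num y)) / 2 ^ floor_log (Suc x))" for x
  have "f (str_code p) \<le> mass s y" unfolding mass_def f_def[symmetric]
    by (rule member_le_sum) (auto simp: s_def f_def)
  moreover have "f (str_code p) = 2 ^ length y / 2 ^ length p"
    using hs floor_log_num[of p, unfolded num_def] by (simp add: f_def overlap_num) (simp add: num_def)
  moreover have "mass s y < 2" using assms(1)[of s] by (simp add: room_def max_def split: if_splits)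
  ultimately have "2 ^ length y / 2 ^ length p < (2::real)" by linarith
  then have "(2::real) ^ length y < 2 ^ Suc (length p)" by (simp add: divide_less_eq mult.commute)
  then show ?thesis by (simp only: power_strict_increasing_iff less_Suc_eq_le)
qed

lemma computable_h_subst [comp_intros]:
  assumes "computable F" "computable G" shows "computable (\<lambda>e. h (F e) (G e))"
  using computable_subst[OF computable_h, of "case_nat F (\<lambda>_. G)"] assms by (simp split: nat.split)

lemma computable_scaled_mass [comp_intros]:
  assumes "computable F" "computable G" "computable H"
  shows "computable (\<lambda>e. scaled_mass (F e) (G e) (H e))"
  unfolding scaled_mass_def by (intro comp_intros assms computable_shift)

end

lemma optimal_machine_staged:
  assumes "optimal_machine U" shows "\<exists>h. staged_machine U h"
proof -
  obtain f where f: "\<And>\<sigma> \<tau>. U \<sigma> = Some \<tau> \<longleftrightarrow> evaluates f [str_code \<sigma>] (str_code \<tau>)"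
    using assms unfolding optimal_machine_def prefix_free_machine_def partial_computable_def by blast
  obtain H where H: "simulates H 1 f" using ex_simulates by blast
  have "staged_machine U (\<lambda>s x. H s [x])"
  proof
    show "computable (\<lambda>e. H (e 0) [e 1])" using H by (simp add: simulates_def)
    show "H s' [x] = H s [x]" if "s \<le> s'" "0 < H s [x]" for s s' x
      using simulates_pos_mono[OF H _ that] by simp
    show "U p = Some \<sigma> \<longleftrightarrow> (\<exists>s. H s [str_code p] = num \<sigma>)" for p \<sigma>
      using f simulates_iff[OF H, of "[str_code p]"] by (simp add: num_def)
    show "prefix_free (dom U)"
      using assms by (simp add: optimal_machine_def prefix_free_machine_def)
  qed
  then show ?thesis by (rule exI[of _ "\<lambda>s x. H s [x]"])
qed

section \<open>The two-point inequality\<close>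

lemma cosh_le_exp_square: "0 \<le> x \<Longrightarrow> x \<le> 1 \<Longrightarrow> cosh x \<le> exp (x\<^sup>2)" for x :: real
proof -
  assume x: "0 \<le> x" "x \<le> 1"
  have "exp (- x) = 1 / exp x" by (simp add: exp_minus inverse_eq_divide)
  also have "\<dots> \<le> 1 / (1 + x)" using x exp_ge_add_one_self[of x] by (intro divide_left_mono) auto
  also have "\<dots> \<le> 1 - x + x\<^sup>2"
  proof -
    have "(1 - x + x\<^sup>2) * (1 + x) = 1 + x ^ 3" by (simp add: power2_eq_square power3_eq_cube algebra_simps)
    also have "\<dots> \<ge> 1" using x by simp
    finally show ?thesis using x by (simp add: divide_le_eq)
  qed
  finally have "cosh x \<le> 1 + x\<^sup>2" using exp_bound[OF x] by (simp add: cosh_def)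
  also have "\<dots> \<le> exp (x\<^sup>2)" using exp_ge_add_one_self by simp
  finally show ?thesis .
qed

text \<open>
  Write \<open>x1 = x0 exp(-w)\<close>. As long as \<open>\<alpha> w \<le> t\<close> it pays to match the second bit exactly, beyond that to
  move to the richer child at cost \<open>exp t\<close>; the second case is bounded by the boundary value
  \<open>w = t/\<alpha>\<close>. The quotient of the two sides is at most \<open>cosh(\<alpha> w/2) cosh(w/2)^\<alpha>\<close> over its value at
  \<open>w = t/\<alpha>\<close>, which is at most 1.
\<close>

lemma two_point_ordered:
  fixes t \<alpha> x x0 x1 :: real
  assumes t: "0 < t" "0 < \<alpha>" and x: "0 < x" "2 * x \<le> x0 + x1" "x1 \<le> x0"
  shows "\<exists>c. 0 < (if c then x1 else x0) \<and>
    x0 powr - \<alpha> + exp (t * of_bool (\<not> c)) * (if c then x1 else x0) powr - \<alpha>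
      \<le> 2 * cosh (t / 2) * cosh (t / (2 * \<alpha>)) powr \<alpha> * x powr - \<alpha>"
proof -
  have x0: "0 < x0" using x by linarith
  have key: "x0 powr - \<alpha> * (1 + exp (\<alpha> * w))
      \<le> 2 * cosh (t / 2) * cosh (t / (2 * \<alpha>)) powr \<alpha> * x powr - \<alpha>"
    if w: "0 \<le> w" "w \<le> t / \<alpha>" "x \<le> x0 * ((1 + exp (- w)) / 2)" for w
  proof -
    have aw: "\<alpha> * w \<le> t" using w(2) t by (simp add: pos_le_divide_eq mult.commute)
    have half: "(1 + exp (- w)) / 2 = exp (- w / 2) * cosh (w / 2)"
      by (simp add: cosh_def distrib_left flip: exp_add)
    have "1 + exp (\<alpha> * w) = 2 * exp (\<alpha> * w / 2) * cosh (\<alpha> * w / 2)"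
      by (simp add: cosh_def distrib_left flip: exp_add)
    also have "\<dots> \<le> 2 * exp (\<alpha> * w / 2) * cosh (t / 2)"
      using aw w t by (intro mult_left_mono) (auto simp: cosh_real_nonneg_le_iff)
    finally have 1: "1 + exp (\<alpha> * w) \<le> 2 * cosh (t / 2) * exp (\<alpha> * w / 2)" by (simp add: mult_ac)
    have "w / 2 \<le> t / (2 * \<alpha>)" using w(2) by (simp add: field_simps)
    then have c: "cosh (w / 2) powr \<alpha> \<le> cosh (t / (2 * \<alpha>)) powr \<alpha>"
      using w t by (intro powr_mono2) (auto simp: cosh_real_nonneg_le_iff)
    have "(x0 * ((1 + exp (- w)) / 2)) powr - \<alpha> \<le> x powr - \<alpha>"
      using x w t by (intro powr_mono2') auto
    then have "x0 powr - \<alpha> * (exp (- w / 2) * cosh (w / 2)) powr - \<alpha> \<le> x powr - \<alpha>"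
      using x0 by (simp add: half powr_mult)
    then have "x0 powr - \<alpha> * (exp (\<alpha> * w / 2) * cosh (w / 2) powr - \<alpha>) \<le> x powr - \<alpha>"
      by (simp add: powr_mult exp_powr_real mult.commute)
    then have "x0 powr - \<alpha> * (exp (\<alpha> * w / 2) * cosh (w / 2) powr - \<alpha>) * cosh (w / 2) powr \<alpha>
        \<le> x powr - \<alpha> * cosh (t / (2 * \<alpha>)) powr \<alpha>"
      using c by (intro mult_mono) auto
    moreover have "cosh (w / 2) powr - \<alpha> * cosh (w / 2) powr \<alpha> = 1"
      by (simp flip: powr_add)
    ultimately have 2: "x0 powr - \<alpha> * exp (\<alpha> * w / 2) \<le> x powr - \<alpha> * cosh (t / (2 * \<alpha>)) powr \<alpha>"
      by (simp add: mult.assoc)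
    have "x0 powr - \<alpha> * (1 + exp (\<alpha> * w)) \<le> x0 powr - \<alpha> * (2 * cosh (t / 2) * exp (\<alpha> * w / 2))"
      using 1 by (intro mult_left_mono) auto
    also have "\<dots> = 2 * cosh (t / 2) * (x0 powr - \<alpha> * exp (\<alpha> * w / 2))" by simp
    also have "\<dots> \<le> 2 * cosh (t / 2) * (x powr - \<alpha> * cosh (t / (2 * \<alpha>)) powr \<alpha>)"
      using 2 by (intro mult_left_mono) auto
    finally show ?thesis by (simp add: mult_ac)
  qed
  show ?thesis
  proof (cases "x0 * exp (- (t / \<alpha>)) \<le> x1")
    case True
    then have x1: "0 < x1" using x0 by (meson exp_gt_zero less_le_trans mult_pos_pos)
    define w where "w = ln (x0 / x1)"
    have ew: "exp (- w) = x1 / x0" using x0 x1 by (simp add: w_def exp_minus)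
    have "exp (- (t / \<alpha>)) \<le> exp (- w)" using True x0 by (simp add: ew pos_le_divide_eq mult.commute)
    then have w: "w \<le> t / \<alpha>" "0 \<le> w" using x x0 x1 by (simp_all add: w_def)
    have "x0 * ((1 + exp (- w)) / 2) = (x0 + x1) / 2" using x0 by (simp add: ew field_simps)
    moreover have "x \<le> (x0 + x1) / 2" using x(2) by simp
    ultimately have "x \<le> x0 * ((1 + exp (- w)) / 2)" by (simp only:)
    then have "x0 powr - \<alpha> * (1 + exp (\<alpha> * w))
      \<le> 2 * cosh (t / 2) * cosh (t / (2 * \<alpha>)) powr \<alpha> * x powr - \<alpha>" using w by (intro key)
    moreover have "x0 powr - \<alpha> * exp (\<alpha> * w) = x1 powr - \<alpha>"
      using x0 x1 by (simp add: powr_def w_def ln_div algebra_simps flip: exp_add)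
    ultimately show ?thesis using x1 by (intro exI[of _ True]) (simp add: distrib_left)
  next
    case False
    have "x0 powr - \<alpha> * (1 + exp (\<alpha> * (t / \<alpha>)))
      \<le> 2 * cosh (t / 2) * cosh (t / (2 * \<alpha>)) powr \<alpha> * x powr - \<alpha>"
    proof (rule key)
      have "2 * x \<le> x0 + x0 * exp (- (t / \<alpha>))" using False x by linarith
      then have "x \<le> (x0 + x0 * exp (- (t / \<alpha>))) / 2" by simp
      also have "\<dots> = x0 * ((1 + exp (- (t / \<alpha>))) / 2)" by (simp add: algebra_simps)
      finally show "x \<le> x0 * ((1 + exp (- (t / \<alpha>))) / 2)" .
    qed (use t in auto)
    then show ?thesis using t x0 by (intro exI[of _ False]) (simp add: algebra_simps)
  qed
qed

text \<open>
  For each next bit \<open>b\<close> of the given string, \<open>c b\<close> is the next bit of the companion; \<open>q\<close> gives the room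
  of the two children and \<open>x\<close> that of the parent.
\<close>

lemma two_point:
  fixes t \<alpha> x :: real and q :: "bool \<Rightarrow> real"
  assumes t: "0 < t" "0 < \<alpha>" and x: "0 < x" "2 * x \<le> q False + q True"
  shows "\<exists>c. (\<forall>b. 0 < q (c b)) \<and> (\<Sum>b\<in>UNIV. exp (t * of_bool (b \<noteq> c b)) * q (c b) powr - \<alpha>)
      \<le> 2 * cosh (t / 2) * cosh (t / (2 * \<alpha>)) powr \<alpha> * x powr - \<alpha>"
proof -
  obtain g where g: "q (\<not> g) \<le> q g"
    using that[of "q False \<le> q True"] by (cases "q False \<le> q True") auto
  have "2 * x \<le> q g + q (\<not> g)" using x(2) by (cases g) auto
  from two_point_ordered[OF t x(1) this g] obtain c where
    c: "0 < (if c then q (\<not> g) else q g)" and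
    le: "q g powr - \<alpha> + exp (t * of_bool (\<not> c)) * (if c then q (\<not> g) else q g) powr - \<alpha>
      \<le> 2 * cosh (t / 2) * cosh (t / (2 * \<alpha>)) powr \<alpha> * x powr - \<alpha>" by blast
  have qg: "0 < q g" using c g by (auto split: if_splits)
  have univ: "(\<Sum>b\<in>UNIV. F b) = F g + F (\<not> g)" for F :: "bool \<Rightarrow> real"
    by (cases g) (simp_all add: UNIV_bool add.commute)
  show ?thesis
    by (rule exI[of _ "\<lambda>b. if b = g \<or> \<not> c then g else \<not> g"], unfold univ)
      (use c qg le in \<open>auto split: if_splits\<close>)
qed

section \<open>Counting the strings that lose all companions\<close>

definition ham :: "nat \<Rightarrow> bool list \<Rightarrow> bool list \<Rightarrow> nat" where
  "ham m \<sigma> \<tau> = card {k. k < m \<and> \<sigma> ! k \<noteq> \<tau> ! k}"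

lemma ham_cong: "take m \<sigma> = take m \<sigma>' \<Longrightarrow> take m \<tau> = take m \<tau>' \<Longrightarrow> ham m \<sigma> \<tau> = ham m \<sigma>' \<tau>'"
proof -
  assume *: "take m \<sigma> = take m \<sigma>'" "take m \<tau> = take m \<tau>'"
  have "\<sigma> ! k = \<sigma>' ! k" "\<tau> ! k = \<tau>' ! k" if "k < m" for k using * that by (metis nth_take)+
  then show ?thesis unfolding ham_def by (intro arg_cong[of _ _ card]) auto
qed

lemma ham_snoc:
  assumes "length \<sigma> = n" "length \<tau> = n"
  shows "ham (Suc n) (\<sigma> @ [b]) (\<tau> @ [c]) = ham n \<sigma> \<tau> + of_bool (b \<noteq> c)"
proof -
  have "{k. k < Suc n \<and> (\<sigma> @ [b]) ! k \<noteq> (\<tau> @ [c]) ! k} =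
     {k. k < n \<and> \<sigma> ! k \<noteq> \<tau> ! k} \<union> (if b \<noteq> c then {n} else {})"
    using assms by (auto simp: nth_append less_Suc_eq)
  then show ?thesis unfolding ham_def by (simp add: card_insert_if)
qed

lemma ham_le: "ham m \<sigma> \<tau> \<le> m"
  unfolding ham_def using card_mono[of "{..<m}" "{k. k < m \<and> \<sigma> ! k \<noteq> \<tau> ! k}"] by auto

text \<open>
  The condition \<open>d + r m * log 2 (1 / q) \<le> D m\<close> at every prefix, written without logarithms so that it
  becomes an inequality between integers when \<open>q\<close> is a dyadic rational. The stage \<open>s\<close> is the stage of the
  approximation to \<open>q\<close>.
\<close>

definition alive where
  "alive q r D s \<sigma> y \<longleftrightarrow> length y = length \<sigma> \<and> (\<forall>m\<le>length \<sigma>. ham m \<sigma> y \<le> D m \<and>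
     (1::real) \<le> q (s::nat) (take m y) ^ r m * 2 ^ (D m - ham m \<sigma> y))"

definition dead where "dead q r D s \<sigma> \<longleftrightarrow> (\<nexists>y. alive q r D s \<sigma> y)"

text \<open>
  Death is inherited by extensions, so for nonempty \<open>\<sigma>\<close> this says that \<open>\<sigma>\<close> is minimal among the strings dead at stage \<open>s\<close>.
  At a later stage a proper prefix may be dead as well.
\<close>

definition dies where "dies q r D s \<sigma> \<longleftrightarrow> dead q r D s \<sigma> \<and> \<not> dead q r D s (butlast \<sigma>)"

lemma alive_take: "alive q r D s \<tau> y \<Longrightarrow> alive q r D s (take n \<tau>) (take n y)"
  unfolding alive_def
proof (intro conjI allI impI)
  fix m assume *: "length y = length \<tau> \<and> (\<forall>m\<le>length \<tau>. ham m \<tau> y \<le> D m \<and>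
      1 \<le> q s (take m y) ^ r m * 2 ^ (D m - ham m \<tau> y))" "m \<le> length (take n \<tau>)"
  then have "m \<le> n" "m \<le> length \<tau>" by auto
  then have "ham m (take n \<tau>) (take n y) = ham m \<tau> y" by (intro ham_cong) (simp_all add: min_absorb1)
  moreover have "take m (take n y) = take m y" using \<open>m \<le> n\<close> by (simp add: min_absorb1)
  moreover have "m \<le> length \<tau>" by fact
  ultimately show "ham m (take n \<tau>) (take n y) \<le> D m"
    "1 \<le> q s (take m (take n y)) ^ r m * 2 ^ (D m - ham m (take n \<tau>) (take n y))"
    using * by auto
qed auto

lemma dead_take: "dead q r D s (take n \<tau>) \<Longrightarrow> dead q r D s \<tau>"
  unfolding dead_def using alive_take by blast

locale room_family =
  fixes q :: "nat \<Rightarrow> bool list \<Rightarrow> real" and r D :: "nat \<Rightarrow> nat"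
  assumes submartingale: "\<And>s y. 2 * q s y \<le> q s (y @ [False]) + q s (y @ [True])"
    and antimono: "\<And>s s' y. s \<le> s' \<Longrightarrow> q s' y \<le> q s y"
    and nonneg: "\<And>s y. 0 \<le> q s y"
    and le_1: "\<And>s y. q s y \<le> 1"
    and half: "\<And>s. 1 / 2 \<le> q s []"
    and r_pos: "\<And>n. 1 \<le> r n" and r_mono: "\<And>n. r n \<le> r (Suc n)"
    and r_0: "r 0 = 1" and D_0: "1 \<le> D 0"
begin

abbreviation "Alive \<equiv> alive q r D"
abbreviation "Dead \<equiv> dead q r D"
abbreviation "Dies \<equiv> dies q r D"

lemma Alive_antimono: "s \<le> s' \<Longrightarrow> Alive s' \<sigma> y \<Longrightarrow> Alive s \<sigma> y"
  unfolding alive_def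
proof (intro conjI allI impI)
  fix m assume s: "s \<le> s'" and *: "length y = length \<sigma> \<and> (\<forall>m\<le>length \<sigma>. ham m \<sigma> y \<le> D m \<and>
      1 \<le> q s' (take m y) ^ r m * 2 ^ (D m - ham m \<sigma> y))" "m \<le> length \<sigma>"
  have "1 \<le> q s' (take m y) ^ r m * 2 ^ (D m - ham m \<sigma> y)" using * by simp
  also have "\<dots> \<le> q s (take m y) ^ r m * 2 ^ (D m - ham m \<sigma> y)"
    using antimono[OF s] nonneg by (intro mult_right_mono power_mono) auto
  finally show "1 \<le> q s (take m y) ^ r m * 2 ^ (D m - ham m \<sigma> y)" .
qed auto

lemma Dead_mono: "s \<le> s' \<Longrightarrow> Dead s \<sigma> \<Longrightarrow> Dead s' \<sigma>"
  unfolding dead_def using Alive_antimono by blast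

lemma Alive_Nil: "Alive s [] []"
proof -
  have "(2::real) ^ 1 \<le> 2 ^ D 0" using D_0 by (intro power_increasing) auto
  then have "1 / 2 * 2 \<le> q s [] * 2 ^ D 0" using half[of s] by (intro mult_mono) auto
  then show ?thesis by (simp add: alive_def r_0 ham_def)
qed

context
  fixes t :: real and E :: "nat \<Rightarrow> real"
  assumes t: "0 < t"
    and E: "\<And>n. E n + 1 / r (Suc n) + (real (r (Suc n)) - r n) * D n / r n \<le> E (Suc n)"
begin

text \<open>
  With this exponent, \<open>exp (lcost n d (q s y))\<close> is the potential \<open>exp(t d) q(y)^(-\<alpha>)\<close>, and being alive at
  length \<open>n\<close> means that the potential is at most \<open>exp (t * D n)\<close>.
\<close>

definition \<alpha> :: "nat \<Rightarrow> real" where "\<alpha> n = t * r n / ln 2"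

definition lcost :: "nat \<Rightarrow> nat \<Rightarrow> real \<Rightarrow> real" where "lcost n d x = t * d - \<alpha> n * ln x"

lemma \<alpha>_pos: "0 < \<alpha> n"
  using t r_pos[of n] by (simp add: \<alpha>_def)

lemma lcost_iff:
  assumes x: "0 \<le> x" "x \<le> 1"
  shows "d \<le> D n \<and> 1 \<le> x ^ r n * 2 ^ (D n - d) \<longleftrightarrow> 0 < x \<and> lcost n d x \<le> t * D n"
proof (cases "x = 0")
  case True
  then show ?thesis using r_pos[of n] by (simp add: power_0_left)
next
  case False
  then have x: "0 < x" "ln x \<le> 0" using x by simp_all
  have *: "1 \<le> x ^ r n * 2 ^ k \<longleftrightarrow> 0 \<le> r n * ln x + k * ln 2" for k :: nat
  proof -
    have "1 \<le> x ^ r n * 2 ^ k \<longleftrightarrow> 0 \<le> ln (x ^ r n * 2 ^ k)" using x by (subst ln_ge_zero_iff) auto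
    also have "ln (x ^ r n * 2 ^ k) = r n * ln x + k * ln 2"
      using x by (simp add: ln_mult ln_realpow)
    finally show ?thesis .
  qed
  have lc: "lcost n d x \<le> t * D n \<longleftrightarrow> 0 \<le> r n * ln x + (real (D n) - d) * ln 2"
  proof -
    have "lcost n d x \<le> t * D n \<longleftrightarrow> 0 \<le> (t / ln 2) * (r n * ln x + (real (D n) - d) * ln 2)"
      by (simp add: lcost_def \<alpha>_def field_simps)
    also have "\<dots> \<longleftrightarrow> 0 \<le> r n * ln x + (real (D n) - d) * ln 2"
      using t by (simp add: zero_le_mult_iff zero_le_divide_iff)
    finally show ?thesis .
  qed
  show ?thesis
  proof (cases "d \<le> D n")
    case True
    then show ?thesis using x by (simp add: * lc of_nat_diff)
  next
    case False
    then have "(real (D n) - d) * ln 2 < 0" by (intro mult_neg_pos) auto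
    moreover have "r n * ln x \<le> 0" using x by (intro mult_nonneg_nonpos) auto
    ultimately have "\<not> lcost n d x \<le> t * D n" unfolding lc by linarith
    with False show ?thesis by simp
  qed
qed

text \<open>
  The strings of length \<open>k\<close> extending \<open>\<sigma>\<close> that have been enumerated by stage \<open>s\<close>, whether or not a proper
  prefix has died in the meantime.
\<close>

definition born :: "nat \<Rightarrow> nat \<Rightarrow> bool list \<Rightarrow> bool list set" where
  "born s k \<sigma> = {\<rho>. length \<rho> = k \<and> take (length \<sigma>) \<rho> = \<sigma> \<and> (\<exists>s'\<le>s. Dies s' \<rho>)}"

text \<open>
  The bound for the number of enumerated extensions of length \<open>k\<close> of a string of length \<open>n\<close>, per unit of
  potential.
\<close>

definition \<Phi> :: "nat \<Rightarrow> nat \<Rightarrow> real" where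
  "\<Phi> n k = exp (ln (2 * cosh (t / 2)) * (real k - n) + t * (E k - E n) - t * D k)"

lemma finite_born: "finite (born s k \<sigma>)"
  by (rule finite_subset[OF _ finite_lists_length_eq[of UNIV k]]) (auto simp: born_def)

lemma born_split:
  assumes "length \<sigma> < k"
  shows "born s k \<sigma> = born s k (\<sigma> @ [False]) \<union> born s k (\<sigma> @ [True])"
proof -
  have "take (length \<sigma>) \<rho> = \<sigma> \<longleftrightarrow> take (Suc (length \<sigma>)) \<rho> = \<sigma> @ [False] \<or> take (Suc (length \<sigma>)) \<rho> = \<sigma> @ [True]"
    if "length \<rho> = k" for \<rho>
    using assms that by (auto simp: take_Suc_conv_app_nth)
  then show ?thesis unfolding born_def by auto
qed

text \<open>
  One step multiplies the potential by \<open>2 cosh(t/2)\<close> up to two losses that \<open>E\<close> accounts for: the factor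
  \<open>cosh(t/(2\<alpha>))^\<alpha>\<close>, and the change of the exponent from \<open>\<alpha> n\<close> to \<open>\<alpha> (Suc n)\<close>. The latter is affordable
  because a living companion has room at least \<open>2^(-D n / r n)\<close>.
\<close>

lemma step_cost:
  assumes y: "0 < q s y" "lcost n d (q s y) \<le> t * D n"
  shows "\<exists>c. (\<forall>b. 0 < q s (y @ [c b])) \<and>
    (\<Sum>b\<in>UNIV. exp (lcost (Suc n) (d + of_bool (b \<noteq> c b)) (q s (y @ [c b]))))
      \<le> 2 * cosh (t / 2) * exp (t * (E (Suc n) - E n)) * exp (lcost n d (q s y))"
proof -
  let ?a = "\<alpha> (Suc n)" and ?x = "q s y" and ?r = "r (Suc n)"
  have r: "0 < real ?r" "0 < real (r n)" "real (r n) \<le> ?r" using r_pos[of n] r_pos[of "Suc n"] r_mono[of n] by auto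
  have lnx: "ln ?x \<le> 0" using y le_1 by simp
  from two_point[OF t \<alpha>_pos y(1), of "\<lambda>c. q s (y @ [c])"] submartingale
  obtain c where c: "\<forall>b. 0 < q s (y @ [c b])" and
    le: "(\<Sum>b\<in>UNIV. exp (t * of_bool (b \<noteq> c b)) * q s (y @ [c b]) powr - ?a)
      \<le> 2 * cosh (t / 2) * cosh (t / (2 * ?a)) powr ?a * ?x powr - ?a" by blast
  have "(\<Sum>b\<in>UNIV. exp (lcost (Suc n) (d + of_bool (b \<noteq> c b)) (q s (y @ [c b]))))
    = (\<Sum>b\<in>UNIV. exp (t * d) * (exp (t * of_bool (b \<noteq> c b)) * q s (y @ [c b]) powr - ?a))"
  proof (rule sum.cong)
    fix b
    have "q s (y @ [c b]) powr - ?a = exp (- ?a * ln (q s (y @ [c b])))"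
      using c[rule_format, of b] by (simp add: powr_def)
    then show "exp (lcost (Suc n) (d + of_bool (b \<noteq> c b)) (q s (y @ [c b])))
      = exp (t * d) * (exp (t * of_bool (b \<noteq> c b)) * q s (y @ [c b]) powr - ?a)"
      by (simp only: flip: exp_add) (simp add: lcost_def algebra_simps)
  qed simp
  also have "\<dots> \<le> exp (t * d) * (2 * cosh (t / 2) * cosh (t / (2 * ?a)) powr ?a * ?x powr - ?a)"
    unfolding sum_distrib_left[symmetric] by (intro mult_left_mono le) simp
  also have "\<dots> = 2 * cosh (t / 2) * (cosh (t / (2 * ?a)) powr ?a * exp (t * d - ?a * ln ?x))"
  proof -
    have "exp (t * d - ?a * ln ?x) = exp (t * d) * ?x powr - ?a"
      using y(1) by (simp add: powr_def flip: exp_add)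
    then show ?thesis by (simp only: mult_ac)
  qed
  also have "\<dots> \<le> 2 * cosh (t / 2) * (exp (t / ?r) * exp (lcost n d ?x + t * ((real ?r - r n) * D n / r n)))"
  proof (intro mult_left_mono mult_mono)
    let ?w = "ln 2 / (2 * ?r)"
    have w: "t / (2 * ?a) = ?w" using t r by (simp add: \<alpha>_def)
    have ln2: "0 < ln (2::real)" "ln 2 \<le> (1::real)" using ln_2_less_1 by auto
    have "?w \<le> 1" using ln2 r_pos[of "Suc n"] by (simp add: divide_le_eq)
    then have "cosh ?w \<le> exp (?w\<^sup>2)" using ln2 by (intro cosh_le_exp_square) auto
    then have "cosh ?w powr ?a \<le> exp (?w\<^sup>2) powr ?a" using \<alpha>_pos[of "Suc n"] by (intro powr_mono2) auto
    also have "\<dots> = exp (t * ln 2 / (4 * ?r))"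
      using r ln2 by (simp add: exp_powr_real \<alpha>_def power2_eq_square field_simps)
    also have "t * ln 2 / (4 * ?r) \<le> t / ?r"
      using r t ln2 by (simp add: divide_le_cancel field_simps mult_left_le)
    finally show "cosh (t / (2 * ?a)) powr ?a \<le> exp (t / ?r)" unfolding w by simp
    have "\<alpha> n * (- ln ?x) \<le> t * D n" using y(2) t by (simp add: lcost_def) (smt (verit) mult_nonneg_nonneg of_nat_0_le_iff)
    then have "- ln ?x \<le> t * D n / \<alpha> n" using \<alpha>_pos[of n] by (simp add: pos_le_divide_eq mult.commute)
    then have "(?a - \<alpha> n) * (- ln ?x) \<le> (?a - \<alpha> n) * (t * D n / \<alpha> n)"
      using r t by (intro mult_left_mono) (auto simp: \<alpha>_def divide_le_cancel intro!: divide_right_mono mult_left_mono)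
    also have "(?a - \<alpha> n) * (t * D n / \<alpha> n) = t * ((real ?r - r n) * D n / r n)"
      using r t ln2 by (simp add: \<alpha>_def field_simps)
    finally show "exp (t * d - ?a * ln ?x) \<le> exp (lcost n d ?x + t * ((real ?r - r n) * D n / r n))"
      by (simp add: lcost_def algebra_simps)
  qed auto
  also have "\<dots> = 2 * cosh (t / 2) * (exp (t * (1 / ?r + (real ?r - r n) * D n / r n)) * exp (lcost n d ?x))"
    by (simp only: flip: exp_add) (simp add: algebra_simps)
  also have "\<dots> \<le> 2 * cosh (t / 2) * (exp (t * (E (Suc n) - E n)) * exp (lcost n d ?x))"
    using E[of n] t by (intro mult_left_mono mult_right_mono) (auto intro!: mult_left_mono)
  finally show ?thesis using c by (intro exI[of _ c]) (simp add: mult.assoc)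
qed

lemma Alive_iff:
  "Alive s \<sigma> y \<longleftrightarrow> length y = length \<sigma> \<and> (\<forall>m\<le>length \<sigma>. 0 < q s (take m y) \<and>
     lcost m (ham m \<sigma> y) (q s (take m y)) \<le> t * D m)"
  unfolding alive_def using lcost_iff[OF nonneg le_1] by simp

lemma Alive_snoc:
  assumes "Alive s \<sigma> y" "0 < q s (y @ [c])"
    "lcost (Suc (length \<sigma>)) (ham (Suc (length \<sigma>)) (\<sigma> @ [b]) (y @ [c])) (q s (y @ [c])) \<le> t * D (Suc (length \<sigma>))"
  shows "Alive s (\<sigma> @ [b]) (y @ [c])"
  unfolding Alive_iff
proof (intro conjI allI impI)
  have len: "length y = length \<sigma>" using assms(1) by (simp add: alive_def)
  then show "length (y @ [c]) = length (\<sigma> @ [b])" by simp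
  fix m assume "m \<le> length (\<sigma> @ [b])"
  then consider "m \<le> length \<sigma>" | "m = Suc (length \<sigma>)" by fastforce
  then have "0 < q s (take m (y @ [c])) \<and> lcost m (ham m (\<sigma> @ [b]) (y @ [c])) (q s (take m (y @ [c]))) \<le> t * D m"
  proof cases
    case 1
    then have "ham m (\<sigma> @ [b]) (y @ [c]) = ham m \<sigma> y" using len by (intro ham_cong) auto
    then show ?thesis using assms(1) 1 len by (simp add: Alive_iff)
  next
    case 2
    then show ?thesis using assms(2,3) len by simp
  qed
  then show "0 < q s (take m (y @ [c]))"
    "lcost m (ham m (\<sigma> @ [b]) (y @ [c])) (q s (take m (y @ [c]))) \<le> t * D m" by auto
qed

lemma alive_le:
  assumes "Alive s \<sigma> y"
  shows "\<Phi> (length \<sigma>) k * exp (lcost (length \<sigma>) (ham (length \<sigma>) \<sigma> y) (q s y)) \<le> \<Phi> (length \<sigma>) k * exp (t * D (length \<sigma>))"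
proof -
  have "length y = length \<sigma>" using assms by (simp add: alive_def)
  then have "lcost (length \<sigma>) (ham (length \<sigma>) \<sigma> y) (q s y) \<le> t * D (length \<sigma>)"
    using assms[unfolded Alive_iff] by (metis order_refl take_all)
  then show ?thesis by (simp add: \<Phi>_def)
qed

lemma born_below_dead:
  assumes "Dead 0 \<sigma>" "length \<sigma> < k"
  shows "born s k \<sigma> = {}"
proof -
  have False if "length \<rho> = k" "take (length \<sigma>) \<rho> = \<sigma>" "Dies s' \<rho>" for \<rho> s'
  proof -
    have "take (length \<sigma>) (butlast \<rho>) = \<sigma>" using that assms(2) by (simp add: butlast_conv_take min_absorb1)
    moreover have "Dead s' \<sigma>" using assms(1) Dead_mono[of 0 s' \<sigma>] by simp
    ultimately have "Dead s' (butlast \<rho>)" using dead_take[of q r D s' "length \<sigma>" "butlast \<rho>"] by simp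
    with that(3) show False by (simp add: dies_def)
  qed
  then show ?thesis by (auto simp: born_def)
qed

text \<open>
  Once \<open>\<sigma>\<close> is dead, no proper extension of it is minimal among the dead strings any more, so the count
  below \<open>\<sigma>\<close> is frozen.
\<close>

lemma born_Suc_dead:
  assumes "Dead (Suc s) \<sigma>" "length \<sigma> < k"
  shows "born (Suc s) k \<sigma> = born s k \<sigma>"
proof -
  have False if "length \<rho> = k" "take (length \<sigma>) \<rho> = \<sigma>" "Dies (Suc s) \<rho>" for \<rho>
  proof -
    have "take (length \<sigma>) (butlast \<rho>) = \<sigma>" using that assms(2) by (simp add: butlast_conv_take min_absorb1)
    then have "Dead (Suc s) (butlast \<rho>)"
      using dead_take[of q r D "Suc s" "length \<sigma>" "butlast \<rho>"] assms(1) by simp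
    with that(3) show False by (simp add: dies_def)
  qed
  then show ?thesis unfolding born_def using le_Suc_eq by auto
qed

text \<open>
  The chosen children of \<open>y\<close> serve as companions of the two extensions. If such a child is no longer alive,
  its potential exceeds \<open>exp (t * D (Suc n))\<close>, and the bound valid for every string is sufficient.
\<close>

lemma card_born_step:
  assumes "length \<sigma> < k" and al: "Alive s \<sigma> y"
    and IH: "\<And>b. card (born s k (\<sigma> @ [b])) \<le> \<Phi> (Suc (length \<sigma>)) k * exp (t * D (Suc (length \<sigma>)))"
    "\<And>b y'. Alive s (\<sigma> @ [b]) y' \<Longrightarrow> card (born s k (\<sigma> @ [b]))
       \<le> \<Phi> (Suc (length \<sigma>)) k * exp (lcost (Suc (length \<sigma>)) (ham (Suc (length \<sigma>)) (\<sigma> @ [b]) y') (q s y'))"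
  shows "card (born s k \<sigma>) \<le> \<Phi> (length \<sigma>) k * exp (lcost (length \<sigma>) (ham (length \<sigma>) \<sigma> y) (q s y))"
proof -
  let ?n = "length \<sigma>"
  have len: "length y = ?n" using al by (simp add: alive_def)
  have y: "0 < q s y" "lcost ?n (ham ?n \<sigma> y) (q s y) \<le> t * D ?n"
    using al[unfolded Alive_iff] len by (metis order_refl take_all)+
  from step_cost[OF y] obtain c where c: "\<And>b. 0 < q s (y @ [c b])" and
    le: "(\<Sum>b\<in>UNIV. exp (lcost (Suc ?n) (ham ?n \<sigma> y + of_bool (b \<noteq> c b)) (q s (y @ [c b]))))
      \<le> 2 * cosh (t / 2) * exp (t * (E (Suc ?n) - E ?n)) * exp (lcost ?n (ham ?n \<sigma> y) (q s y))" by blast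
  have \<Phi>0: "0 < \<Phi> (Suc ?n) k" by (simp add: \<Phi>_def)
  have b: "card (born s k (\<sigma> @ [b]))
      \<le> \<Phi> (Suc ?n) k * exp (lcost (Suc ?n) (ham ?n \<sigma> y + of_bool (b \<noteq> c b)) (q s (y @ [c b])))" for b
  proof -
    have ham: "ham (Suc ?n) (\<sigma> @ [b]) (y @ [c b]) = ham ?n \<sigma> y + of_bool (b \<noteq> c b)"
      using len by (intro ham_snoc) auto
    show ?thesis
    proof (cases "Alive s (\<sigma> @ [b]) (y @ [c b])")
      case True
      from IH(2)[OF this] show ?thesis by (simp only: ham)
    next
      case False
      then have "t * D (Suc ?n) \<le> lcost (Suc ?n) (ham ?n \<sigma> y + of_bool (b \<noteq> c b)) (q s (y @ [c b]))"
        using Alive_snoc[OF al c[of b], of b] unfolding ham by linarith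
      then have "\<Phi> (Suc ?n) k * exp (t * D (Suc ?n)) \<le> \<Phi> (Suc ?n) k *
          exp (lcost (Suc ?n) (ham ?n \<sigma> y + of_bool (b \<noteq> c b)) (q s (y @ [c b])))"
        using \<Phi>0 by simp
      then show ?thesis using IH(1)[of b] by linarith
    qed
  qed
  have "card (born s k \<sigma>) \<le> card (born s k (\<sigma> @ [False])) + card (born s k (\<sigma> @ [True]))"
    unfolding born_split[OF assms(1)] by (rule card_Un_le)
  then have "real (card (born s k \<sigma>)) \<le> (\<Sum>b\<in>UNIV. real (card (born s k (\<sigma> @ [b]))))"
    by (simp add: UNIV_bool)
  also have "\<dots> \<le> (\<Sum>b\<in>UNIV. \<Phi> (Suc ?n) k *
      exp (lcost (Suc ?n) (ham ?n \<sigma> y + of_bool (b \<noteq> c b)) (q s (y @ [c b]))))"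
    by (rule sum_mono) (rule b)
  also have "\<dots> \<le> \<Phi> (Suc ?n) k * (2 * cosh (t / 2) * exp (t * (E (Suc ?n) - E ?n))
      * exp (lcost ?n (ham ?n \<sigma> y) (q s y)))"
    unfolding sum_distrib_left[symmetric] using \<Phi>0 le by (intro mult_left_mono) auto
  also have "\<dots> = \<Phi> ?n k * exp (lcost ?n (ham ?n \<sigma> y) (q s y))"
  proof -
    define L where "L = ln (2 * cosh (t / 2))"
    have c: "2 * cosh (t / 2) = exp L" by (simp add: L_def)
    have A: "\<Phi> (Suc ?n) k * (exp L * exp (t * (E (Suc ?n) - E ?n))) = \<Phi> ?n k"
      unfolding \<Phi>_def L_def[symmetric] by (simp add: algebra_simps flip: exp_add)
    show ?thesis unfolding c A[symmetric] by (simp only: mult.assoc)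
  qed
  finally show ?thesis .
qed

text \<open>
  Both bounds are proved together by induction on the remaining length \<open>j\<close>, for all stages at once. A
  string that is dead at stage \<open>s\<close> stopped collecting when it died, so the first bound follows from the
  second one at the last stage at which the string still had a living companion.
\<close>

lemma card_born:
  assumes "length \<sigma> + j = k"
  shows "card (born s k \<sigma>) \<le> \<Phi> (length \<sigma>) k * exp (t * D (length \<sigma>))"
    "Alive s \<sigma> y \<Longrightarrow> card (born s k \<sigma>) \<le> \<Phi> (length \<sigma>) k * exp (lcost (length \<sigma>) (ham (length \<sigma>) \<sigma> y) (q s y))"
  using assms
proof (induction j arbitrary: \<sigma> s y)
  case 0
  {
    case 1
    have "born s k \<sigma> \<subseteq> {\<sigma>}" using 1 by (auto simp: born_def)
    then have "card (born s k \<sigma>) \<le> card {\<sigma>}" by (intro card_mono) auto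
    then have "real (card (born s k \<sigma>)) \<le> 1" by simp
    also have "1 = \<Phi> (length \<sigma>) k * exp (t * D (length \<sigma>))" using 1 by (simp add: \<Phi>_def flip: exp_add)
    finally show ?case .
  next
    case 2
    have "\<not> Dies s' \<rho>" if "s' \<le> s" "length \<rho> = k" "take (length \<sigma>) \<rho> = \<sigma>" for \<rho> s'
    proof -
      have "\<rho> = \<sigma>" using that 2 by simp
      moreover have "Alive s' \<sigma> y" using Alive_antimono[OF that(1)] 2 by blast
      ultimately show ?thesis unfolding dies_def dead_def by blast
    qed
    then have "born s k \<sigma> = {}" by (auto simp: born_def)
    then show ?case by (simp add: \<Phi>_def)
  }
next
  case (Suc j)
  have alive: "card (born s k \<sigma>) \<le> \<Phi> (length \<sigma>) k * exp (lcost (length \<sigma>) (ham (length \<sigma>) \<sigma> y) (q s y))"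
    if "Alive s \<sigma> y" "length \<sigma> + Suc j = k" for s \<sigma> y
  proof (rule card_born_step)
    show "length \<sigma> < k" using that by simp
    show "Alive s \<sigma> y" by fact
    show "card (born s k (\<sigma> @ [b])) \<le> \<Phi> (Suc (length \<sigma>)) k * exp (t * D (Suc (length \<sigma>)))" for b
      using Suc.IH(1)[of "\<sigma> @ [b]" s] that by simp
    show "card (born s k (\<sigma> @ [b])) \<le> \<Phi> (Suc (length \<sigma>)) k *
        exp (lcost (Suc (length \<sigma>)) (ham (Suc (length \<sigma>)) (\<sigma> @ [b]) y') (q s y'))"
      if "Alive s (\<sigma> @ [b]) y'" for b y'
      using Suc.IH(2)[OF that] \<open>length \<sigma> + Suc j = k\<close> by simp
  qed
  {
    case 1
    have "card (born s k \<sigma>) \<le> \<Phi> (length \<sigma>) k * exp (t * D (length \<sigma>))" for s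
    proof (induction s)
      case 0
      show ?case
      proof (cases "Dead 0 \<sigma>")
        case True
        then have "born 0 k \<sigma> = {}" using 1 by (intro born_below_dead) auto
        then show ?thesis by (simp add: \<Phi>_def)
      next
        case False
        then obtain y where y: "Alive 0 \<sigma> y" by (auto simp: dead_def)
        show ?thesis by (rule order_trans[OF alive[OF y 1] alive_le[OF y]])
      qed
    next
      case (Suc s)
      show ?case
      proof (cases "Dead (Suc s) \<sigma>")
        case True
        then have "born (Suc s) k \<sigma> = born s k \<sigma>" using 1 by (intro born_Suc_dead) auto
        with Suc.IH show ?thesis by simp
      next
        case False
        then obtain y where y: "Alive (Suc s) \<sigma> y" by (auto simp: dead_def)
        show ?thesis by (rule order_trans[OF alive[OF y 1] alive_le[OF y]])
      qed
    qed
    then show ?case .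
  next
    case 2
    then show ?case using alive by simp
  }
qed

theorem card_Dies:
  "card {\<rho>. length \<rho> = k \<and> (\<exists>s. Dies s \<rho>)} \<le> exp (ln (2 * cosh (t / 2)) * k - t * D k + t * (E k - E 0 + 1))"
proof -
  let ?T = "{\<rho>. length \<rho> = k \<and> (\<exists>s. Dies s \<rho>)}"
  have fin: "finite ?T"
    by (rule finite_subset[OF _ finite_lists_length_eq[of UNIV k]]) auto
  define st where "st \<rho> = (SOME s. Dies s \<rho>)" for \<rho>
  have st: "Dies (st \<rho>) \<rho>" if "\<rho> \<in> ?T" for \<rho>
    using that unfolding st_def by (auto intro: someI_ex)
  define s where "s = Max (st ` ?T)"
  have "?T \<subseteq> born s k []"
  proof
    fix \<rho> assume \<rho>: "\<rho> \<in> ?T"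
    then have "st \<rho> \<le> s" unfolding s_def using fin by (intro Max_ge) auto
    then show "\<rho> \<in> born s k []" using st[OF \<rho>] \<rho> by (auto simp: born_def)
  qed
  then have "card ?T \<le> card (born s k [])" by (intro card_mono finite_born)
  also have "real \<dots> \<le> \<Phi> 0 k * exp (lcost 0 (ham 0 [] []) (q s []))"
    using card_born(2)[of "[]" k k s "[]"] Alive_Nil by simp
  also have "\<dots> \<le> \<Phi> 0 k * exp t"
  proof -
    have "- ln (q s []) \<le> ln 2"
    proof -
      have "ln (1 / 2) \<le> ln (q s [])" using half[of s] by (subst ln_le_cancel_iff) auto
      then show ?thesis by (simp add: ln_div)
    qed
    then have "t / ln 2 * (- ln (q s [])) \<le> t / ln 2 * ln 2" using t by (intro mult_left_mono) auto
    then have "lcost 0 (ham 0 [] []) (q s []) \<le> t"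
      by (simp add: lcost_def \<alpha>_def r_0 ham_def)
    then show ?thesis by (simp add: \<Phi>_def)
  qed
  also have "\<dots> = exp (ln (2 * cosh (t / 2)) * k - t * D k + t * (E k - E 0 + 1))"
    by (simp add: \<Phi>_def algebra_simps flip: exp_add)
  finally show ?thesis by simp
qed

end
end

section \<open>The distance budget and the overhead\<close>

text \<open>
  The weight of the logarithm of the room. It has to tend to infinity to make the loss per step vanish,
  and to grow slowly because each increase costs a budget's worth divided by the rank.
\<close>

definition rank :: "nat \<Rightarrow> nat" where "rank n = Suc (floor_log (Suc n))"

text \<open>
  On the block of lengths \<open>n\<close> with \<open>floor_log (Suc n) = i\<close> the budget has slope \<open>e i / 2^i\<close>.
\<close>

definition sched :: "(nat \<Rightarrow> nat) \<Rightarrow> nat \<Rightarrow> nat" where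
  "sched e n = Suc (n * e (floor_log (Suc n)) div 2 ^ floor_log (Suc n))"

text \<open>
  A sequence of slopes is stored in a number \<open>z\<close>; the entry \<open>i\<close> occupies the \<open>i + 2\<close> bits from position
  \<open>(i + 2)^2\<close> on. These fields are disjoint since consecutive squares are far enough apart.
\<close>

definition digit :: "nat \<Rightarrow> nat \<Rightarrow> nat" where
  "digit z i = (z div 2 ^ (i + 2)\<^sup>2) mod 2 ^ (i + 2)"

lemma ex_digits:
  assumes "\<And>i. i \<le> I \<Longrightarrow> e i < 2 ^ (i + 2)"
  shows "\<exists>z<2 ^ (I + 3)\<^sup>2. \<forall>i\<le>I. digit z i = e i"
proof -
  have main: "\<exists>z<2 ^ (n + 2)\<^sup>2. \<forall>i<n. digit z i = e i" if "\<And>i. i < n \<Longrightarrow> e i < 2 ^ (i + 2)" for n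
    using that
  proof (induction n)
    case 0 show ?case by (intro exI[of _ 0]) simp
  next
    case (Suc n)
    then obtain z where z: "z < 2 ^ (n + 2)\<^sup>2" "\<And>i. i < n \<Longrightarrow> digit z i = e i" by force
    define y where "y = z + 2 ^ (n + 2)\<^sup>2 * e n"
    have "y < 2 ^ (n + 2)\<^sup>2 * Suc (e n)" using z(1) by (simp add: y_def)
    also have "\<dots> \<le> 2 ^ (n + 2)\<^sup>2 * 2 ^ (n + 2)" using Suc.prems[of n] by (intro mult_left_mono) auto
    also have "\<dots> = 2 ^ ((n + 2)\<^sup>2 + (n + 2))" by (simp add: power_add)
    also have "\<dots> \<le> 2 ^ (Suc n + 2)\<^sup>2" by (intro power_increasing) (auto simp: power2_eq_square)
    finally have "y < 2 ^ (Suc n + 2)\<^sup>2" .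
    moreover have "digit y i = e i" if "i < Suc n" for i
    proof (cases "i = n")
      case True
      then show ?thesis using z(1) Suc.prems[of n] by (simp add: digit_def y_def)
    next
      case False
      then have i: "i < n" using that by simp
      have "(i + 2)\<^sup>2 + (i + 2) \<le> (Suc i + 2)\<^sup>2" by (simp add: power2_eq_square)
      also have "\<dots> \<le> (n + 2)\<^sup>2" using i by (intro power_mono) auto
      finally obtain k where k: "(n + 2)\<^sup>2 = (i + 2)\<^sup>2 + (i + 2) + k" using le_Suc_ex by blast
      have "y = z + 2 ^ (i + 2)\<^sup>2 * (2 ^ (i + 2) * (2 ^ k * e n))"
        unfolding y_def k power_add by (simp only: mult.assoc)
      then have "y div 2 ^ (i + 2)\<^sup>2 = z div 2 ^ (i + 2)\<^sup>2 + 2 ^ (i + 2) * (2 ^ k * e n)" by simp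
      then have "digit y i = digit z i" unfolding digit_def by (simp only: mod_mult_self2)
      then show ?thesis using z(2)[OF i] by simp
    qed
    ultimately show ?case by blast
  qed
  have "\<exists>z<2 ^ (Suc I + 2)\<^sup>2. \<forall>i<Suc I. digit z i = e i"
    using assms by (intro main) simp
  moreover have "Suc I + 2 = I + 3" by simp
  ultimately show ?thesis by (simp only: less_Suc_eq_le)
qed

lemma digit_less: "digit z i < 2 ^ (i + 2)" by (simp add: digit_def)

lemma sched_le: assumes "\<And>i. e i < 2 ^ (i + 2)" shows "sched e n \<le> 4 * n + 1"
proof -
  let ?i = "floor_log (Suc n)"
  have "n * e ?i \<le> n * (2 ^ ?i * 4)" using assms[of ?i] by (intro mult_left_mono) auto
  then have "n * e ?i div 2 ^ ?i \<le> n * (2 ^ ?i * 4) div 2 ^ ?i" by (rule div_le_mono)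
  also have "n * (2 ^ ?i * 4) div 2 ^ ?i = 4 * n" by (simp add: mult.left_commute)
  finally show ?thesis by (simp add: sched_def)
qed

lemma rank_mono: "m \<le> n \<Longrightarrow> rank m \<le> rank n"
  by (simp add: rank_def floor_log_le_iff)

definition overhead :: "nat \<Rightarrow> real" where
  "overhead n = (\<Sum>m<n. 1 / rank (Suc m) + (real (rank (Suc m)) - rank m) * (4 * m + 1) / rank m)"

lemma overhead_step:
  assumes "d \<le> 4 * n + 1"
  shows "overhead n + 1 / rank (Suc n) + (real (rank (Suc n)) - rank n) * d / rank n \<le> overhead (Suc n)"
proof -
  have "(real (rank (Suc n)) - rank n) * d / rank n \<le> (real (rank (Suc n)) - rank n) * (4 * n + 1) / rank n"
    using assms rank_mono[of n "Suc n"] by (intro divide_right_mono mult_left_mono) auto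
  then show ?thesis by (simp add: overhead_def add.commute)
qed

text \<open>
  The rank jumps by one when \<open>Suc m\<close> passes a power of 2, and the power of 2 then grows by an amount
  comparable with \<open>m\<close>. Charging the jump to that growth turns the overhead into a telescoping sum
  with the small factor \<open>8 / rank m\<close>.
\<close>

lemma overhead_increment:
  "1 / rank (Suc m) + (real (rank (Suc m)) - rank m) * (4 * m + 1) / rank m
    \<le> 8 / rank m * (1 + (2 ^ floor_log (Suc (Suc m)) - 2 ^ floor_log (Suc m)))"
proof -
  define i where "i = floor_log (Suc m)"
  define j where "j = floor_log (Suc (Suc m))"
  have ij: "i \<le> j" unfolding i_def j_def by (rule floor_log_le_iff) simp
  have lt: "Suc m < 2 * 2 ^ i" unfolding i_def by (rule floor_log_exp2_gt)
  have "(2::nat) ^ j \<le> Suc (Suc m)" unfolding j_def by (rule floor_log_exp2_le) simp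
  also have "\<dots> \<le> 2 ^ Suc i" using lt by simp
  finally have "j \<le> Suc i" by (simp add: power_increasing_iff del: power_Suc)
  with ij consider "j = i" | "j = Suc i" by linarith
  then have "(real j - i) * (4 * m + 1) \<le> 8 * (2 ^ j - 2 ^ i)"
  proof cases
    case 2
    have "real (4 * m + 1) \<le> real (8 * 2 ^ i)" using lt by (subst of_nat_le_iff) simp
    then show ?thesis using 2 by simp
  qed simp
  then have "(real j - i) * (4 * m + 1) / rank m \<le> 8 * (2 ^ j - 2 ^ i) / rank m"
    by (intro divide_right_mono) auto
  moreover have "1 / rank (Suc m) \<le> 1 / real (rank m)"
    using rank_mono[of m "Suc m"] by (intro divide_left_mono) (auto simp: rank_def)
  moreover have "1 / real (rank m) \<le> 8 / rank m" by (intro divide_right_mono) auto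
  ultimately have "1 / rank (Suc m) + (real j - i) * (4 * m + 1) / rank m \<le> 8 / rank m + 8 * (2 ^ j - 2 ^ i) / rank m"
    by linarith
  also have "\<dots> = 8 / rank m * (1 + (2 ^ j - 2 ^ i))" by (simp add: algebra_simps add_divide_distrib diff_divide_distrib)
  also have "real j - i = real (rank (Suc m)) - rank m" by (simp add: rank_def i_def j_def)
  finally show ?thesis by (simp only: i_def j_def of_nat_add of_nat_mult of_nat_numeral of_nat_1)
qed

lemma overhead_sublinear:
  fixes \<epsilon> :: real assumes "0 < \<epsilon>" shows "\<forall>\<^sub>F n in sequentially. overhead n \<le> \<epsilon> * n"
proof -
  \<comment> \<open>Once the rank exceeds \<open>32 / \<epsilon>\<close>, the overhead grows at a rate below \<open>\<epsilon> / 2\<close>.\<close>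
  obtain R :: nat where R: "16 / \<epsilon> * 2 < R" using reals_Archimedean2 by blast
  define m0 :: nat where "m0 = 2 ^ R"
  define G where "G n = real n + 2 ^ floor_log (Suc n)" for n
  have "0 < 16 / \<epsilon> * 2" using assms by simp
  with R have R0: "0 < real R" by linarith
  have rank: "real R \<le> rank m" if "m0 \<le> m" for m
  proof -
    have "floor_log (2 ^ R) \<le> floor_log (Suc m)" using that by (intro floor_log_le_iff) (simp add: m0_def)
    then show ?thesis by (simp add: rank_def)
  qed
  have main: "overhead n \<le> overhead m0 + 8 / R * (G n - G m0)" if "m0 \<le> n" for n
    using that
  proof (induction n rule: dec_induct)
    case (step n)
    have mono: "(2::real) ^ floor_log (Suc n) \<le> 2 ^ floor_log (Suc (Suc n))"
      by (intro power_increasing floor_log_le_iff) auto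
    have "overhead (Suc n) \<le> overhead n + 8 / rank n * (1 + (2 ^ floor_log (Suc (Suc n)) - 2 ^ floor_log (Suc n)))"
      using overhead_increment[of n] by (simp add: overhead_def)
    also have "\<dots> \<le> overhead n + 8 / R * (1 + (2 ^ floor_log (Suc (Suc n)) - 2 ^ floor_log (Suc n)))"
      using rank[OF step(1)] R0 mono
      by (intro add_left_mono mult_right_mono divide_left_mono) (auto intro!: mult_pos_pos)
    also have "\<dots> = overhead n + 8 / R * (G (Suc n) - G n)" by (simp add: G_def)
    also have "\<dots> \<le> overhead m0 + 8 / R * (G n - G m0) + 8 / R * (G (Suc n) - G n)"
      using step.IH by simp
    also have "\<dots> = overhead m0 + 8 / R * (G (Suc n) - G m0)" by (simp add: algebra_simps diff_divide_distrib)
    finally show ?case .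
  qed simp
  have G_le: "G n \<le> 2 * n + 1" for n
  proof -
    have "(2::nat) ^ floor_log (Suc n) \<le> Suc n" by (rule floor_log_exp2_le) simp
    then have "real (2 ^ floor_log (Suc n)) \<le> real (Suc n)" by (subst of_nat_le_iff)
    then show ?thesis by (simp add: G_def)
  qed
  have "0 \<le> G m0" by (simp add: G_def)
  then have le1: "8 / R * (G n - G m0) \<le> 8 / R * (2 * n + 1)" for n
    using R0 G_le[of n] by (intro mult_left_mono) auto
  have le2: "8 / R * (2 * real n + 1) \<le> \<epsilon> / 2 * n + 8 / R" for n :: nat
  proof -
    have "16 / R \<le> \<epsilon> / 2" using R R0 assms by (simp add: field_simps)
    then have "16 / R * n \<le> \<epsilon> / 2 * n" by (intro mult_right_mono) auto
    moreover have "8 / R * (2 * real n + 1) = 16 / R * n + 8 / R" by (simp add: add_divide_distrib mult.commute)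
    ultimately show ?thesis by linarith
  qed
  have le: "overhead n \<le> overhead m0 + \<epsilon> / 2 * n + 8 / R" if "m0 \<le> n" for n
    using main[OF that] le1[of n] le2[of n] by linarith
  have "\<forall>\<^sub>F n in sequentially. overhead m0 + 8 / R \<le> \<epsilon> / 2 * real n"
    using assms by real_asymp
  then show ?thesis using eventually_ge_at_top[of m0]
    by eventually_elim (use le in force)
qed

section \<open>The entropy exponent\<close>

text \<open>
  For \<open>0 < h < 1/2\<close> the optimal choice \<open>exp t = (1 - h) / h\<close> gives \<open>ln (2 cosh(t/2)) - t (1/2 - h) = H(h) ln 2\<close>
  exactly, and the excess of \<open>\<delta>\<close> over \<open>1/2 - h\<close> is gained. At the two end points the optimum is not
  attained: \<open>t\<close> has to be small for \<open>h = 1/2\<close> and large for \<open>h = 0\<close>.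
\<close>

lemma entropy_exponent:
  assumes h: "0 \<le> h" "h \<le> 1 / 2" and \<delta>: "1 / 2 - h < \<delta>"
  shows "\<exists>t>0. \<exists>\<eta>>0. ln (2 * cosh (t / 2)) - t * \<delta> \<le> (bin_entropy h - \<eta>) * ln 2"
proof -
  have ln_cosh: "ln (2 * cosh (t / 2)) = - t / 2 + ln (1 + exp t)" for t :: real
  proof -
    have "2 * cosh (t / 2) = exp (- t / 2) * (1 + exp t)"
      by (simp add: cosh_def distrib_left flip: exp_add)
    moreover have "0 < 1 + exp t" by (simp add: add_pos_pos)
    ultimately show ?thesis by (simp add: ln_mult)
  qed
  consider "h = 0" | "h = 1 / 2" | "0 < h" "h < 1 / 2" using h by linarith
  then show ?thesis
  proof cases
    case 1
    define t where "t = 1 / (\<delta> - 1 / 2)"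
    have t: "0 < t" "t * \<delta> = 1 + t / 2" using 1 \<delta> by (simp_all add: t_def field_simps)
    have "ln (1 + exp t) = t + ln (1 + exp (- t))"
    proof -
      have "1 + exp t = exp t * (1 + exp (- t))" by (simp add: distrib_left flip: exp_add)
      moreover have "0 < 1 + exp (- t)" by (simp add: add_pos_pos)
      ultimately show ?thesis by (simp add: ln_mult)
    qed
    also have "\<dots> \<le> t + exp (- t)" using ln_add_one_self_le_self[of "exp (- t)"] by simp
    finally have "ln (2 * cosh (t / 2)) - t * \<delta> \<le> exp (- t) - 1" unfolding ln_cosh t(2) by linarith
    moreover have "(bin_entropy h - (1 - exp (- t)) / ln 2) * ln 2 = exp (- t) - 1"
      using 1 by (simp add: bin_entropy_def)
    moreover have "0 < (1 - exp (- t)) / ln 2" using t by simp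
    ultimately show ?thesis using t(1) by (intro exI[of _ t] exI[of _ "(1 - exp (- t)) / ln 2"] conjI) simp_all
  next
    case 2
    define t where "t = min 2 (2 * \<delta>)"
    have t: "0 < t" "t \<le> 2" "t \<le> 2 * \<delta>" using 2 \<delta> by (auto simp: t_def)
    have "ln (cosh (t / 2)) \<le> (t / 2)\<^sup>2"
      using cosh_le_exp_square[of "t / 2"] t ln_le_cancel_iff[of "cosh (t / 2)" "exp ((t / 2)\<^sup>2)"] by simp
    also have "\<dots> \<le> t * \<delta> / 2" using t by (simp add: power2_eq_square)
    finally have "ln (2 * cosh (t / 2)) - t * \<delta> \<le> ln 2 - t * \<delta> / 2" by (simp add: ln_mult)
    moreover have "bin_entropy h = 1" unfolding 2 by (simp add: bin_entropy_def log_divide)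
    then have "(bin_entropy h - t * \<delta> / (2 * ln 2)) * ln 2 = ln 2 - t * \<delta> / 2"
      by (simp add: left_diff_distrib)
    moreover have "0 < t * \<delta> / (2 * ln 2)" using t 2 \<delta> by simp
    ultimately show ?thesis using t(1) by (intro exI[of _ t] exI[of _ "t * \<delta> / (2 * ln 2)"] conjI) simp_all
  next
    case 3
    define t where "t = ln ((1 - h) / h)"
    have t: "0 < t" using 3 by (simp add: t_def)
    have "1 + exp t = 1 / h" using 3 by (simp add: t_def field_simps)
    then have L: "ln (2 * cosh (t / 2)) = - t / 2 - ln h" unfolding ln_cosh using 3 by (simp add: ln_div)
    have l: "ln (1 - h) = t + ln h" using 3 by (simp add: t_def ln_div)
    have ent: "bin_entropy h * ln 2 = - (h * ln h + (1 - h) * ln (1 - h))"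
      by (simp add: bin_entropy_def log_def field_simps)
    have "ln (2 * cosh (t / 2)) - t * (1 / 2 - h) = bin_entropy h * ln 2"
      unfolding L ent l by (simp add: field_simps)
    then have "ln (2 * cosh (t / 2)) - t * \<delta> = bin_entropy h * ln 2 - t * (\<delta> - (1 / 2 - h))"
      by (simp add: algebra_simps)
    also have "\<dots> = (bin_entropy h - t * (\<delta> - (1 / 2 - h)) / ln 2) * ln 2" by (simp add: left_diff_distrib)
    finally show ?thesis using t \<delta>
      by (intro exI[of _ t] exI[of _ "t * (\<delta> - (1 / 2 - h)) / ln 2"] conjI) simp_all
  qed
qed

section \<open>Deciding death at a stage\<close>

lemma KC_le:
  assumes "U p = Some \<sigma>" shows "KC U \<sigma> \<le> length p"
  unfolding KC_def using assms by (intro Least_le) blast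

text \<open>
  The set of all strings of a given length is an instance of \<open>counting_code\<close>. This bounds the dimension
  by 1 and shows that every string has a description.
\<close>

lemma optimal_description_length:
  assumes "optimal_machine U"
  shows "\<exists>C. \<forall>\<sigma>. \<exists>p. U p = Some \<sigma> \<and>
    length p \<le> length \<sigma> + 3 * floor_sqrt (length \<sigma>) + 2 * floor_log (length \<sigma>) + C"
proof -
  define P :: "nat \<Rightarrow> nat \<Rightarrow> nat \<Rightarrow> bool" where "P c x s \<longleftrightarrow> floor_log (Suc x) = c" for c x s
  have "decidable (\<lambda>e. P (e 0) (e 1) (e 2))" unfolding P_def by (intro comp_intros)
  from counting_code[OF assms this] obtain C where C: "\<And>c a b \<sigma>. c < 2 ^ a \<Longrightarrow>
     finite {\<tau>. \<exists>s. P c (str_code \<tau>) s} \<Longrightarrow> card {\<tau>. \<exists>s. P c (str_code \<tau>) s} \<le> 2 ^ b\<^sup>2 \<Longrightarrow>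
     (\<exists>s. P c (str_code \<sigma>) s) \<Longrightarrow> \<exists>p. U p = Some \<sigma> \<and> length p \<le> 2 * a + b\<^sup>2 + b + C" by metis
  have P: "(\<exists>s. P c (str_code \<tau>) s) \<longleftrightarrow> length \<tau> = c" for c \<tau>
    using floor_log_num[of \<tau>, unfolded num_def] by (simp add: P_def)
  have "\<exists>p. U p = Some \<sigma> \<and>
    length p \<le> length \<sigma> + 3 * floor_sqrt (length \<sigma>) + 2 * floor_log (length \<sigma>) + (C + 4)" for \<sigma>
  proof -
    let ?n = "length \<sigma>"
    have fin: "finite {\<tau>::bool list. length \<tau> = ?n}" using finite_lists_length_eq[of "UNIV::bool set" ?n] by simp
    have "card {\<tau>::bool list. length \<tau> = ?n} = 2 ^ ?n" using card_lists_length_eq[of "UNIV::bool set" ?n] by simp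
    also have "\<dots> \<le> 2 ^ (Suc (floor_sqrt ?n))\<^sup>2"
      using Suc_floor_sqrt_power2_gt[of ?n] by (intro power_increasing) auto
    finally have "card {\<tau>::bool list. length \<tau> = ?n} \<le> 2 ^ (Suc (floor_sqrt ?n))\<^sup>2" .
    moreover have "?n < 2 ^ Suc (floor_log ?n)" using floor_log_exp2_gt by simp
    ultimately obtain p where p: "U p = Some \<sigma>"
      "length p \<le> 2 * Suc (floor_log ?n) + (Suc (floor_sqrt ?n))\<^sup>2 + Suc (floor_sqrt ?n) + C"
      using C[of ?n "Suc (floor_log ?n)" "Suc (floor_sqrt ?n)" \<sigma>] fin unfolding P by auto
    have "(Suc (floor_sqrt ?n))\<^sup>2 = (floor_sqrt ?n)\<^sup>2 + 2 * floor_sqrt ?n + 1" by (simp add: power2_eq_square)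
    also have "\<dots> \<le> ?n + 2 * floor_sqrt ?n + 1" by simp
    finally show ?thesis using p by (intro exI[of _ p]) auto
  qed
  then show ?thesis by blast
qed

definition num_ham :: "nat \<Rightarrow> nat \<Rightarrow> nat \<Rightarrow> nat" where
  "num_ham m A B = (\<Sum>i<m. of_bool (\<not> (A div 2 ^ i mod 2 = B div 2 ^ i mod 2)))"

lemma num_ham: "m \<le> length \<sigma> \<Longrightarrow> m \<le> length \<tau> \<Longrightarrow> num_ham m (num \<sigma>) (num \<tau>) = ham m \<sigma> \<tau>"
proof -
  assume m: "m \<le> length \<sigma>" "m \<le> length \<tau>"
  have "num_ham m (num \<sigma>) (num \<tau>) = (\<Sum>i<m. of_bool (\<sigma> ! i \<noteq> \<tau> ! i))"
    unfolding num_ham_def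
  proof (rule sum.cong)
    fix i assume "i \<in> {..<m}"
    then have "\<sigma> ! i = odd (num \<sigma> div 2 ^ i)" "\<tau> ! i = odd (num \<tau> div 2 ^ i)" using num_nth m by auto
    then show "of_bool (\<not> (num \<sigma> div 2 ^ i mod 2 = num \<tau> div 2 ^ i mod 2)) = of_bool (\<sigma> ! i \<noteq> \<tau> ! i)"
      by (simp add: mod2_eq_if)
  qed simp
  also have "\<dots> = card {i. i < m \<and> \<sigma> ! i \<noteq> \<tau> ! i}"
    by (simp add: of_bool_def sum.If_cases Int_def)
  finally show ?thesis by (simp add: ham_def)
qed

context staged_machine
begin

text \<open>
  Deadness as a statement about numbers, with bounded quantifiers only.
\<close>

definition num_dead :: "nat \<Rightarrow> nat \<Rightarrow> nat \<Rightarrow> nat \<Rightarrow> bool" where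
  "num_dead z s n N \<longleftrightarrow> \<not> (\<exists>Y<2 * 2 ^ n. 2 ^ n \<le> Y \<and> (\<forall>m<Suc n.
     num_ham m N Y \<le> sched (digit z) m \<and>
     (2 ^ Suc s) ^ rank m \<le> (2 ^ Suc s - scaled_mass s m Y) ^ rank m
        * 2 ^ (sched (digit z) m - num_ham m N Y)))"

lemma decidable_num_dead [comp_intros]:
  assumes "computable Z" "computable S" "computable F" "computable G"
  shows "decidable (\<lambda>e. num_dead (Z e) (S e) (F e) (G e))"
  unfolding num_dead_def num_ham_def sched_def digit_def rank_def
  by (intro comp_intros assms computable_shift)

lemma room_power_ge:
  assumes "m \<le> length y"
  shows "1 \<le> room s (take m y) ^ k * 2 ^ j \<longleftrightarrow>
     (2 ^ Suc s) ^ k \<le> (2 ^ Suc s - scaled_mass s m (num y)) ^ k * 2 ^ j"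
proof -
  let ?q = "2 ^ Suc s - scaled_mass s m (num y)"
  have "room s (take m y) = real ?q / 2 ^ Suc s"
    using room_eq[of s "take m y"] scaled_mass_take[OF assms] assms by (simp add: min_absorb2)
  then have "1 \<le> room s (take m y) ^ k * 2 ^ j \<longleftrightarrow> 1 \<le> real ?q ^ k * 2 ^ j / (2 ^ Suc s) ^ k"
    by (simp only: power_divide times_divide_eq_left)
  also have "\<dots> \<longleftrightarrow> (2 ^ Suc s) ^ k \<le> real ?q ^ k * 2 ^ j"
    by (subst le_divide_eq_1_pos) auto
  also have "\<dots> \<longleftrightarrow> real ((2 ^ Suc s) ^ k) \<le> real (?q ^ k * 2 ^ j)"
    by (simp del: power_Suc)
  finally show ?thesis by (simp only: of_nat_le_iff)
qed

lemma num_dead: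
  assumes "n \<le> length \<sigma>"
  shows "num_dead z s n (num \<sigma>) \<longleftrightarrow> dead room rank (sched (digit z)) s (take n \<sigma>)"
proof -
  let ?D = "sched (digit z)"
  have alive: "alive room rank ?D s (take n \<sigma>) y \<longleftrightarrow> length y = n \<and>
     (\<forall>m<Suc n. num_ham m (num \<sigma>) (num y) \<le> ?D m \<and>
     (2 ^ Suc s) ^ rank m \<le> (2 ^ Suc s - scaled_mass s m (num y)) ^ rank m * 2 ^ (?D m - num_ham m (num \<sigma>) (num y)))" for y
  proof (cases "length y = n")
    case True
    have "ham m (take n \<sigma>) y = num_ham m (num \<sigma>) (num y)" if "m \<le> n" for m
    proof -
      have "ham m (take n \<sigma>) y = ham m \<sigma> y" using that by (intro ham_cong) (simp_all add: min_absorb1)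
      then show ?thesis using num_ham that assms True by simp
    qed
    moreover have "length (take n \<sigma>) = n" using assms by simp
    ultimately show ?thesis using True unfolding alive_def less_Suc_eq_le
      by (simp add: room_power_ge cong: conj_cong)
  qed (use assms in \<open>simp add: alive_def\<close>)
  have "(\<exists>Y<2 * 2 ^ n. 2 ^ n \<le> Y \<and> Q Y) \<longleftrightarrow> (\<exists>y. length y = n \<and> Q (num y))" for Q
    using num_bounds num_surj[of n] by metis
  then show ?thesis unfolding num_dead_def dead_def alive by simp
qed

text \<open>
  The parameter \<open>c\<close> packs the length of the string together with the number that stores the slopes.
\<close>

definition num_dies :: "nat \<Rightarrow> nat \<Rightarrow> nat \<Rightarrow> bool" where
  "num_dies c x s \<longleftrightarrow> floor_log (Suc x) = pfst c \<and> num_dead (psnd c) s (pfst c) (Suc x)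
     \<and> \<not> num_dead (psnd c) s (pfst c - 1) (Suc x)"

lemma decidable_num_dies: "decidable (\<lambda>e. num_dies (e 0) (e 1) (e 2))"
  unfolding num_dies_def by (intro comp_intros)

lemma num_dies: "num_dies (pair n z) (str_code \<sigma>) s \<longleftrightarrow>
    length \<sigma> = n \<and> dies room rank (sched (digit z)) s \<sigma>"
  using num_dead[of "length \<sigma>" \<sigma> z s] num_dead[of "length \<sigma> - 1" \<sigma> z s] floor_log_num[of \<sigma>]
  by (auto simp: num_dies_def dies_def num_def butlast_conv_take)

lemma room_family_sched:
  "room_family room rank (sched e)"
proof
  show "1 \<le> rank n" "rank n \<le> rank (Suc n)" "rank 0 = 1" "1 \<le> sched e 0" for n
    using rank_mono[of n "Suc n"] by (simp_all add: rank_def sched_def)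
  show "0 \<le> room s y" for s y by (simp add: room_def)
qed (use room_submartingale room_antimono room_le_1 room_Nil in auto)

lemma card_dies:
  fixes t :: real
  assumes "0 < t"
  shows "card {\<rho>. length \<rho> = k \<and> (\<exists>s. dies room rank (sched (digit z)) s \<rho>)}
    \<le> exp (ln (2 * cosh (t / 2)) * k - t * sched (digit z) k + t * (overhead k + 1))"
proof -
  interpret room_family room rank "sched (digit z)" by (rule room_family_sched)
  have "overhead n + 1 / rank (Suc n) + (real (rank (Suc n)) - rank n) * sched (digit z) n / rank n \<le> overhead (Suc n)" for n
    using sched_le[of "digit z" n, OF digit_less] by (intro overhead_step) (simp flip: of_nat_mult of_nat_add)
  from card_Dies[of t overhead, OF assms this, of k] show ?thesis by (simp add: overhead_def)
qed

end

section \<open>Dimension, distance and infinite paths\<close>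

lemma length_initial_seg [simp]: "length (initial_seg X n) = n"
  by (simp add: initial_seg_def)

lemma take_initial_seg: "m \<le> n \<Longrightarrow> take m (initial_seg X n) = initial_seg X m"
  by (simp add: initial_seg_def take_map)

lemma butlast_initial_seg: "butlast (initial_seg X n) = initial_seg X (n - 1)"
  by (simp add: butlast_conv_take take_initial_seg)

lemma eff_dim_bounds:
  assumes "optimal_machine U"
  shows "0 \<le> eff_dim U X" "eff_dim U X \<le> 1"
    "0 < \<epsilon> \<Longrightarrow> \<forall>\<^sub>F n in sequentially. (eff_dim U X - \<epsilon>) * n \<le> KC U (initial_seg X n)"
proof -
  define a where "a n = real (KC U (initial_seg X n)) / real n" for n
  define l where "l = liminf (\<lambda>n. ereal (a n))"
  have dim: "eff_dim U X = real_of_ereal l" by (simp add: eff_dim_def l_def a_def)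
  have l0: "0 \<le> l" unfolding l_def by (intro Liminf_bounded always_eventually) (simp add: a_def)
  obtain C where C: "\<And>\<sigma>. \<exists>p. U p = Some \<sigma> \<and>
    length p \<le> length \<sigma> + 3 * floor_sqrt (length \<sigma>) + 2 * floor_log (length \<sigma>) + C"
    using optimal_description_length[OF assms] by blast
  have upper: "KC U (initial_seg X n) \<le> n + 3 * sqrt n + 2 * log 2 n + C" if "0 < n" for n
  proof -
    obtain p where "U p = Some (initial_seg X n)" "length p \<le> n + 3 * floor_sqrt n + 2 * floor_log n + C"
      using C[of "initial_seg X n"] by auto
    then have "KC U (initial_seg X n) \<le> n + 3 * floor_sqrt n + 2 * floor_log n + C"
      using KC_le[of U p] by (meson order_trans)
    then have "real (KC U (initial_seg X n)) \<le> real (n + 3 * floor_sqrt n + 2 * floor_log n + C)"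
      by (subst of_nat_le_iff)
    moreover have "real (floor_sqrt n) \<le> sqrt n"
    proof (rule real_le_rsqrt)
      have "real ((floor_sqrt n)\<^sup>2) \<le> real n" by (subst of_nat_le_iff) simp
      then show "(real (floor_sqrt n))\<^sup>2 \<le> real n" by simp
    qed
    moreover have "real (floor_log n) \<le> log 2 n"
    proof -
      have "real (2 ^ floor_log n) \<le> real n" using floor_log_exp2_le[OF that] by (subst of_nat_le_iff)
      then show ?thesis using that by (subst le_log_iff) (simp_all add: powr_realpow)
    qed
    ultimately show ?thesis by simp
  qed
  have "l \<le> 1 + ereal \<epsilon>" if "0 < \<epsilon>" for \<epsilon>
  proof -
    have "\<forall>\<^sub>F n in sequentially. real n + 3 * sqrt n + 2 * log 2 n + C \<le> (1 + \<epsilon>) * n"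
      using that by real_asymp
    then have "\<forall>\<^sub>F n in sequentially. ereal (a n) \<le> 1 + ereal \<epsilon>"
      using eventually_gt_at_top[of 0]
    proof eventually_elim
      case (elim n)
      then have "real (KC U (initial_seg X n)) \<le> (1 + \<epsilon>) * n" using upper[of n] by linarith
      then have "a n \<le> 1 + \<epsilon>" using elim by (simp add: a_def divide_le_eq)
      then show ?case by (simp add: one_ereal_def)
    qed
    then have "limsup (\<lambda>n. ereal (a n)) \<le> 1 + ereal \<epsilon>" by (rule Limsup_bounded)
    then show ?thesis unfolding l_def using Liminf_le_Limsup[of sequentially] by (meson order_trans trivial_limit_sequentially)
  qed
  then have l1: "l \<le> 1" by (rule ereal_le_epsilon2)
  have l: "l = ereal (eff_dim U X)" unfolding dim using l0 l1 by (cases l) auto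
  show "0 \<le> eff_dim U X" "eff_dim U X \<le> 1" using l0 l1 by (simp_all add: l one_ereal_def)
  show "\<forall>\<^sub>F n in sequentially. (eff_dim U X - \<epsilon>) * n \<le> KC U (initial_seg X n)" if "0 < \<epsilon>"
  proof -
    have "ereal (eff_dim U X - \<epsilon>) < liminf (\<lambda>n. ereal (a n))" using that l by (simp add: l_def)
    from less_LiminfD[OF this] eventually_gt_at_top[of 0]
    show ?thesis
      by eventually_elim (simp add: a_def pos_less_divide_eq less_imp_le)
  qed
qed

text \<open>
  A node is kept if it has extensions of every length in the tree.
\<close>

lemma koenig_binary:
  assumes ex: "\<And>n. \<exists>y. length y = n \<and> A y" and take: "\<And>y n. A y \<Longrightarrow> A (take n y)"
  shows "\<exists>Y. \<forall>n. A (initial_seg Y n)"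
proof -
  define good where "good y \<longleftrightarrow> (\<forall>n\<ge>length y. \<exists>w. length w = n \<and> A w \<and> take (length y) w = y)" for y
  have good_Nil: "good []" using ex by (simp add: good_def)
  have good_ext: "\<exists>b. good (y @ [b])" if "good y" for y
  proof (rule ccontr)
    assume "\<nexists>b. good (y @ [b])"
    then have "\<forall>b. \<exists>n\<ge>Suc (length y). \<not> (\<exists>w. length w = n \<and> A w \<and> take (Suc (length y)) w = y @ [b])"
      unfolding good_def by simp
    then obtain N where N: "\<And>b. Suc (length y) \<le> N b"
      "\<And>b w. length w = N b \<Longrightarrow> A w \<Longrightarrow> take (Suc (length y)) w \<noteq> y @ [b]" by metis
    define n where "n = max (N False) (N True)"
    have n: "N b \<le> n" for b by (cases b) (auto simp: n_def)
    then have ln: "Suc (length y) \<le> n" using N(1) order_trans by blast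
    then obtain w where w: "length w = n" "A w" "take (length y) w = y"
      using \<open>good y\<close> unfolding good_def by (meson Suc_leD)
    define b where "b = w ! length y"
    have "take (Suc (length y)) w = y @ [b]" using w ln by (simp add: take_Suc_conv_app_nth b_def)
    then have "take (Suc (length y)) (take (N b) w) = y @ [b]" using N(1)[of b] by (simp add: min_absorb1)
    moreover have "length (take (N b) w) = N b" using n[of b] w by simp
    ultimately show False using N(2) take[OF w(2)] by blast
  qed
  define f where "f = rec_nat [] (\<lambda>_ y. y @ [SOME b. good (y @ [b])])"
  have f: "f 0 = []" "f (Suc n) = f n @ [SOME b. good (f n @ [b])]" for n by (simp_all add: f_def)
  define Y where "Y n = (SOME b. good (f n @ [b]))" for n
  have "initial_seg Y n = f n" for n by (induction n) (simp_all add: f initial_seg_def Y_def)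
  moreover have "good (f n)" for n
  proof (induction n)
    case (Suc n)
    from someI_ex[OF good_ext[OF this]] show ?case by (simp add: f)
  qed (simp add: f good_Nil)
  moreover have "A y" if "good y" for y
    using \<open>good y\<close>[unfolded good_def, rule_format, of "length y"] by fastforce
  ultimately have "\<forall>n. A (initial_seg Y n)" by simp
  then show ?thesis by blast
qed

lemma alive_cong:
  "(\<And>m. m \<le> length \<sigma> \<Longrightarrow> D m = D' m) \<Longrightarrow> alive q r D s \<sigma> y \<longleftrightarrow> alive q r D' s \<sigma> y"
  unfolding alive_def by (intro conj_cong all_cong imp_cong) auto

lemma dead_cong:
  "(\<And>m. m \<le> length \<sigma> \<Longrightarrow> D m = D' m) \<Longrightarrow> dead q r D s \<sigma> \<longleftrightarrow> dead q r D' s \<sigma>"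
  unfolding dead_def using alive_cong[of \<sigma> D D'] by simp

lemma dies_cong:
  assumes "\<And>m. m \<le> length \<sigma> \<Longrightarrow> D m = D' m"
  shows "dies q r D s \<sigma> \<longleftrightarrow> dies q r D' s \<sigma>"
  unfolding dies_def using dead_cong[of \<sigma> D D'] dead_cong[of "butlast \<sigma>" D D'] assms by simp

lemma seq_dist_le:
  fixes B :: real
  assumes "\<And>\<epsilon>. 0 < \<epsilon> \<Longrightarrow> \<forall>\<^sub>F n in sequentially. ham n (initial_seg X n) (initial_seg Y n) \<le> (B + \<epsilon>) * n"
  shows "seq_dist X Y \<le> B"
proof -
  let ?d = "\<lambda>n. str_dist (initial_seg X n) (initial_seg Y n)"
  have d: "?d n = ham n (initial_seg X n) (initial_seg Y n) / n" for n
    by (simp add: str_dist_def ham_def)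
  have "limsup (\<lambda>n. ereal (?d n)) \<le> ereal B + ereal \<epsilon>" if "0 < \<epsilon>" for \<epsilon>
  proof (rule Limsup_bounded)
    show "\<forall>\<^sub>F n in sequentially. ereal (?d n) \<le> ereal B + ereal \<epsilon>"
      using assms[OF that] eventually_gt_at_top[of 0]
      by eventually_elim (simp add: d divide_le_eq)
  qed
  then have le: "limsup (\<lambda>n. ereal (?d n)) \<le> ereal B" by (rule ereal_le_epsilon2)
  have "0 \<le> liminf (\<lambda>n. ereal (?d n))"
    by (intro Liminf_bounded always_eventually) (simp add: str_dist_def)
  then have "0 \<le> limsup (\<lambda>n. ereal (?d n))"
    using Liminf_le_Limsup[of sequentially "\<lambda>n. ereal (?d n)"] by (meson order_trans trivial_limit_sequentially)
  from real_of_ereal_positive_mono[OF this le] show ?thesis by (simp add: seq_dist_def)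
qed

context staged_machine
begin

text \<open>
  The strings of length \<open>n\<close> that die are so few that each of them has a description of
  \<open>(H(\<theta>) - 3\<eta>/4) n + O(sqrt n)\<close> bits. The \<open>z\<close>-part of the description has about \<open>log(n)^2\<close> bits and is
  absorbed. A prefix of \<open>X\<close> has more complexity than that.
\<close>

lemma rarely_dies:
  fixes \<theta> \<delta> :: real
  assumes U: "optimal_machine U"
    and dim: "\<And>\<epsilon>. 0 < \<epsilon> \<Longrightarrow> \<forall>\<^sub>F n in sequentially. (bin_entropy \<theta> - \<epsilon>) * n \<le> KC U (initial_seg X n)"
    and \<theta>: "0 \<le> \<theta>" "\<theta> \<le> 1 / 2" "bin_entropy \<theta> \<le> 1" and \<delta>: "1 / 2 - \<theta> < \<delta>"
  shows "\<forall>\<^sub>F n in sequentially. \<forall>z<2 ^ (floor_log (Suc n) + 3)\<^sup>2. \<delta> * n \<le> sched (digit z) n \<longrightarrow>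
     \<not> (\<exists>s. dies room rank (sched (digit z)) s (initial_seg X n))"
proof -
  let ?H = "bin_entropy \<theta>"
  obtain t \<eta> :: real where t: "0 < t" and \<eta>: "0 < \<eta>" and le: "ln (2 * cosh (t / 2)) - t * \<delta> \<le> (?H - \<eta>) * ln 2"
    using entropy_exponent[OF \<theta>(1,2) \<delta>] by auto
  from counting_code[of U num_dies, OF U decidable_num_dies]
  obtain C where C: "\<forall>c a b \<sigma>. c < 2 ^ a \<longrightarrow> finite {\<tau>. \<exists>s. num_dies c (str_code \<tau>) s} \<longrightarrow>
     card {\<tau>. \<exists>s. num_dies c (str_code \<tau>) s} \<le> 2 ^ b\<^sup>2 \<longrightarrow> (\<exists>s. num_dies c (str_code \<sigma>) s) \<longrightarrow>
     (\<exists>p. U p = Some \<sigma> \<and> length p \<le> 2 * a + b\<^sup>2 + b + C)" ..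
  have "0 < \<eta> / 4 * ln 2 / (2 * t)" using \<eta> t by simp
  from overhead_sublinear[OF this]
  have ov: "\<forall>\<^sub>F n in sequentially. t * overhead n \<le> \<eta> / 8 * ln 2 * n"
    by eventually_elim (use t in \<open>simp add: field_simps\<close>)
  have t1: "\<forall>\<^sub>F n in sequentially. t \<le> \<eta> / 8 * ln 2 * real n" using \<eta> by real_asymp
  have big: "\<forall>\<^sub>F n in sequentially. 4 * (log 2 (real n + 1) + 3)\<^sup>2 + 6 + 3 * sqrt (real n) + C < \<eta> / 2 * real n"
    using \<eta> by real_asymp
  have K: "\<forall>\<^sub>F n in sequentially. (?H - \<eta> / 4) * n \<le> KC U (initial_seg X n)" using dim[of "\<eta> / 4"] \<eta> by simp
  from ov t1 big K show ?thesis
  proof eventually_elim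
    case (elim n)
    show ?case
    proof (intro allI impI notI)
      fix z
      define w where "w = (floor_log (Suc n) + 3)\<^sup>2"
      assume z: "z < 2 ^ (floor_log (Suc n) + 3)\<^sup>2" and D: "\<delta> * n \<le> sched (digit z) n"
        and dies: "\<exists>s. dies room rank (sched (digit z)) s (initial_seg X n)"
      let ?T = "{\<rho>. length \<rho> = n \<and> (\<exists>s. dies room rank (sched (digit z)) s \<rho>)}"
      have T: "{\<tau>. \<exists>s. num_dies (pair n z) (str_code \<tau>) s} = ?T" by (auto simp: num_dies)
      have fin: "finite ?T" by (rule finite_subset[OF _ finite_lists_length_eq[of UNIV n]]) auto
      define u where "u = (?H - 3 * \<eta> / 4) * n"
      have "ln (2 * cosh (t / 2)) * n - t * sched (digit z) n + t * (overhead n + 1) \<le> u * ln 2"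
      proof -
        have "(ln (2 * cosh (t / 2)) - t * \<delta>) * n \<le> (?H - \<eta>) * ln 2 * n" using le by (intro mult_right_mono) auto
        moreover have "t * (\<delta> * n) \<le> t * sched (digit z) n" using D t by (intro mult_left_mono) auto
        ultimately show ?thesis using elim(1,2) by (simp add: u_def algebra_simps)
      qed
      then have "card ?T \<le> exp (u * ln 2)" using card_dies[OF t, of n z] by (meson exp_le_cancel_iff order_trans)
      then have card: "card ?T \<le> 2 powr u" by (simp add: powr_def)
      have "initial_seg X n \<in> ?T" using dies by simp
      then have "0 < card ?T" using fin card_gt_0_iff by blast
      then have "1 \<le> 2 powr u" using card by linarith
      then have u0: "0 \<le> u" using powr_less_one[of 2 u] by fastforce
      have "u \<le> 1 * real n" unfolding u_def using \<theta>(3) \<eta> by (intro mult_right_mono) auto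
      then have un: "sqrt u \<le> sqrt n" by simp
      define b where "b = nat \<lceil>sqrt u\<rceil>"
      have b: "sqrt u \<le> b" "b \<le> sqrt u + 1" using u0 by (auto simp: b_def)
      have "u \<le> (real b)\<^sup>2" using b(1) u0 by (metis real_sqrt_ge_zero real_sqrt_pow2 power_mono)
      then have "2 powr u \<le> 2 powr real (b\<^sup>2)" by (intro powr_mono) auto
      also have "\<dots> = real (2 ^ b\<^sup>2)" by (subst powr_realpow) auto
      finally have "card ?T \<le> 2 ^ b\<^sup>2" using card by (meson of_nat_le_iff order_trans)
      then have card2: "card {\<tau>. \<exists>s. num_dies (pair n z) (str_code \<tau>) s} \<le> 2 ^ b\<^sup>2" unfolding T .
      have pair: "pair n z < 2 ^ (2 * w + 2)"
      proof -
        have "floor_log (Suc n) + 3 \<le> w" unfolding w_def power2_eq_square by (rule le_square)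
        then have "floor_log (Suc n) + 1 \<le> w" by simp
        then have "2 ^ (floor_log (Suc n) + 1) \<le> (2::nat) ^ w" by (intro power_increasing) auto
        then have "Suc n < 2 ^ w" using floor_log_exp2_gt[of "Suc n"] by simp
        then have "n + z + 1 \<le> 2 ^ (w + 1)" using z by (simp add: w_def)
        then have "(n + z + 1)\<^sup>2 \<le> (2 ^ (w + 1))\<^sup>2" by (rule power_mono) simp
        also have "\<dots> = 2 ^ (2 * w + 2)" by (simp flip: power_mult)
        finally show ?thesis by (simp add: pair_def power2_eq_square algebra_simps)
      qed
      have nd: "\<exists>s. num_dies (pair n z) (str_code (initial_seg X n)) s" using dies by (simp add: num_dies)
      have "finite {\<tau>. \<exists>s. num_dies (pair n z) (str_code \<tau>) s}" unfolding T by (rule fin)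
      from C[rule_format, OF pair this card2 nd] obtain p where
        p: "U p = Some (initial_seg X n)" "length p \<le> 2 * (2 * w + 2) + b\<^sup>2 + b + C" by auto
      have "real (KC U (initial_seg X n)) \<le> real (2 * (2 * w + 2) + b\<^sup>2 + b + C)"
        using KC_le[of U, OF p(1)] p(2) by (subst of_nat_le_iff) linarith
      then have "(?H - \<eta> / 4) * n \<le> 4 * w + 4 + (real b)\<^sup>2 + b + C" using elim(4) by simp
      moreover have "(real b)\<^sup>2 + b \<le> u + 3 * sqrt n + 2"
      proof -
        have "(real b)\<^sup>2 \<le> (sqrt u + 1)\<^sup>2" using b(2) by (intro power_mono) auto
        also have "\<dots> = u + 2 * sqrt u + 1" using u0 by (simp add: power2_sum)
        finally show ?thesis using b(2) un by linarith
      qed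
      moreover have "real w \<le> (log 2 (real n + 1) + 3)\<^sup>2"
      proof -
        have "real (2 ^ floor_log (Suc n)) \<le> real (Suc n)" using floor_log_exp2_le[of "Suc n"] by (subst of_nat_le_iff) simp
        then have "real (floor_log (Suc n)) \<le> log 2 (real n + 1)" by (subst le_log_iff) (simp_all add: powr_realpow add.commute)
        then have "(real (floor_log (Suc n)) + 3)\<^sup>2 \<le> (log 2 (real n + 1) + 3)\<^sup>2" by (intro power_mono) auto
        then show ?thesis by (simp add: w_def)
      qed
      moreover have "(?H - \<eta> / 4) * n = u + \<eta> / 2 * n" by (simp add: u_def algebra_simps)
      ultimately show False using elim(3) by linarith
    qed
  qed
qed

text \<open>
  A companion chosen only to keep the room at least \<open>1/2\<close> is alive under this budget. This covers the
  initial blocks, for which nothing is known about the complexity of \<open>X\<close>.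
\<close>

lemma generous_budget_not_dead:
  assumes "\<And>m. m \<le> length \<sigma> \<Longrightarrow> 2 * m + 1 \<le> D m"
  shows "\<not> dead room rank D s \<sigma>"
proof -
  have "\<exists>y. length y = n \<and> (\<forall>m\<le>n. 1 / 2 \<le> room s (take m y))" for n
  proof (induction n)
    case 0 show ?case using room_Nil by simp
  next
    case (Suc n)
    then obtain y where y: "length y = n" "\<And>m. m \<le> n \<Longrightarrow> 1 / 2 \<le> room s (take m y)" by blast
    have "1 \<le> room s (y @ [False]) + room s (y @ [True])" using room_submartingale[of s y] y(2)[of n] y(1) by simp
    then have "1 / 2 \<le> room s (y @ [False]) \<or> 1 / 2 \<le> room s (y @ [True])" by linarith
    then obtain b where b: "1 / 2 \<le> room s (y @ [b])" by blast
    have "1 / 2 \<le> room s (take m (y @ [b]))" if "m \<le> Suc n" for m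
      using that y b by (cases "m = Suc n") auto
    then show ?case using y(1) by (intro exI[of _ "y @ [b]"]) simp
  qed
  then obtain y where y: "length y = length \<sigma>" "\<And>m. m \<le> length \<sigma> \<Longrightarrow> 1 / 2 \<le> room s (take m y)" by blast
  have "alive room rank D s \<sigma> y" unfolding alive_def
  proof (intro conjI allI impI y(1))
    fix m assume m: "m \<le> length \<sigma>"
    have ham: "ham m \<sigma> y \<le> m" by (rule ham_le)
    then show "ham m \<sigma> y \<le> D m" using assms[OF m] by linarith
    have "rank m \<le> m + 1" using floor_log_Suc_le[of m] by (simp add: rank_def)
    also have "m + 1 \<le> D m - ham m \<sigma> y" using ham assms[OF m] by linarith
    finally have "(1 / 2 :: real) ^ (D m - ham m \<sigma> y) \<le> (1 / 2) ^ rank m" by (intro power_decreasing) auto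
    also have "\<dots> \<le> room s (take m y) ^ rank m" using y(2)[OF m] by (intro power_mono) auto
    finally show "1 \<le> room s (take m y) ^ rank m * 2 ^ (D m - ham m \<sigma> y)"
      by (simp add: power_one_over field_simps)
  qed
  then show ?thesis unfolding dead_def by blast
qed

text \<open>
  For each length there are finitely many companions, and companions alive at a stage were alive before,
  so some companion is alive at all stages; these companions form an infinite binary tree.
\<close>

lemma ex_close_random:
  assumes nd: "\<And>n s. \<not> dead room rank (sched e) s (initial_seg X n)"
  shows "\<exists>Y. \<forall>n s. alive room rank (sched e) s (initial_seg X n) (initial_seg Y n)"
proof -
  interpret room_family room rank "sched e" by (rule room_family_sched)
  define A where "A y \<longleftrightarrow> (\<forall>s. Alive s (initial_seg X (length y)) y)" for y
  have "\<exists>Y. \<forall>n. A (initial_seg Y n)"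
  proof (rule koenig_binary)
    fix n
    let ?L = "{y :: bool list. length y = n}"
    have fin: "finite ?L" using finite_lists_length_eq[of "UNIV :: bool set" n] by simp
    show "\<exists>y. length y = n \<and> A y"
    proof (rule ccontr)
      assume "\<nexists>y. length y = n \<and> A y"
      then have "\<forall>y\<in>?L. \<exists>s. \<not> Alive s (initial_seg X n) y" by (auto simp: A_def)
      then obtain f where f: "\<And>y. y \<in> ?L \<Longrightarrow> \<not> Alive (f y) (initial_seg X n) y" by metis
      define s where "s = Max (f ` ?L)"
      obtain y where y: "Alive s (initial_seg X n) y" using nd[of s n] by (auto simp: dead_def)
      then have "y \<in> ?L" by (simp add: alive_def)
      moreover then have "f y \<le> s" unfolding s_def using fin by (intro Max_ge) auto
      ultimately show False using f Alive_antimono[OF _ y] by blast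
    qed
  next
    fix y n assume "A y"
    show "A (take n y)"
    proof (cases "n \<le> length y")
      case True
      have "Alive s (take n (initial_seg X (length y))) (take n y)" for s
        using \<open>A y\<close> by (intro alive_take) (simp add: A_def)
      then show ?thesis using True by (simp add: A_def take_initial_seg min_absorb2)
    qed (use \<open>A y\<close> in simp)
  qed
  then show ?thesis by (simp add: A_def)
qed

end

theorem theorem2p1:
  fixes U :: "bool list \<Rightarrow> bool list option" and X :: "nat \<Rightarrow> bool"
  assumes "optimal_machine U"
  shows "\<exists>Y :: nat \<Rightarrow> bool. martin_loef_random U Y \<and>
           seq_dist X Y \<le> 1/2 - bin_entropy_inv (eff_dim U X)"
proof -
  obtain h where "staged_machine U h" using optimal_machine_staged[OF assms] by blast
  then interpret staged_machine U h .
  define \<theta> where "\<theta> = bin_entropy_inv (eff_dim U X)"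
  have dim01: "eff_dim U X \<in> {0..1}" using eff_dim_bounds(1,2)[OF assms] by simp
  have \<theta>: "0 \<le> \<theta>" "\<theta> \<le> 1 / 2" "bin_entropy \<theta> = eff_dim U X"
  proof -
    have inj: "inj_on bin_entropy {0..1/2}" and img: "bin_entropy ` {0..1/2} = {0..1}"
      using bij_betw_bin_entropy by (auto simp: bij_betw_def)
    have "\<theta> \<in> {0..1/2}" unfolding \<theta>_def bin_entropy_inv_def
      by (rule the_inv_into_into[OF inj _ subset_refl]) (use dim01 img in simp)
    then show "0 \<le> \<theta>" "\<theta> \<le> 1 / 2" by auto
    show "bin_entropy \<theta> = eff_dim U X" unfolding \<theta>_def bin_entropy_inv_def
      by (rule f_the_inv_into_f[OF inj]) (use dim01 img in simp)
  qed
  \<comment> \<open>Slope \<open>e\<close> is safe on block \<open>i\<close> if no prefix of \<open>X\<close> with length in that block ever dies, whatever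
    the slopes on the earlier blocks are.\<close>
  define safe where "safe i e \<longleftrightarrow> (\<forall>n z. floor_log (Suc n) = i \<longrightarrow> z < 2 ^ (i + 3)\<^sup>2 \<longrightarrow> digit z i = e \<longrightarrow>
      \<not> (\<exists>s. dies room rank (sched (digit z)) s (initial_seg X n)))" for i e
  have safe_ev: "\<forall>\<^sub>F i in sequentially. \<forall>e. \<delta> * 2 ^ i \<le> real e \<longrightarrow> safe i e" if \<delta>: "1 / 2 - \<theta> < \<delta>" for \<delta>
  proof -
    have "\<forall>\<^sub>F n in sequentially. \<forall>z<2 ^ (floor_log (Suc n) + 3)\<^sup>2. \<delta> * n \<le> sched (digit z) n \<longrightarrow>
     \<not> (\<exists>s. dies room rank (sched (digit z)) s (initial_seg X n))"
      using eff_dim_bounds(3)[OF assms] dim01 \<theta> \<delta> by (intro rarely_dies[OF assms]) auto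
    then obtain n0 where n0: "\<And>n z. n0 \<le> n \<Longrightarrow> z < 2 ^ (floor_log (Suc n) + 3)\<^sup>2 \<Longrightarrow>
        \<delta> * n \<le> sched (digit z) n \<Longrightarrow> \<not> (\<exists>s. dies room rank (sched (digit z)) s (initial_seg X n))"
      unfolding eventually_sequentially by blast
    have "safe i e" if i: "n0 \<le> i" and e: "\<delta> * 2 ^ i \<le> real e" for i e
      unfolding safe_def
    proof (intro allI impI)
      fix n z assume n: "floor_log (Suc n) = i" and z: "z < 2 ^ (i + 3)\<^sup>2" "digit z i = e"
      have "i \<le> n" using floor_log_Suc_le[of n] n by simp
      have "\<delta> * n \<le> real e / 2 ^ i * n" using e by (intro mult_right_mono) (simp_all add: pos_le_divide_eq)
      also have "\<dots> = real (n * e) / real (2 ^ i)" by simp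
      also have "\<dots> \<le> sched (digit z) n"
      proof -
        have "n * e \<le> Suc (n * e div 2 ^ i) * 2 ^ i"
          using dividend_less_div_times[of "2 ^ i" "n * e"] by simp
        then have "real (n * e) \<le> real (Suc (n * e div 2 ^ i)) * real (2 ^ i)"
          unfolding of_nat_mult[symmetric] by (subst of_nat_le_iff)
        then have "real (n * e) / real (2 ^ i) \<le> real (Suc (n * e div 2 ^ i))"
          by (subst pos_divide_le_eq) simp_all
        then show ?thesis using z n by (simp add: sched_def)
      qed
      finally show "\<not> (\<exists>s. dies room rank (sched (digit z)) s (initial_seg X n))"
        using i \<open>i \<le> n\<close> z n by (intro n0) auto
    qed
    then show ?thesis unfolding eventually_sequentially by blast
  qed
  have "\<forall>\<^sub>F i in sequentially. \<forall>e. 1 * 2 ^ i \<le> real e \<longrightarrow> safe i e" by (rule safe_ev) (use \<theta> in auto)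
  then obtain I0 where I0: "\<And>i. I0 \<le> i \<Longrightarrow> safe i (2 ^ i)" unfolding eventually_sequentially by force
  \<comment> \<open>Below block \<open>I0\<close> slope 2 keeps everything alive; from there on slope 1 is already safe.\<close>
  define e where "e i = (if i < I0 then 2 ^ (i + 1) else LEAST e. safe i e)" for i
  have e_least: "e i \<le> k" if "I0 \<le> i" "safe i k" for i k
    using that by (simp add: e_def Least_le)
  have e_safe: "safe i (e i)" if "I0 \<le> i" for i
    using LeastI[of "safe i", OF I0[OF that]] that by (simp add: e_def)
  have e_less: "e i < 2 ^ (i + 2)" for i
  proof (cases "i < I0")
    case False
    then have "e i \<le> 2 ^ i" by (intro e_least I0) auto
    also have "(2::nat) ^ i < 2 ^ (i + 2)" by (intro power_strict_increasing) auto
    finally show ?thesis .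
  qed (simp add: e_def)
  interpret room_family room rank "sched e" by (rule room_family_sched)
  \<comment> \<open>A shortest dead prefix would have to die, and its block excludes that.\<close>
  have nd: "\<not> Dead s (initial_seg X n)" for n s
  proof (induction n arbitrary: s rule: less_induct)
    case (less n)
    show ?case
    proof
      assume dead: "Dead s (initial_seg X n)"
      define i where "i = floor_log (Suc n)"
      show False
      proof (cases "i < I0")
        case True
        have "2 * m + 1 \<le> sched e m" if "m \<le> n" for m
        proof -
          let ?j = "floor_log (Suc m)"
          have "?j < I0" using floor_log_le_iff[of "Suc m" "Suc n"] that True by (simp add: i_def)
          then have "m * e ?j = 2 * m * 2 ^ ?j" by (simp add: e_def)
          then have "m * e ?j div 2 ^ ?j = 2 * m" by (metis div_mult_self_is_m zero_less_power pos2)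
          then show ?thesis unfolding sched_def by linarith
        qed
        then show False using generous_budget_not_dead[of "initial_seg X n" "sched e" s] dead by simp
      next
        case False
        have "n \<noteq> 0"
        proof
          assume "n = 0"
          then have "initial_seg X n = []" by (simp add: initial_seg_def)
          with dead Alive_Nil[of s] show False unfolding dead_def by metis
        qed
        then have dies: "Dies s (initial_seg X n)"
          using dead less[of "n - 1" s] by (simp add: dies_def butlast_initial_seg)
        obtain z where z: "z < 2 ^ (i + 3)\<^sup>2" "\<And>j. j \<le> i \<Longrightarrow> digit z j = e j"
          using ex_digits[of i e] e_less by blast
        have "sched e m = sched (digit z) m" if "m \<le> length (initial_seg X n)" for m
        proof -
          have "floor_log (Suc m) \<le> i" unfolding i_def using that by (intro floor_log_le_iff) simp
          then show ?thesis using z(2) by (simp add: sched_def)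
        qed
        from dies_cong[of _ "sched e" "sched (digit z)", OF this] dies have "dies room rank (sched (digit z)) s (initial_seg X n)" by blast
        then show False using e_safe[of i] False z by (auto simp: safe_def i_def)
      qed
    qed
  qed
  then obtain Y where Y: "\<And>n s. Alive s (initial_seg X n) (initial_seg Y n)" using ex_close_random by blast
  have "martin_loef_random U Y" unfolding martin_loef_random_def
  proof (intro exI allI)
    fix n
    have "0 < room s (initial_seg Y n)" for s
    proof -
      have "1 \<le> room s (initial_seg Y n) ^ rank n * 2 ^ (sched e n - ham n (initial_seg X n) (initial_seg Y n))"
        using Y[of s n] by (auto simp: alive_def dest!: spec[of _ n])
      then have "room s (initial_seg Y n) \<noteq> 0" using r_pos[of n] by (auto simp: power_0_left)
      then show ?thesis using nonneg[of s "initial_seg Y n"] by linarith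
    qed
    then have len: "n \<le> length p" if "U p = Some (initial_seg Y n)" for p
      using room_pos_incompressible[OF _ that] by simp
    obtain p where "U p = Some (initial_seg Y n)" using optimal_description_length[OF assms] by blast
    then obtain q where "U q = Some (initial_seg Y n)" "length q = KC U (initial_seg Y n)"
      unfolding KC_def
      using LeastI[of "\<lambda>k. \<exists>p. U p = Some (initial_seg Y n) \<and> length p = k" "length p"] by auto
    then have "n \<le> KC U (initial_seg Y n)" using len[of q] by simp
    then show "real n - real 0 \<le> real (KC U (initial_seg Y n))" by simp
  qed
  moreover have "seq_dist X Y \<le> 1 / 2 - \<theta>"
  proof (rule seq_dist_le)
    fix \<epsilon> :: real assume \<epsilon>: "0 < \<epsilon>"
    define \<delta> where "\<delta> = 1 / 2 - \<theta> + \<epsilon> / 2"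
    have \<delta>0: "0 \<le> \<delta>" using \<theta> \<epsilon> by (simp add: \<delta>_def)
    obtain I1 where I1: "\<And>i k. I1 \<le> i \<Longrightarrow> \<delta> * 2 ^ i \<le> real k \<Longrightarrow> safe i k"
      using safe_ev[of \<delta>] \<epsilon> unfolding eventually_sequentially \<delta>_def by force
    have e_le: "e i \<le> \<delta> * 2 ^ i + 1" if "I0 \<le> i" "I1 \<le> i" for i
    proof -
      have "\<delta> * 2 ^ i \<le> real (nat \<lceil>\<delta> * 2 ^ i\<rceil>)" by linarith
      then have "e i \<le> nat \<lceil>\<delta> * 2 ^ i\<rceil>" using that by (intro e_least I1) auto
      moreover have "0 \<le> \<delta> * 2 ^ i" using \<delta>0 by simp
      ultimately show ?thesis by linarith
    qed
    have "\<forall>\<^sub>F n in sequentially. 3 \<le> \<epsilon> / 2 * real n" using \<epsilon> by real_asymp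
    then show "\<forall>\<^sub>F n in sequentially. ham n (initial_seg X n) (initial_seg Y n) \<le> (1 / 2 - \<theta> + \<epsilon>) * n"
      using eventually_ge_at_top[of "2 ^ (I0 + I1)"]
    proof eventually_elim
      case (elim n)
      define i where "i = floor_log (Suc n)"
      have "floor_log (2 ^ (I0 + I1)) \<le> i" unfolding i_def using elim(2) by (intro floor_log_le_iff) simp
      then have e: "e i \<le> \<delta> * 2 ^ i + 1" by (intro e_le) auto
      have n: "n \<le> 2 * 2 ^ i" using floor_log_exp2_gt[of "Suc n"] by (simp add: i_def)
      have "ham n (initial_seg X n) (initial_seg Y n) \<le> sched e n"
        using Y[of 0 n] by (simp add: alive_def)
      then have "real (ham n (initial_seg X n) (initial_seg Y n)) \<le> real (sched e n)" by simp
      also have "\<dots> \<le> 1 + real n * e i / 2 ^ i"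
        using of_nat_div_le_of_nat[of "n * e i" "2 ^ i", where ?'a = real] by (simp add: sched_def i_def)
      also have "\<dots> \<le> 1 + real n * (\<delta> * 2 ^ i + 1) / 2 ^ i"
        using e by (intro add_left_mono divide_right_mono mult_left_mono) auto
      also have "\<dots> = 1 + \<delta> * n + real n / 2 ^ i" by (simp add: field_simps)
      also have "real n / 2 ^ i \<le> 2"
      proof -
        have "real n \<le> real (2 * 2 ^ i)" using n by (subst of_nat_le_iff)
        then show ?thesis by (simp add: divide_le_eq)
      qed
      finally show ?case using elim(1) by (simp add: \<delta>_def algebra_simps)
    qed
  qed
  ultimately show ?thesis unfolding \<theta>_def by blast
qed

end
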